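(* Let $\lambda$ be a regular cardinal and let $\mathcal{K}$ be a pointed strongly $\lambda$-combinatorial model category. Then there is only a set (i.e. not a proper class) of distinct kernels $\ker H$, where $H$ ranges over all endofunctors $H\colon\mathcal{K}\to\mathcal{K}$ that preserve $\lambda$-filtered colimits and the zero object. (The endofunctors $H$ are not required to preserve weak equivalences.)
   Context: A model category is combinatorial if it is cofibrantly generated and its underlying category is locally presentable. For a model category $\mathcal{K}$, the homotopy category $\mathrm{Ho}\,\mathcal{K}$ is the quotient of the full subcategory $\mathcal{K}_{cf}$ of objects that are both fibrant and cofibrant by the homotopy relation on morphisms. A fibrant replacement functor $R_f$ is a functor with fibrant values equipped with a natural trivial cofibration $X\to R_fX$; a cofibrant replacement functor $R_c$ is a functor with cofibrant values equipped with a natural trivial fibration $R_cX\to X$. Such a choice gives the functor $P\colon\mathcal{K}\to\mathrm{Ho}\,\mathcal{K}$, the composite of $R_cR_f\colon\mathcal{K}\to\mathcal{K}_{cf}$ with the projection $\mathcal{K}_{cf}\to\mathrm{Ho}\,\mathcal{K}$. A small full subcategory $\mathcal{A}$ of a category $\mathcal{C}$ is a weak generator of $\mathcal{C}$ if an object $X$ of $\mathcal{C}$ is terminal whenever $\mathcal{C}(A,X)$ is a one-element set for every $A\in\mathcal{A}$. For a regular cardinal $\lambda$, a combinatorial model category $\mathcal{K}$ is strongly $\lambda$-combinatorial if: (1) $\mathcal{K}$ is locally $\lambda$-presentable; (2) there is a small weak generator of $\mathrm{Ho}\,\mathcal{K}$ consisting of objects that are $\lambda$-presentable in $\mathcal{K}$;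 (3) there are fibrant and cofibrant replacement functors $R_f$ and $R_c$ on $\mathcal{K}$ that preserve $\lambda$-filtered colimits and $\lambda$-presentable objects. It is assumed that $R_f$ and $R_c$ (and hence $P$) have been chosen as in (3). A model category is pointed if its initial object is also terminal; this zero object is denoted $0$, as is its image in $\mathrm{Ho}\,\mathcal{K}$. For an endofunctor $H\colon\mathcal{K}\to\mathcal{K}$, the kernel $\ker H$ is the class of objects $X$ of $\mathcal{K}$ such that $PHX$ is terminal in $\mathrm{Ho}\,\mathcal{K}$ (in the pointed case, $PHX\cong 0$). *)

theory Defs
  imports "HOL-Library.FuncSet"
begin

unbundle cardinal_syntax

section \<open>Size\<close>

text \<open>
  The distinction between sets and proper classes is rendered in the usual way by a universe.
  Here the universe is given by its cardinal \<open>\<kappa>\<close>, an uncountable strongly inaccessible one, and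
  ``is a set'' means ``has fewer than \<open>\<kappa>\<close> elements''.  Small categories used as shapes of diagrams
  have their objects and arrows in the type \<open>'u\<close> that carries \<open>\<kappa>\<close>; up to isomorphism these are all
  the small categories, since \<open>\<kappa>\<close> itself lives on \<open>'u\<close>.
\<close>

definition regular_cardinal :: "'u rel \<Rightarrow> bool" where
  "regular_cardinal r \<longleftrightarrow> Cinfinite r \<and> regularCard r"

definition inaccessible :: "'u rel \<Rightarrow> bool" where
  "inaccessible \<kappa> \<longleftrightarrow> regular_cardinal \<kappa> \<and> natLeq <o \<kappa> \<and>
     (\<forall>A :: 'u set. |A| <o \<kappa> \<longrightarrow> |Pow A| <o \<kappa>)"

definition small :: "'u rel \<Rightarrow> 'a set \<Rightarrow> bool" where
  "small \<kappa> A \<longleftrightarrow> |A| <o \<kappa>"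


section \<open>Categories and functors\<close>

record ('o, 'm) cat =
  Obj :: "'o set"
  Arr :: "'m set"
  Dom :: "'m \<Rightarrow> 'o"
  Cod :: "'m \<Rightarrow> 'o"
  Ide :: "'o \<Rightarrow> 'm"
  Cmp :: "'m \<Rightarrow> 'm \<Rightarrow> 'm"  \<comment> \<open>\<open>Cmp C g f\<close> is \<open>g\<close> after \<open>f\<close>\<close>

definition hom :: "('o, 'm, 'z) cat_scheme \<Rightarrow> 'o \<Rightarrow> 'o \<Rightarrow> 'm set" where
  "hom C X Y = {f \<in> Arr C. Dom C f = X \<and> Cod C f = Y}"

definition is_category :: "('o, 'm, 'z) cat_scheme \<Rightarrow> bool" where
  "is_category C \<longleftrightarrow>
     (\<forall>f\<in>Arr C. Dom C f \<in> Obj C \<and> Cod C f \<in> Obj C) \<and>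
     (\<forall>X\<in>Obj C. Ide C X \<in> hom C X X) \<and>
     (\<forall>f\<in>Arr C. \<forall>g\<in>Arr C. Cod C f = Dom C g \<longrightarrow> Cmp C g f \<in> hom C (Dom C f) (Cod C g)) \<and>
     (\<forall>f\<in>Arr C. Cmp C f (Ide C (Dom C f)) = f \<and> Cmp C (Ide C (Cod C f)) f = f) \<and>
     (\<forall>f\<in>Arr C. \<forall>g\<in>Arr C. \<forall>h\<in>Arr C. Cod C f = Dom C g \<longrightarrow> Cod C g = Dom C h \<longrightarrow>
        Cmp C h (Cmp C g f) = Cmp C (Cmp C h g) f)"

definition locally_small :: "'u rel \<Rightarrow> ('o, 'm, 'z) cat_scheme \<Rightarrow> bool" where
  "locally_small \<kappa> C \<longleftrightarrow> (\<forall>X\<in>Obj C. \<forall>Y\<in>Obj C. small \<kappa> (hom C X Y))"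

definition small_category :: "'u rel \<Rightarrow> ('o, 'm, 'z) cat_scheme \<Rightarrow> bool" where
  "small_category \<kappa> C \<longleftrightarrow> is_category C \<and> small \<kappa> (Obj C) \<and> small \<kappa> (Arr C)"

definition op_cat :: "('o, 'm, 'z) cat_scheme \<Rightarrow> ('o, 'm, 'z) cat_scheme" where
  "op_cat C = C\<lparr>Dom := Cod C, Cod := Dom C, Cmp := (\<lambda>g f. Cmp C f g)\<rparr>"

definition full_subcat :: "('o, 'm, 'z) cat_scheme \<Rightarrow> 'o set \<Rightarrow> ('o, 'm) cat" where
  "full_subcat C S = \<lparr>Obj = S, Arr = {f \<in> Arr C. Dom C f \<in> S \<and> Cod C f \<in> S},
     Dom = Dom C, Cod = Cod C, Ide = Ide C, Cmp = Cmp C\<rparr>"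

record ('o, 'm, 'p, 'n) ftor =
  onObj :: "'o \<Rightarrow> 'p"
  onArr :: "'m \<Rightarrow> 'n"

definition is_functor ::
  "('o, 'm, 'y) cat_scheme \<Rightarrow> ('p, 'n, 'z) cat_scheme \<Rightarrow> ('o, 'm, 'p, 'n) ftor \<Rightarrow> bool" where
  "is_functor C D F \<longleftrightarrow>
     (\<forall>X\<in>Obj C. onObj F X \<in> Obj D \<and> onArr F (Ide C X) = Ide D (onObj F X)) \<and>
     (\<forall>f\<in>Arr C. onArr F f \<in> hom D (onObj F (Dom C f)) (onObj F (Cod C f))) \<and>
     (\<forall>f\<in>Arr C. \<forall>g\<in>Arr C. Cod C f = Dom C g \<longrightarrow>
        onArr F (Cmp C g f) = Cmp D (onArr F g) (onArr F f))"

definition comp_ftor ::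
  "('p, 'n, 'q, 'k) ftor \<Rightarrow> ('o, 'm, 'p, 'n) ftor \<Rightarrow> ('o, 'm, 'q, 'k) ftor" where
  "comp_ftor G F = \<lparr>onObj = onObj G \<circ> onObj F, onArr = onArr G \<circ> onArr F\<rparr>"

definition id_ftor :: "('o, 'm, 'o, 'm) ftor" where
  "id_ftor = \<lparr>onObj = id, onArr = id\<rparr>"

definition nat_trans ::
  "('o, 'm, 'y) cat_scheme \<Rightarrow> ('p, 'n, 'z) cat_scheme \<Rightarrow>
   ('o, 'm, 'p, 'n) ftor \<Rightarrow> ('o, 'm, 'p, 'n) ftor \<Rightarrow> ('o \<Rightarrow> 'n) \<Rightarrow> bool" where
  "nat_trans C D F G \<tau> \<longleftrightarrow>
     (\<forall>X\<in>Obj C. \<tau> X \<in> hom D (onObj F X) (onObj G X)) \<and>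
     (\<forall>f\<in>Arr C. Cmp D (\<tau> (Cod C f)) (onArr F f) = Cmp D (onArr G f) (\<tau> (Dom C f)))"

definition terminal :: "('o, 'm, 'z) cat_scheme \<Rightarrow> 'o \<Rightarrow> bool" where
  "terminal C T \<longleftrightarrow> T \<in> Obj C \<and> (\<forall>X\<in>Obj C. \<exists>!f. f \<in> hom C X T)"

definition initial :: "('o, 'm, 'z) cat_scheme \<Rightarrow> 'o \<Rightarrow> bool" where
  "initial C I \<longleftrightarrow> I \<in> Obj C \<and> (\<forall>X\<in>Obj C. \<exists>!f. f \<in> hom C I X)"

definition zero_object :: "('o, 'm, 'z) cat_scheme \<Rightarrow> 'o \<Rightarrow> bool" where
  "zero_object C Z \<longleftrightarrow> initial C Z \<and> terminal C Z"

definition pointed :: "('o, 'm, 'z) cat_scheme \<Rightarrow> bool" where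
  "pointed C \<longleftrightarrow> (\<exists>Z. zero_object C Z)"

definition preserves_zero ::
  "('o, 'm, 'y) cat_scheme \<Rightarrow> ('p, 'n, 'z) cat_scheme \<Rightarrow> ('o, 'm, 'p, 'n) ftor \<Rightarrow> bool" where
  "preserves_zero C D F \<longleftrightarrow> (\<forall>Z. zero_object C Z \<longrightarrow> zero_object D (onObj F Z))"

definition weak_generator :: "'u rel \<Rightarrow> ('o, 'm, 'z) cat_scheme \<Rightarrow> 'o set \<Rightarrow> bool" where
  "weak_generator \<kappa> C \<A> \<longleftrightarrow> \<A> \<subseteq> Obj C \<and> small_category \<kappa> (full_subcat C \<A>) \<and>
     (\<forall>X\<in>Obj C. (\<forall>A\<in>\<A>. \<exists>!f. f \<in> hom C A X) \<longrightarrow> terminal C X)"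


section \<open>Colimits and presentability\<close>

definition cocone ::
  "('i, 'j, 'y) cat_scheme \<Rightarrow> ('o, 'm, 'z) cat_scheme \<Rightarrow> ('i, 'j, 'o, 'm) ftor \<Rightarrow>
   'o \<Rightarrow> ('i \<Rightarrow> 'm) \<Rightarrow> bool" where
  "cocone J C D X c \<longleftrightarrow> X \<in> Obj C \<and>
     (\<forall>j\<in>Obj J. c j \<in> hom C (onObj D j) X) \<and>
     (\<forall>u\<in>Arr J. Cmp C (c (Cod J u)) (onArr D u) = c (Dom J u))"

definition colimit ::
  "('i, 'j, 'y) cat_scheme \<Rightarrow> ('o, 'm, 'z) cat_scheme \<Rightarrow> ('i, 'j, 'o, 'm) ftor \<Rightarrow>
   'o \<Rightarrow> ('i \<Rightarrow> 'm) \<Rightarrow> bool" where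
  "colimit J C D X c \<longleftrightarrow> cocone J C D X c \<and>
     (\<forall>Y d. cocone J C D Y d \<longrightarrow>
        (\<exists>!h. h \<in> hom C X Y \<and> (\<forall>j\<in>Obj J. Cmp C h (c j) = d j)))"

definition cocomplete :: "'u rel \<Rightarrow> ('o, 'm, 'z) cat_scheme \<Rightarrow> bool" where
  "cocomplete \<kappa> C \<longleftrightarrow>
     (\<forall>(J :: ('u, 'u) cat) D. small_category \<kappa> J \<and> is_functor J C D \<longrightarrow> (\<exists>X c. colimit J C D X c))"

definition complete :: "'u rel \<Rightarrow> ('o, 'm, 'z) cat_scheme \<Rightarrow> bool" where
  "complete \<kappa> C \<longleftrightarrow> cocomplete \<kappa> (op_cat C)"

definition filtered :: "'u rel \<Rightarrow> ('u, 'u) cat \<Rightarrow> bool" where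
  "filtered lam J \<longleftrightarrow> is_category J \<and>
     (\<forall>(I :: ('u, 'u) cat) D. is_category I \<and> |Arr I| <o lam \<and> is_functor I J D \<longrightarrow>
        (\<exists>k c. cocone I J D k c))"

definition preserves_filtered_colimits ::
  "'u rel \<Rightarrow> 'u rel \<Rightarrow> ('o, 'm, 'y) cat_scheme \<Rightarrow> ('p, 'n, 'z) cat_scheme \<Rightarrow>
   ('o, 'm, 'p, 'n) ftor \<Rightarrow> bool" where
  "preserves_filtered_colimits \<kappa> lam C E F \<longleftrightarrow>
     (\<forall>(J :: ('u, 'u) cat) D X c.
        small_category \<kappa> J \<and> filtered lam J \<and> is_functor J C D \<and> colimit J C D X c \<longrightarrow>
        colimit J E (comp_ftor F D) (onObj F X) (onArr F \<circ> c))"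

text \<open>
  The category of small subsets of a type.  For a category with arrows in \<open>'m\<close> it is used over \<open>'m\<close>
  itself, where all hom-sets live.  Although the type may contain few small sets, no generality is
  lost in testing colimits of hom-sets there: a map of sets is already bijective if precomposition
  with it is bijective on maps into one fixed set with two elements (and a category with at most one
  arrow is trivial).
\<close>

definition set_cat :: "'u rel \<Rightarrow> ('a set, 'a set \<times> ('a \<Rightarrow> 'a) \<times> 'a set) cat" where
  "set_cat \<kappa> =
     \<lparr>Obj = {A. small \<kappa> A},
      Arr = {(A, f, B). small \<kappa> A \<and> small \<kappa> B \<and> f \<in> A \<rightarrow>\<^sub>E B},
      Dom = (\<lambda>(A, f, B). A),
      Cod = (\<lambda>(A, f, B). B),
      Ide = (\<lambda>A. (A, \<lambda>x\<in>A. x, A)),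
      Cmp = (\<lambda>(B, g, C) (A, f, B'). (A, compose A g f, C))\<rparr>"

definition hom_ftor ::
  "('o, 'm, 'z) cat_scheme \<Rightarrow> 'o \<Rightarrow> ('o, 'm, 'm set, 'm set \<times> ('m \<Rightarrow> 'm) \<times> 'm set) ftor" where
  "hom_ftor C A =
     \<lparr>onObj = hom C A,
      onArr = (\<lambda>f. (hom C A (Dom C f), \<lambda>g\<in>hom C A (Dom C f). Cmp C f g, hom C A (Cod C f)))\<rparr>"

definition presentable :: "'u rel \<Rightarrow> 'u rel \<Rightarrow> ('o, 'm, 'z) cat_scheme \<Rightarrow> 'o \<Rightarrow> bool" where
  "presentable \<kappa> lam C A \<longleftrightarrow> A \<in> Obj C \<and>
     preserves_filtered_colimits \<kappa> lam C (set_cat \<kappa>) (hom_ftor C A)"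

definition locally_presentable_at ::
  "'u rel \<Rightarrow> 'u rel \<Rightarrow> ('o, 'm, 'z) cat_scheme \<Rightarrow> bool" where
  "locally_presentable_at \<kappa> lam C \<longleftrightarrow>
     is_category C \<and> locally_small \<kappa> C \<and> cocomplete \<kappa> C \<and>
     (\<exists>S. small \<kappa> S \<and> (\<forall>A\<in>S. presentable \<kappa> lam C A) \<and>
        (\<forall>X\<in>Obj C. \<exists>(J :: ('u, 'u) cat) D c.
           small_category \<kappa> J \<and> filtered lam J \<and> is_functor J C D \<and>
           (\<forall>j\<in>Obj J. onObj D j \<in> S) \<and> colimit J C D X c))"

definition locally_presentable :: "'u rel \<Rightarrow> ('o, 'm, 'z) cat_scheme \<Rightarrow> bool" where
  "locally_presentable \<kappa> C \<longleftrightarrow>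
     (\<exists>\<mu> :: 'u rel. regular_cardinal \<mu> \<and> \<mu> <o \<kappa> \<and> locally_presentable_at \<kappa> \<mu> C)"


section \<open>Model categories\<close>

record ('o, 'm) model_cat = "('o, 'm) cat" +
  Weq :: "'m set"
  Cof :: "'m set"
  Fib :: "'m set"

definition op_model :: "('o, 'm, 'z) model_cat_scheme \<Rightarrow> ('o, 'm, 'z) model_cat_scheme" where
  "op_model K = (op_cat K)\<lparr>Cof := Fib K, Fib := Cof K\<rparr>"

definition retract_of :: "('o, 'm, 'z) cat_scheme \<Rightarrow> 'm \<Rightarrow> 'm \<Rightarrow> bool" where
  "retract_of C f g \<longleftrightarrow> f \<in> Arr C \<and> g \<in> Arr C \<and>
     (\<exists>i\<in>hom C (Dom C f) (Dom C g). \<exists>r\<in>hom C (Dom C g) (Dom C f).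
      \<exists>i'\<in>hom C (Cod C f) (Cod C g). \<exists>r'\<in>hom C (Cod C g) (Cod C f).
        Cmp C r i = Ide C (Dom C f) \<and> Cmp C r' i' = Ide C (Cod C f) \<and>
        Cmp C g i = Cmp C i' f \<and> Cmp C f r = Cmp C r' g)"

definition has_lift :: "('o, 'm, 'z) cat_scheme \<Rightarrow> 'm \<Rightarrow> 'm \<Rightarrow> bool" where
  "has_lift C i p \<longleftrightarrow>
     (\<forall>u\<in>hom C (Dom C i) (Dom C p). \<forall>v\<in>hom C (Cod C i) (Cod C p).
        Cmp C p u = Cmp C v i \<longrightarrow>
        (\<exists>h\<in>hom C (Cod C i) (Dom C p). Cmp C h i = u \<and> Cmp C p h = v))"

definition factors_through :: "('o, 'm, 'z) cat_scheme \<Rightarrow> 'm set \<Rightarrow> 'm set \<Rightarrow> bool" where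
  "factors_through C L R \<longleftrightarrow>
     (\<forall>f\<in>Arr C. \<exists>i\<in>L. \<exists>p\<in>R. Cod C i = Dom C p \<and> f = Cmp C p i)"

definition model_category :: "'u rel \<Rightarrow> ('o, 'm, 'z) model_cat_scheme \<Rightarrow> bool" where
  "model_category \<kappa> K \<longleftrightarrow>
     is_category K \<and> locally_small \<kappa> K \<and> complete \<kappa> K \<and> cocomplete \<kappa> K \<and>
     Weq K \<subseteq> Arr K \<and> Cof K \<subseteq> Arr K \<and> Fib K \<subseteq> Arr K \<and>
     (\<forall>f\<in>Arr K. \<forall>g\<in>Arr K. Cod K f = Dom K g \<longrightarrow>
        (f \<in> Weq K \<and> g \<in> Weq K \<longrightarrow> Cmp K g f \<in> Weq K) \<and>
        (f \<in> Weq K \<and> Cmp K g f \<in> Weq K \<longrightarrow> g \<in> Weq K) \<and>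
        (g \<in> Weq K \<and> Cmp K g f \<in> Weq K \<longrightarrow> f \<in> Weq K)) \<and>
     (\<forall>f g. retract_of K f g \<longrightarrow>
        (g \<in> Weq K \<longrightarrow> f \<in> Weq K) \<and> (g \<in> Cof K \<longrightarrow> f \<in> Cof K) \<and> (g \<in> Fib K \<longrightarrow> f \<in> Fib K)) \<and>
     (\<forall>i\<in>Cof K. \<forall>p\<in>Fib K. i \<in> Weq K \<or> p \<in> Weq K \<longrightarrow> has_lift K i p) \<and>
     factors_through K (Cof K \<inter> Weq K) (Fib K) \<and>
     factors_through K (Cof K) (Fib K \<inter> Weq K)"

definition injectives :: "('o, 'm, 'z) cat_scheme \<Rightarrow> 'm set \<Rightarrow> 'm set" where
  "injectives C I = {p \<in> Arr C. \<forall>i\<in>I. has_lift C i p}"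

text \<open>
  That the generating sets permit the small object argument is not listed among the conditions.
  The notion is only used for locally presentable categories, where every object is presentable,
  and hence small relative to any class of morphisms.
\<close>

definition cofibrantly_generated :: "'u rel \<Rightarrow> ('o, 'm, 'z) model_cat_scheme \<Rightarrow> bool" where
  "cofibrantly_generated \<kappa> K \<longleftrightarrow>
     (\<exists>I J. I \<subseteq> Arr K \<and> J \<subseteq> Arr K \<and> small \<kappa> I \<and> small \<kappa> J \<and>
        Fib K \<inter> Weq K = injectives K I \<and> Fib K = injectives K J)"

definition combinatorial :: "'u rel \<Rightarrow> ('o, 'm, 'z) model_cat_scheme \<Rightarrow> bool" where
  "combinatorial \<kappa> K \<longleftrightarrow>
     model_category \<kappa> K \<and> cofibrantly_generated \<kappa> K \<and> locally_presentable \<kappa> K"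

definition fibrant :: "('o, 'm, 'z) model_cat_scheme \<Rightarrow> 'o \<Rightarrow> bool" where
  "fibrant K X \<longleftrightarrow> X \<in> Obj K \<and> (\<exists>T. terminal K T \<and> (\<exists>f\<in>hom K X T. f \<in> Fib K))"

definition cofibrant :: "('o, 'm, 'z) model_cat_scheme \<Rightarrow> 'o \<Rightarrow> bool" where
  "cofibrant K X \<longleftrightarrow> X \<in> Obj K \<and> (\<exists>I. initial K I \<and> (\<exists>f\<in>hom K I X. f \<in> Cof K))"


section \<open>The homotopy category\<close>

definition coproduct ::
  "('o, 'm, 'z) cat_scheme \<Rightarrow> 'o \<Rightarrow> 'o \<Rightarrow> 'o \<Rightarrow> 'm \<Rightarrow> 'm \<Rightarrow> bool" where
  "coproduct C X Y S a b \<longleftrightarrow> S \<in> Obj C \<and> a \<in> hom C X S \<and> b \<in> hom C Y S \<and>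
     (\<forall>T\<in>Obj C. \<forall>f\<in>hom C X T. \<forall>g\<in>hom C Y T.
        \<exists>!h. h \<in> hom C S T \<and> Cmp C h a = f \<and> Cmp C h b = g)"

text \<open>A factorization of the fold map of \<open>X\<close> into the cofibration \<open>k\<close> followed by the weak
  equivalence \<open>s\<close>.\<close>

definition cylinder ::
  "('o, 'm, 'z) model_cat_scheme \<Rightarrow> 'o \<Rightarrow> 'o \<Rightarrow> 'm \<Rightarrow> 'm \<Rightarrow> 'm \<Rightarrow> bool" where
  "cylinder K X Cyl i0 i1 s \<longleftrightarrow>
     (\<exists>S a b. coproduct K X X S a b \<and>
        (\<exists>k\<in>hom K S Cyl \<inter> Cof K. i0 = Cmp K k a \<and> i1 = Cmp K k b)) \<and>
     s \<in> hom K Cyl X \<inter> Weq K \<and> Cmp K s i0 = Ide K X \<and> Cmp K s i1 = Ide K X"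

definition left_homotopic :: "('o, 'm, 'z) model_cat_scheme \<Rightarrow> 'm \<Rightarrow> 'm \<Rightarrow> bool" where
  "left_homotopic K f g \<longleftrightarrow> f \<in> Arr K \<and> g \<in> hom K (Dom K f) (Cod K f) \<and>
     (\<exists>Cyl i0 i1 s. cylinder K (Dom K f) Cyl i0 i1 s \<and>
        (\<exists>h\<in>hom K Cyl (Cod K f). Cmp K h i0 = f \<and> Cmp K h i1 = g))"

text \<open>Right homotopies, by means of path objects, are the left homotopies of the dual model
  category.\<close>

definition right_homotopic :: "('o, 'm, 'z) model_cat_scheme \<Rightarrow> 'm \<Rightarrow> 'm \<Rightarrow> bool" where
  "right_homotopic K f g \<longleftrightarrow> left_homotopic (op_model K) f g"

definition homotopy :: "('o, 'm, 'z) model_cat_scheme \<Rightarrow> 'm rel" where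
  "homotopy K = {(f, g). left_homotopic K f g \<and> right_homotopic K f g}"

text \<open>The quotient by a congruence \<open>r\<close>; arrows are the equivalence classes of \<open>r\<close>.\<close>

definition quotient_cat :: "('o, 'm, 'z) cat_scheme \<Rightarrow> 'm rel \<Rightarrow> ('o, 'm set) cat" where
  "quotient_cat C r =
     \<lparr>Obj = Obj C,
      Arr = Arr C // r,
      Dom = (\<lambda>F. the_elem (Dom C ` F)),
      Cod = (\<lambda>F. the_elem (Cod C ` F)),
      Ide = (\<lambda>X. r `` {Ide C X}),
      Cmp = (\<lambda>G F. \<Union>g\<in>G. \<Union>f\<in>F. r `` {Cmp C g f})\<rparr>"

definition quotient_ftor :: "'m rel \<Rightarrow> ('o, 'm, 'o, 'm set) ftor" where
  "quotient_ftor r = \<lparr>onObj = id, onArr = (\<lambda>f. r `` {f})\<rparr>"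

definition Kcf :: "('o, 'm, 'z) model_cat_scheme \<Rightarrow> ('o, 'm) cat" where
  "Kcf K = full_subcat K {X. fibrant K X \<and> cofibrant K X}"

definition Ho :: "('o, 'm, 'z) model_cat_scheme \<Rightarrow> ('o, 'm set) cat" where
  "Ho K = quotient_cat (Kcf K) (homotopy K)"


section \<open>Strongly combinatorial model categories and kernels\<close>

definition fibrant_replacement ::
  "('o, 'm, 'z) model_cat_scheme \<Rightarrow> ('o, 'm, 'o, 'm) ftor \<Rightarrow> bool" where
  "fibrant_replacement K R \<longleftrightarrow> is_functor K K R \<and> (\<forall>X\<in>Obj K. fibrant K (onObj R X)) \<and>
     (\<exists>\<eta>. nat_trans K K id_ftor R \<eta> \<and> (\<forall>X\<in>Obj K. \<eta> X \<in> Cof K \<inter> Weq K))"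

definition cofibrant_replacement ::
  "('o, 'm, 'z) model_cat_scheme \<Rightarrow> ('o, 'm, 'o, 'm) ftor \<Rightarrow> bool" where
  "cofibrant_replacement K R \<longleftrightarrow> is_functor K K R \<and> (\<forall>X\<in>Obj K. cofibrant K (onObj R X)) \<and>
     (\<exists>\<epsilon>. nat_trans K K R id_ftor \<epsilon> \<and> (\<forall>X\<in>Obj K. \<epsilon> X \<in> Fib K \<inter> Weq K))"

definition preserves_presentables ::
  "'u rel \<Rightarrow> 'u rel \<Rightarrow> ('o, 'm, 'z) cat_scheme \<Rightarrow> ('o, 'm, 'o, 'm) ftor \<Rightarrow> bool" where
  "preserves_presentables \<kappa> lam C F \<longleftrightarrow>
     (\<forall>X. presentable \<kappa> lam C X \<longrightarrow> presentable \<kappa> lam C (onObj F X))"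

definition strong_replacements ::
  "'u rel \<Rightarrow> 'u rel \<Rightarrow> ('o, 'm, 'z) model_cat_scheme \<Rightarrow>
   ('o, 'm, 'o, 'm) ftor \<Rightarrow> ('o, 'm, 'o, 'm) ftor \<Rightarrow> bool" where
  "strong_replacements \<kappa> lam K Rf Rc \<longleftrightarrow>
     fibrant_replacement K Rf \<and> cofibrant_replacement K Rc \<and>
     preserves_filtered_colimits \<kappa> lam K K Rf \<and> preserves_filtered_colimits \<kappa> lam K K Rc \<and>
     preserves_presentables \<kappa> lam K Rf \<and> preserves_presentables \<kappa> lam K Rc"

definition strongly_combinatorial ::
  "'u rel \<Rightarrow> 'u rel \<Rightarrow> ('o, 'm, 'z) model_cat_scheme \<Rightarrow> bool" where
  "strongly_combinatorial \<kappa> lam K \<longleftrightarrow>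
     combinatorial \<kappa> K \<and>
     locally_presentable_at \<kappa> lam K \<and>
     (\<exists>\<A>. weak_generator \<kappa> (Ho K) \<A> \<and> (\<forall>A\<in>\<A>. presentable \<kappa> lam K A)) \<and>
     (\<exists>Rf Rc. strong_replacements \<kappa> lam K Rf Rc)"

definition proj_Ho ::
  "('o, 'm, 'z) model_cat_scheme \<Rightarrow> ('o, 'm, 'o, 'm) ftor \<Rightarrow> ('o, 'm, 'o, 'm) ftor \<Rightarrow>
   ('o, 'm, 'o, 'm set) ftor" where
  "proj_Ho K Rf Rc = comp_ftor (quotient_ftor (homotopy K)) (comp_ftor Rc Rf)"

definition kernel ::
  "('o, 'm, 'z) model_cat_scheme \<Rightarrow> ('o, 'm, 'o, 'm) ftor \<Rightarrow> ('o, 'm, 'o, 'm) ftor \<Rightarrow>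
   ('o, 'm, 'o, 'm) ftor \<Rightarrow> 'o set" where
  "kernel K Rf Rc H =
     {X \<in> Obj K. terminal (Ho K) (onObj (comp_ftor (proj_Ho K Rf Rc) H) X)}"

end

theory Submission
  imports Defs
begin

text \<open>
  The argument is Ohkawa's.  Write \<open>Z = R\<^sub>c R\<^sub>f H\<close>.  Then \<open>X\<close> lies in the kernel of \<open>H\<close> iff any two maps
  from a generator \<open>A\<close> to \<open>Z X\<close> are homotopic, i.e. extend over one fixed cylinder \<open>B\<close> of \<open>A\<close>.  Choose a
  small set \<open>W\<close> so large that all generators and their cylinders are colimits of diagrams of
  \<open>\<lambda>\<close>-presentable objects with at most \<open>|W|\<close> arrows.  Every object \<open>X\<close> is the colimit of a
  diagram \<open>F\<close> over a poset in which any \<open>|W|\<close> elements have an upper bound, with values in one small set \<open>S'\<close>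
  of objects: \<open>X\<close> is a colimit of \<open>\<lambda>\<close>-presentable objects, and the poset consists of the subgraphs of that
  diagram with at most \<open>|W|\<close> arrows.  Maps and homotopies into \<open>Z X = colim Z F\<close> then factor through
  some stage \<open>Z F q\<close>, so the kernel is determined by the annihilators
  \<open>{u : Y \<rightarrow> Y' | Z u x and Z u x' are homotopic}\<close> of pairs \<open>x, x' : A \<rightarrow> Z Y\<close>, where \<open>Y\<close> and \<open>Y'\<close> are
  in \<open>S'\<close>.  There is only a small set of sets of such annihilators.
\<close>

section \<open>Smallness\<close>

text \<open>The obstacle is one of rank. A cylinder of a generator comes from an arbitrary
  factorization, so it may be presentable only for a cardinal larger than \<open>lam\<close>,
  whereas \<open>H\<close> is only known to preserve \<open>lam\<close>-filtered colimits. Diagrams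
  that are directed for the larger cardinal \<open>|W|\<close> reconcile the two: they are in
  particular \<open>lam\<close>-filtered, so that \<open>H\<close>, \<open>Rf\<close> and
  \<open>Rc\<close> preserve their colimits, and they are directed enough for generators and
  cylinders to be compact relative to them. The price is that the stages are no longer
  \<open>lam\<close>-presentable but colimits of graphs of such objects with at most
  \<open>|W|\<close> arrows; up to the choice of the colimit there is still only a small set of
  these.

  The second point is uniformity. The diagrams are chosen once, before any \<open>H\<close> is
  considered. The maps into stages live in hom-sets that vary with \<open>H\<close>, but their
  annihilators are subsets of one small set of arrows. Pointedness enters where terminality is
  expressed by pairs of maps: the zero object supplies a map from every generator, so only
  uniqueness up to homotopy has to be tested.\<close>

locale universe =
  fixes \<kappa> :: "'u rel"
  assumes inaccessible: "inaccessible \<kappa>"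
begin

lemma Cinfinite: "Cinfinite \<kappa>" and regularCard: "regularCard \<kappa>"
  using inaccessible unfolding inaccessible_def regular_cardinal_def by blast+

lemma Card_order: "Card_order \<kappa>" and infinite_Field: "infinite (Field \<kappa>)"
  using Cinfinite unfolding cinfinite_def by blast+

lemma infinite_UNIV: "infinite (UNIV :: 'u set)"
  using infinite_Field finite_subset[OF subset_UNIV] by blast

lemma small_subset: "small \<kappa> B \<Longrightarrow> A \<subseteq> B \<Longrightarrow> small \<kappa> A"
  unfolding small_def using card_of_mono1 ordLeq_ordLess_trans by blast

lemma small_image: "small \<kappa> A \<Longrightarrow> small \<kappa> (f ` A)"
  unfolding small_def using card_of_image ordLeq_ordLess_trans by blast

lemma small_finite: "finite A \<Longrightarrow> small \<kappa> A"
  unfolding small_def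
  by (rule Cfinite_ordLess_Cinfinite[OF _ Cinfinite]) (simp add: cfinite_def card_of_card_order_on Field_card_of)

lemma small_UN_index:
  fixes I :: "'u set"
  assumes "small \<kappa> I" "\<And>i. i \<in> I \<Longrightarrow> small \<kappa> (A i)"
  shows "small \<kappa> (\<Union>i\<in>I. A i)"
  using assms card_of_UNION_ordLess_infinite_Field_regularCard[OF regularCard Cinfinite, of I A]
  by (auto simp: small_def)

lemma small_embedding:
  assumes "small \<kappa> A"
  obtains e :: "'a \<Rightarrow> 'u" where "inj_on e A"
proof -
  have "|A| \<le>o |Field \<kappa>|"
    using ordLeq_ordIso_trans[OF ordLess_imp_ordLeq ordIso_symmetric[OF card_of_Field_ordIso[OF Card_order]]]
      assms by (simp add: small_def)
  then show ?thesis
    using that card_of_ordLeq[of A "Field \<kappa>"] by blast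
qed

text \<open>Regularity of \<kappa> is first applied to index sets inside its own carrier
  \<open>'u\<close>; a small index set of another type is moved there by an embedding.\<close>

lemma small_UN:
  fixes I :: "'b set"
  assumes "small \<kappa> I" "\<And>i. i \<in> I \<Longrightarrow> small \<kappa> (A i)"
  shows "small \<kappa> (\<Union>i\<in>I. A i)"
proof -
  obtain e :: "'b \<Rightarrow> 'u" where e: "inj_on e I" using small_embedding[OF assms(1)] .
  have "small \<kappa> (\<Union>i\<in>e ` I. A (inv_into I e i))"
    by (rule small_UN_index) (use assms e in \<open>auto intro: small_image\<close>)
  then show ?thesis using e by simp
qed

lemma small_Un: "small \<kappa> A \<Longrightarrow> small \<kappa> B \<Longrightarrow> small \<kappa> (A \<union> B)"
  unfolding small_def
  by (rule card_of_Un_ordLess_infinite_Field[OF infinite_Field Card_order])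

lemma small_Sigma:
  assumes "small \<kappa> A" "\<And>a. a \<in> A \<Longrightarrow> small \<kappa> (B a)"
  shows "small \<kappa> (Sigma A B)"
proof -
  have "Sigma A B = (\<Union>a\<in>A. Pair a ` B a)" by auto
  then show ?thesis using assms by (auto intro!: small_UN small_image)
qed

text \<open>That \<kappa> is a strong limit is stated for subsets of \<open>'u\<close>, hence the
  detour through the image of \<open>A\<close> under an embedding. The final count of annihilators
  rests on this.\<close>

lemma small_Pow:
  assumes "small \<kappa> A"
  shows "small \<kappa> (Pow A)"
proof -
  obtain e :: "'a \<Rightarrow> 'u" where e: "inj_on e A" using small_embedding[OF assms] .
  have "small \<kappa> (e ` A)" using assms by (rule small_image)
  then have "small \<kappa> (Pow (e ` A))"
    using inaccessible by (auto simp: small_def inaccessible_def)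
  then have "small \<kappa> ((\<lambda>B. inv_into A e ` B) ` Pow (e ` A))" by (rule small_image)
  moreover have "Pow A \<subseteq> (\<lambda>B. inv_into A e ` B) ` Pow (e ` A)"
  proof
    fix B assume "B \<in> Pow A"
    then show "B \<in> (\<lambda>B. inv_into A e ` B) ` Pow (e ` A)"
      using e by (intro image_eqI[where x = "e ` B"]) (auto simp: inv_into_image_cancel)
  qed
  ultimately show ?thesis by (rule small_subset)
qed

end

section \<open>Categories\<close>

locale category =
  fixes C :: "('o, 'm, 'z) cat_scheme"
  assumes is_category: "is_category C"
begin

abbreviation comp (infixl "\<cdot>" 70) where "g \<cdot> f \<equiv> Cmp C g f"

lemma Dom_Obj [simp]: "f \<in> Arr C \<Longrightarrow> Dom C f \<in> Obj C"
  and Cod_Obj [simp]: "f \<in> Arr C \<Longrightarrow> Cod C f \<in> Obj C"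
  and Ide_hom [simp]: "X \<in> Obj C \<Longrightarrow> Ide C X \<in> hom C X X"
  and comp_hom': "f \<in> Arr C \<Longrightarrow> g \<in> Arr C \<Longrightarrow> Cod C f = Dom C g \<Longrightarrow>
    g \<cdot> f \<in> hom C (Dom C f) (Cod C g)"
  and comp_Ide': "f \<in> Arr C \<Longrightarrow> f \<cdot> Ide C (Dom C f) = f"
  and Ide_comp': "f \<in> Arr C \<Longrightarrow> Ide C (Cod C f) \<cdot> f = f"
  and assoc': "f \<in> Arr C \<Longrightarrow> g \<in> Arr C \<Longrightarrow> h \<in> Arr C \<Longrightarrow> Cod C f = Dom C g \<Longrightarrow>
    Cod C g = Dom C h \<Longrightarrow> h \<cdot> (g \<cdot> f) = h \<cdot> g \<cdot> f"
  using is_category unfolding is_category_def by blast+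

lemma homD: "f \<in> hom C X Y \<Longrightarrow> f \<in> Arr C \<and> Dom C f = X \<and> Cod C f = Y \<and> X \<in> Obj C \<and> Y \<in> Obj C"
  using Dom_Obj Cod_Obj unfolding hom_def by blast

lemma hom_arr: "f \<in> Arr C \<Longrightarrow> f \<in> hom C (Dom C f) (Cod C f)"
  by (simp add: hom_def)

lemma Ide_Arr [simp]: "X \<in> Obj C \<Longrightarrow> Ide C X \<in> Arr C"
  and Dom_Ide [simp]: "X \<in> Obj C \<Longrightarrow> Dom C (Ide C X) = X"
  and Cod_Ide [simp]: "X \<in> Obj C \<Longrightarrow> Cod C (Ide C X) = X"
  using homD[OF Ide_hom[of X]] by blast+

lemma comp_hom: "f \<in> hom C X Y \<Longrightarrow> g \<in> hom C Y Z \<Longrightarrow> g \<cdot> f \<in> hom C X Z"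
  using comp_hom'[of f g] by (simp add: hom_def)

lemma comp_Ide [simp]: "f \<in> hom C X Y \<Longrightarrow> f \<cdot> Ide C X = f"
  and Ide_comp [simp]: "f \<in> hom C X Y \<Longrightarrow> Ide C Y \<cdot> f = f"
  using comp_Ide'[of f] Ide_comp'[of f] by (simp_all add: hom_def)

lemma assoc:
  "f \<in> hom C W X \<Longrightarrow> g \<in> hom C X Y \<Longrightarrow> h \<in> hom C Y Z \<Longrightarrow> h \<cdot> g \<cdot> f = h \<cdot> (g \<cdot> f)"
  using assoc'[of f g h] by (simp add: hom_def)

lemma terminal_unique:
  assumes "terminal C T" "f \<in> hom C X T" "g \<in> hom C X T"
  shows "f = g"
proof -
  have "\<exists>!h. h \<in> hom C X T" using assms homD[OF assms(2)] by (auto simp: terminal_def)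
  then show ?thesis using assms by blast
qed

end

lemma op_cat_simps [simp]:
  "Obj (op_cat C) = Obj C" "Arr (op_cat C) = Arr C" "Dom (op_cat C) = Cod C"
  "Cod (op_cat C) = Dom C" "Ide (op_cat C) = Ide C" "Cmp (op_cat C) g f = Cmp C f g"
  "hom (op_cat C) X Y = hom C Y X" "op_cat (op_cat C) = C"
  by (auto simp: op_cat_def hom_def)

lemma is_functor_hom:
  assumes "is_functor C D F" "f \<in> hom C X Y"
  shows "onArr F f \<in> hom D (onObj F X) (onObj F Y)"
  using assms unfolding is_functor_def hom_def by auto

lemma is_functor_comp:
  assumes "is_functor C D F" "f \<in> hom C X Y" "g \<in> hom C Y Z"
  shows "onArr F (Cmp C g f) = Cmp D (onArr F g) (onArr F f)"
  using assms by (auto simp: is_functor_def hom_def)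

lemma comp_ftor_simps [simp]:
  "onObj (comp_ftor G F) X = onObj G (onObj F X)" "onArr (comp_ftor G F) f = onArr G (onArr F f)"
  by (simp_all add: comp_ftor_def)

lemma is_functor_comp_ftor:
  assumes "is_functor C D F" "is_functor D E G"
  shows "is_functor C E (comp_ftor G F)"
  using assms unfolding is_functor_def by (simp add: hom_def)

lemma preserves_filtered_colimits_comp_ftor:
  assumes "preserves_filtered_colimits \<kappa> lam C D F" "is_functor C D F"
    and "preserves_filtered_colimits \<kappa> lam D E G"
  shows "preserves_filtered_colimits \<kappa> lam C E (comp_ftor G F)"
  unfolding preserves_filtered_colimits_def
proof (intro allI impI, elim conjE)
  fix J :: "('a, 'a) cat" and X c and H :: "('a, 'a, 'b, 'c) ftor"
  assume "small_category \<kappa> J" "filtered lam J" "is_functor J C H" "colimit J C H X c"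
  then have "colimit J E (comp_ftor G (comp_ftor F H)) (onObj G (onObj F X)) (onArr G \<circ> (onArr F \<circ> c))"
    using assms(1)[unfolded preserves_filtered_colimits_def, rule_format, of J H X c]
      assms(3)[unfolded preserves_filtered_colimits_def, rule_format,
        of J "comp_ftor F H" "onObj F X" "onArr F \<circ> c"]
      is_functor_comp_ftor[of J C H D F] assms(2) by simp
  then show "colimit J E (comp_ftor (comp_ftor G F) H) (onObj (comp_ftor G F) X) (onArr (comp_ftor G F) \<circ> c)"
    by (simp add: comp_ftor_def comp_assoc)
qed

section \<open>Model categories\<close>

lemma op_model_simps [simp]:
  "Obj (op_model K) = Obj K" "Arr (op_model K) = Arr K" "Dom (op_model K) = Cod K"
  "Cod (op_model K) = Dom K" "Ide (op_model K) = Ide K" "Cmp (op_model K) g f = Cmp K f g"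
  "Weq (op_model K) = Weq K" "Cof (op_model K) = Fib K" "Fib (op_model K) = Cof K"
  "hom (op_model K) X Y = hom K Y X" "op_model (op_model K) = K"
  by (auto simp: op_cat_def op_model_def hom_def)

lemma colimit_cong:
  assumes "Obj C = Obj C'" "Arr C = Arr C'" "Dom C = Dom C'" "Cod C = Cod C'"
    and "\<And>g f. Cmp C g f = Cmp C' g f"
  shows "colimit J C D X c = colimit J C' D X c"
  using assms by (simp add: colimit_def cocone_def hom_def)

lemma is_functor_cong:
  assumes "Obj C = Obj C'" "Arr C = Arr C'" "Dom C = Dom C'" "Cod C = Cod C'"
    and "Ide C = Ide C'" "\<And>g f. Cmp C g f = Cmp C' g f"
  shows "is_functor J C D = is_functor J C' D"
  using assms by (simp add: is_functor_def hom_def)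

text \<open>In \<open>op_cat (op_model K)\<close> the cofibrations and fibrations are still
  exchanged, so it is not the record \<open>K\<close> itself. Cocompleteness sees only the category
  fields, and on these the two agree.\<close>

lemma cocomplete_cong:
  fixes \<kappa> :: "'u rel"
  assumes "Obj C = Obj C'" "Arr C = Arr C'" "Dom C = Dom C'" "Cod C = Cod C'"
    and "Ide C = Ide C'" "\<And>g f. Cmp C g f = Cmp C' g f"
  shows "cocomplete \<kappa> C = cocomplete \<kappa> C'"
proof -
  have "colimit J C D X c = colimit J C' D X c" "is_functor J C D = is_functor J C' D"
    for J :: "('u, 'u) cat" and D X c
    by (rule colimit_cong is_functor_cong; rule assms)+
  then show ?thesis by (simp add: cocomplete_def)
qed

locale model = category K for K :: "('o, 'm, 'z) model_cat_scheme" +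
  fixes \<kappa> :: "'u rel"
  assumes model: "model_category \<kappa> K"
begin

notation comp (infixl "\<cdot>" 70)

lemma Weq_Arr: "f \<in> Weq K \<Longrightarrow> f \<in> Arr K"
  and Cof_Arr: "f \<in> Cof K \<Longrightarrow> f \<in> Arr K"
  and Fib_Arr: "f \<in> Fib K \<Longrightarrow> f \<in> Arr K"
  and has_lift: "i \<in> Cof K \<Longrightarrow> p \<in> Fib K \<Longrightarrow> i \<in> Weq K \<or> p \<in> Weq K \<Longrightarrow> has_lift K i p"
  and Cof_retract: "retract_of K f g \<Longrightarrow> g \<in> Cof K \<Longrightarrow> f \<in> Cof K"
  and factors_TCof_Fib: "factors_through K (Cof K \<inter> Weq K) (Fib K)"
  and factors_Cof_TFib: "factors_through K (Cof K) (Fib K \<inter> Weq K)"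
  and cocomplete: "cocomplete \<kappa> K"
  using model unfolding model_category_def by blast+

lemma Weq_2_of_3:
  assumes "f \<in> hom K X Y" "g \<in> hom K Y Z"
  shows "f \<in> Weq K \<Longrightarrow> g \<in> Weq K \<Longrightarrow> g \<cdot> f \<in> Weq K"
    and "f \<in> Weq K \<Longrightarrow> g \<cdot> f \<in> Weq K \<Longrightarrow> g \<in> Weq K"
    and "g \<in> Weq K \<Longrightarrow> g \<cdot> f \<in> Weq K \<Longrightarrow> f \<in> Weq K"
proof -
  have "\<forall>f\<in>Arr K. \<forall>g\<in>Arr K. Cod K f = Dom K g \<longrightarrow>
        (f \<in> Weq K \<and> g \<in> Weq K \<longrightarrow> g \<cdot> f \<in> Weq K) \<and>
        (f \<in> Weq K \<and> g \<cdot> f \<in> Weq K \<longrightarrow> g \<in> Weq K) \<and>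
        (g \<in> Weq K \<and> g \<cdot> f \<in> Weq K \<longrightarrow> f \<in> Weq K)"
    using model unfolding model_category_def by (elim conjE)
  moreover have "f \<in> Arr K" "g \<in> Arr K" "Cod K f = Dom K g"
    using homD[OF assms(1)] homD[OF assms(2)] by simp_all
  ultimately show "f \<in> Weq K \<Longrightarrow> g \<in> Weq K \<Longrightarrow> g \<cdot> f \<in> Weq K"
    and "f \<in> Weq K \<Longrightarrow> g \<cdot> f \<in> Weq K \<Longrightarrow> g \<in> Weq K"
    and "g \<in> Weq K \<Longrightarrow> g \<cdot> f \<in> Weq K \<Longrightarrow> f \<in> Weq K"
    by blast+
qed

lemma factor_TCof_Fib:
  assumes "f \<in> hom K X Y"
  obtains Z i p where "i \<in> hom K X Z" "p \<in> hom K Z Y" "i \<in> Cof K" "i \<in> Weq K" "p \<in> Fib K" "f = p \<cdot> i"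
proof -
  obtain i p where *: "i \<in> Cof K" "i \<in> Weq K" "p \<in> Fib K" "Cod K i = Dom K p" "f = p \<cdot> i"
    using factors_TCof_Fib homD[OF assms] unfolding factors_through_def by blast
  then have "p \<cdot> i \<in> hom K (Dom K i) (Cod K p)"
    using Fib_Arr Cof_Arr comp_hom' by blast
  then have "Dom K i = X" "Cod K p = Y" using * assms homD by metis+
  then show ?thesis using * that[of i "Cod K i" p] Fib_Arr Cof_Arr by (simp add: hom_def)
qed

lemma factor_Cof_TFib:
  assumes "f \<in> hom K X Y"
  obtains Z i p where "i \<in> hom K X Z" "p \<in> hom K Z Y" "i \<in> Cof K" "p \<in> Fib K" "p \<in> Weq K" "f = p \<cdot> i"
proof -
  obtain i p where *: "i \<in> Cof K" "p \<in> Weq K" "p \<in> Fib K" "Cod K i = Dom K p" "f = p \<cdot> i"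
    using factors_Cof_TFib homD[OF assms] unfolding factors_through_def by blast
  then have "p \<cdot> i \<in> hom K (Dom K i) (Cod K p)"
    using Fib_Arr Cof_Arr comp_hom' by blast
  then have "Dom K i = X" "Cod K p = Y" using * assms homD by metis+
  then show ?thesis using * that[of i "Cod K i" p] Fib_Arr Cof_Arr by (simp add: hom_def)
qed

lemma lift:
  assumes "has_lift K i p" "i \<in> hom K A B" "p \<in> hom K X Y" "u \<in> hom K A X" "v \<in> hom K B Y"
    and "p \<cdot> u = v \<cdot> i"
  obtains h where "h \<in> hom K B X" "h \<cdot> i = u" "p \<cdot> h = v"
  using assms homD[OF assms(2)] homD[OF assms(3)] unfolding has_lift_def by blast

text \<open>The retract argument.\<close>

lemma Cof_of_has_lift:
  assumes i: "i \<in> hom K A B" and lifts: "\<And>p. p \<in> Fib K \<Longrightarrow> p \<in> Weq K \<Longrightarrow> has_lift K i p"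
  shows "i \<in> Cof K"
proof -
  obtain Z j q where j: "j \<in> hom K A Z" "j \<in> Cof K" and q: "q \<in> hom K Z B" "q \<in> Fib K" "q \<in> Weq K"
    and "i = q \<cdot> j"
    using factor_Cof_TFib[OF i] .
  have B: "B \<in> Obj K" "A \<in> Obj K" using homD[OF i] by auto
  obtain h where h: "h \<in> hom K B Z" "h \<cdot> i = j" "q \<cdot> h = Ide K B"
    by (rule lift[OF lifts[OF q(2,3)] i q(1) j(1), of "Ide K B"]) (use \<open>i = q \<cdot> j\<close> i B in auto)
  have "retract_of K i j"
    unfolding retract_of_def
    by (intro conjI bexI[of _ "Ide K A"] bexI[of _ h] bexI[of _ q])
      (use homD[OF i] homD[OF j(1)] h j(1) q(1) B i \<open>i = q \<cdot> j\<close> in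
        \<open>simp_all add: comp_Ide[of "Ide K A" A A] comp_Ide[of i A B] comp_Ide[of j A Z]\<close>)
  then show ?thesis using Cof_retract j by blast
qed

text \<open>Identities are not listed among the axioms. For a trivial cofibration \<open>i\<close>
  out of \<open>X\<close>, which the factorization provides, \<open>i \<cdot> Ide K X = i\<close>,
  and two-out-of-three applies.\<close>

lemma Weq_Ide:
  assumes "X \<in> Obj K"
  shows "Ide K X \<in> Weq K"
proof -
  obtain Z i p where i: "i \<in> hom K X Z" "i \<in> Weq K" and p: "p \<in> hom K Z X" "Ide K X = p \<cdot> i"
    using factor_TCof_Fib[OF Ide_hom[OF assms]] by metis
  have "i \<cdot> Ide K X \<in> Weq K" using comp_Ide[OF i(1)] i(2) by simp
  then show ?thesis using Weq_2_of_3(3)[OF Ide_hom[OF assms] i(1)] i by blast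
qed

text \<open>The axioms are self-dual once cofibrations and fibrations are exchanged. Facts about
  cylinders and cofibrations thereby give facts about path objects and fibrations, which is how
  right homotopies are handled.\<close>

lemma model_category_op: "model_category \<kappa> (op_model K)"
proof -
  have co: "cocomplete \<kappa> (op_cat (op_model K))" "cocomplete \<kappa> (op_model K)"
    using model cocomplete_cong[of "op_cat (op_model K)" K \<kappa>] cocomplete_cong[of "op_model K" "op_cat K" \<kappa>]
    by (simp_all add: model_category_def complete_def)
  have lift: "has_lift (op_model K) i p" if "has_lift K p i" for i p
    using that unfolding has_lift_def by (simp) metis
  have fact: "factors_through (op_model K) R L" if "factors_through K L R" for L R
    using that unfolding factors_through_def by simp metis
  have retr: "retract_of K f g" if op: "retract_of (op_model K) f g" for f g
  proof -
    obtain i r i' r' where *: "f \<in> Arr K" "g \<in> Arr K" "i \<in> hom K (Cod K g) (Cod K f)" "r \<in> hom K (Cod K f) (Cod K g)"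
       "i' \<in> hom K (Dom K g) (Dom K f)" "r' \<in> hom K (Dom K f) (Dom K g)" "i \<cdot> r = Ide K (Cod K f)"
       "i' \<cdot> r' = Ide K (Dom K f)" "i \<cdot> g = f \<cdot> i'" "r \<cdot> f = g \<cdot> r'"
      using op unfolding retract_of_def op_model_simps by blast
    then show ?thesis unfolding retract_of_def
      by (intro conjI bexI[of _ r'] bexI[of _ i'] bexI[of _ r] bexI[of _ i]) (use * in \<open>simp_all only:\<close>)
  qed
  have ls: "locally_small \<kappa> (op_model K)"
    using model by (simp add: model_category_def locally_small_def)
  have cat: "is_category (op_model K)"
    unfolding is_category_def using comp_hom' by (simp add: comp_Ide' Ide_comp' assoc')
  have w: "(f \<in> Weq K \<and> g \<in> Weq K \<longrightarrow> f \<cdot> g \<in> Weq K) \<and> (f \<in> Weq K \<and> f \<cdot> g \<in> Weq K \<longrightarrow> g \<in> Weq K) \<and>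
      (g \<in> Weq K \<and> f \<cdot> g \<in> Weq K \<longrightarrow> f \<in> Weq K)"
    if "f \<in> Arr K" "g \<in> Arr K" "Dom K f = Cod K g" for f g
    using Weq_2_of_3[OF hom_arr[OF that(2)], of f "Cod K f"] that by (auto simp: hom_def)
  have r: "(g \<in> Weq K \<longrightarrow> f \<in> Weq K) \<and> (g \<in> Fib K \<longrightarrow> f \<in> Fib K) \<and> (g \<in> Cof K \<longrightarrow> f \<in> Cof K)"
    if "retract_of (op_model K) f g" for f g
    using retr[OF that] model unfolding model_category_def by blast
  have l: "has_lift (op_model K) i p"
    if "i \<in> Fib K" "p \<in> Cof K" "i \<in> Weq K \<or> p \<in> Weq K" for i p
    using that lift has_lift by blast
  have "factors_through (op_model K) (Fib K \<inter> Weq K) (Cof K)"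
      "factors_through (op_model K) (Fib K) (Cof K \<inter> Weq K)"
    using fact factors_TCof_Fib factors_Cof_TFib by blast+
  moreover have "Weq K \<subseteq> Arr K" "Cof K \<subseteq> Arr K" "Fib K \<subseteq> Arr K"
    using Weq_Arr Cof_Arr Fib_Arr by blast+
  moreover have "\<forall>f\<in>Arr K. \<forall>g\<in>Arr K. Dom K f = Cod K g \<longrightarrow>
        (f \<in> Weq K \<and> g \<in> Weq K \<longrightarrow> f \<cdot> g \<in> Weq K) \<and>
        (f \<in> Weq K \<and> f \<cdot> g \<in> Weq K \<longrightarrow> g \<in> Weq K) \<and>
        (g \<in> Weq K \<and> f \<cdot> g \<in> Weq K \<longrightarrow> f \<in> Weq K)"
    by (intro ballI impI w)
  moreover have "\<forall>f g. retract_of (op_model K) f g \<longrightarrow>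
      (g \<in> Weq K \<longrightarrow> f \<in> Weq K) \<and> (g \<in> Fib K \<longrightarrow> f \<in> Fib K) \<and> (g \<in> Cof K \<longrightarrow> f \<in> Cof K)"
    by (intro allI impI r)
  moreover have "\<forall>i\<in>Fib K. \<forall>p\<in>Cof K. i \<in> Weq K \<or> p \<in> Weq K \<longrightarrow> has_lift (op_model K) i p"
    by (intro ballI impI l)
  ultimately show ?thesis
    using co ls cat unfolding model_category_def complete_def op_model_simps
    by (intro conjI)
qed

lemma model_op: "model (op_model K) \<kappa>"
proof unfold_locales
  show "is_category (op_model K)"
    using model_category_op unfolding model_category_def by blast
qed (rule model_category_op)

lemma Fib_of_has_lift:
  assumes "p \<in> hom K A B" "\<And>i. i \<in> Cof K \<Longrightarrow> i \<in> Weq K \<Longrightarrow> has_lift K i p"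
  shows "p \<in> Fib K"
proof -
  have "has_lift (op_model K) p i" if "has_lift K i p" for i
    using that unfolding has_lift_def by simp metis
  then show ?thesis
    using model.Cof_of_has_lift[OF model_op, of p B A] assms by simp
qed

text \<open>A lift is found in two stages, first against \<open>g\<close> and then against
  \<open>f\<close>. This is what later makes the cofibrant replacement of a fibrant object fibrant
  again.\<close>

lemma Fib_comp:
  assumes f: "f \<in> hom K X Y" "f \<in> Fib K" and g: "g \<in> hom K Y Z" "g \<in> Fib K"
  shows "g \<cdot> f \<in> Fib K"
proof (rule Fib_of_has_lift)
  show gf: "g \<cdot> f \<in> hom K X Z" using f g by (blast intro: comp_hom)
  fix i assume i: "i \<in> Cof K" "i \<in> Weq K"
  then have ih: "i \<in> hom K (Dom K i) (Cod K i)" by (simp add: Cof_Arr hom_arr)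
  show "has_lift K i (g \<cdot> f)"
    unfolding has_lift_def
  proof (intro ballI impI)
    fix u v assume "u \<in> hom K (Dom K i) (Dom K (g \<cdot> f))" "v \<in> hom K (Cod K i) (Cod K (g \<cdot> f))"
      and eq: "g \<cdot> f \<cdot> u = v \<cdot> i"
    then have u: "u \<in> hom K (Dom K i) X" and v: "v \<in> hom K (Cod K i) Z" using homD[OF gf] by auto
    have "g \<cdot> (f \<cdot> u) = v \<cdot> i" using eq assoc[OF u f(1) g(1)] by simp
    then obtain w where w: "w \<in> hom K (Cod K i) Y" "w \<cdot> i = f \<cdot> u" "g \<cdot> w = v"
      using lift[OF has_lift[OF i(1) g(2)] ih g(1) comp_hom[OF u f(1)] v] i by blast
    obtain h where h: "h \<in> hom K (Cod K i) X" "h \<cdot> i = u" "f \<cdot> h = w"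
      using lift[OF has_lift[OF i(1) f(2)] ih f(1) u w(1)] w i by metis
    then show "\<exists>h\<in>hom K (Cod K i) (Dom K (g \<cdot> f)). h \<cdot> i = u \<and> g \<cdot> f \<cdot> h = v"
      using assoc[OF h(1) f(1) g(1)] w homD[OF gf] by auto
  qed
qed

end

section \<open>Homotopy\<close>

definition good_cylinder ::
  "('o, 'm, 'z) model_cat_scheme \<Rightarrow> 'o \<Rightarrow> 'o \<Rightarrow> 'm \<Rightarrow> 'm \<Rightarrow> 'm \<Rightarrow> bool" where
  "good_cylinder K X Cyl i0 i1 s \<longleftrightarrow> cylinder K X Cyl i0 i1 s \<and> s \<in> Fib K"

lemma coproductD:
  assumes "coproduct C X Y S a b"
  shows "a \<in> hom C X S" "b \<in> hom C Y S"
    and "T \<in> Obj C \<Longrightarrow> f \<in> hom C X T \<Longrightarrow> g \<in> hom C Y T \<Longrightarrow>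
      \<exists>h\<in>hom C S T. Cmp C h a = f \<and> Cmp C h b = g"
    and "T \<in> Obj C \<Longrightarrow> h \<in> hom C S T \<Longrightarrow> h' \<in> hom C S T \<Longrightarrow> Cmp C h a \<in> hom C X T \<Longrightarrow>
      Cmp C h b \<in> hom C Y T \<Longrightarrow> Cmp C h a = Cmp C h' a \<Longrightarrow> Cmp C h b = Cmp C h' b \<Longrightarrow> h = h'"
  using assms unfolding coproduct_def by (blast, blast, blast, metis)

locale model_in_universe = universe \<kappa> + model K \<kappa>
  for \<kappa> :: "'u rel" and K :: "('o, 'm, 'z) model_cat_scheme"
begin

notation comp (infixl "\<cdot>" 70)

lemma model_in_universe_op: "model_in_universe \<kappa> (op_model K)"
  by (intro model_in_universe.intro model_op universe_axioms)

section \<open>Cylinders and homotopies\<close>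

lemma ex_coproduct:
  assumes "X \<in> Obj K" "Y \<in> Obj K"
  shows "\<exists>S a b. coproduct K X Y S a b"
proof -
  obtain u v :: 'u where uv: "u \<noteq> v"
    using infinite_UNIV by (metis finite.emptyI finite_insert finite_subset insertCI subsetI UNIV_I ex_new_if_finite)
  \<comment> \<open>The discrete category on two elements of the carrier; each element serves as its
    own identity arrow.\<close>
  define J :: "('u, 'u) cat" where
    "J = \<lparr>Obj = {u, v}, Arr = {u, v}, Dom = id, Cod = id, Ide = id, Cmp = (\<lambda>g f. f)\<rparr>"
  define D where "D = \<lparr>onObj = (\<lambda>i. if i = u then X else Y), onArr = (\<lambda>i. Ide K (if i = u then X else Y))\<rparr>"
  have "small_category \<kappa> J"
    by (auto simp: small_category_def J_def is_category_def hom_def intro!: small_finite)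
  moreover have "is_functor J K D"
    using assms by (auto simp: is_functor_def J_def D_def Ide_comp[of _ X X] Ide_comp[of _ Y Y])
  ultimately obtain S c where S: "colimit J K D S c"
    using cocomplete unfolding cocomplete_def by blast
  have cocone: "cocone J K D T d \<longleftrightarrow> T \<in> Obj K \<and> d u \<in> hom K X T \<and> d v \<in> hom K Y T" for T d
    using uv comp_Ide[of "d u" X T] comp_Ide[of "d v" Y T] by (auto simp: cocone_def J_def D_def)
  have "coproduct K X Y S (c u) (c v)"
    unfolding coproduct_def
  proof (intro conjI ballI)
    show "S \<in> Obj K" "c u \<in> hom K X S" "c v \<in> hom K Y S"
      using S by (auto simp: colimit_def cocone)
    fix T f g assume "T \<in> Obj K" "f \<in> hom K X T" "g \<in> hom K Y T"
    then have "cocone J K D T (\<lambda>i. if i = u then f else g)" using uv by (simp add: cocone)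
    then have "\<exists>!h. h \<in> hom K S T \<and> (\<forall>j\<in>Obj J. h \<cdot> c j = (if j = u then f else g))"
      using S unfolding colimit_def by blast
    then show "\<exists>!h. h \<in> hom K S T \<and> h \<cdot> c u = f \<and> h \<cdot> c v = g"
      using uv by (simp add: J_def)
  qed
  then show ?thesis by blast
qed

lemma ex_good_cylinder:
  assumes A: "A \<in> Obj K"
  shows "\<exists>Cyl i0 i1 s. good_cylinder K A Cyl i0 i1 s"
proof -
  obtain S a b where S: "coproduct K A A S a b" using ex_coproduct[OF A A] by blast
  note ab = coproductD(1,2)[OF S]
  obtain n where n: "n \<in> hom K S A" "n \<cdot> a = Ide K A" "n \<cdot> b = Ide K A"
    using coproductD(3)[OF S A Ide_hom[OF A] Ide_hom[OF A]] by blast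
  obtain Z k s where k: "k \<in> hom K S Z" "k \<in> Cof K" and s: "s \<in> hom K Z A" "s \<in> Fib K" "s \<in> Weq K"
    and eq: "n = s \<cdot> k"
    by (rule factor_Cof_TFib[OF n(1)])
  have "cylinder K A Z (k \<cdot> a) (k \<cdot> b) s"
    unfolding cylinder_def
    using S k s n(2,3) assoc[OF ab(1) k(1) s(1)] assoc[OF ab(2) k(1) s(1)] eq by auto
  then show ?thesis using s by (auto simp: good_cylinder_def)
qed

lemma cylinder_hom:
  assumes "cylinder K A Cyl i0 i1 s"
  shows "i0 \<in> hom K A Cyl" "i1 \<in> hom K A Cyl" "s \<in> hom K Cyl A" "s \<in> Weq K"
    "s \<cdot> i0 = Ide K A" "s \<cdot> i1 = Ide K A"
proof -
  obtain S a b k where S: "coproduct K A A S a b" and k: "k \<in> hom K S Cyl"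
    and i: "i0 = k \<cdot> a" "i1 = k \<cdot> b"
    using assms unfolding cylinder_def by blast
  show "i0 \<in> hom K A Cyl" "i1 \<in> hom K A Cyl"
    unfolding i using comp_hom[OF coproductD(1)[OF S] k] comp_hom[OF coproductD(2)[OF S] k] .
  show "s \<in> hom K Cyl A" "s \<in> Weq K" "s \<cdot> i0 = Ide K A" "s \<cdot> i1 = Ide K A"
    using assms unfolding cylinder_def by blast+
qed

lemma left_homotopic_refl:
  assumes "f \<in> Arr K"
  shows "left_homotopic K f f"
proof -
  obtain Cyl i0 i1 s where cyl: "cylinder K (Dom K f) Cyl i0 i1 s"
    using ex_good_cylinder[of "Dom K f"] assms by (auto simp: good_cylinder_def)
  note * = cylinder_hom[OF cyl]
  have f: "f \<in> hom K (Dom K f) (Cod K f)" using assms by (rule hom_arr)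
  have "f \<cdot> s \<in> hom K Cyl (Cod K f)" "f \<cdot> s \<cdot> i0 = f" "f \<cdot> s \<cdot> i1 = f"
    using comp_hom[OF *(3) f] assoc[OF *(1,3) f] assoc[OF *(2,3) f] *(5,6) comp_Ide[OF f] by simp_all
  then show ?thesis using assms f cyl unfolding left_homotopic_def by blast
qed

lemma homotopy_refl: "f \<in> Arr K \<Longrightarrow> (f, f) \<in> homotopy K"
  using left_homotopic_refl[of f] model_in_universe.left_homotopic_refl[OF model_in_universe_op, of f]
  by (simp add: homotopy_def right_homotopic_def)

lemma homotopy_hom: "(f, g) \<in> homotopy K \<Longrightarrow> g \<in> hom K (Dom K f) (Cod K f)"
  by (simp add: homotopy_def left_homotopic_def)

text \<open>A homotopy on some cylinder extends along a fibrant replacement of the cylinder over \<open>A\<close>, and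
  the given good cylinder, being cofibrant under \<open>A \<squnion> A\<close>, maps to the latter.\<close>

lemma left_homotopic_good_cylinder:
  assumes good: "good_cylinder K A Cyl i0 i1 s" and Q: "fibrant K Q" and f: "f \<in> hom K A Q"
    and "left_homotopic K f g"
  shows "\<exists>h\<in>hom K Cyl Q. h \<cdot> i0 = f \<and> h \<cdot> i1 = g"
proof -
  obtain Cyl' j0 j1 t h where cyl': "cylinder K A Cyl' j0 j1 t"
    and h: "h \<in> hom K Cyl' Q" "h \<cdot> j0 = f" "h \<cdot> j1 = g"
    using assms(4) homD[OF f] unfolding left_homotopic_def by blast
  note t = cylinder_hom[OF cyl']
  obtain S' a' b' k' where S': "coproduct K A A S' a' b'" and k': "k' \<in> hom K S' Cyl'"
    and j: "j0 = k' \<cdot> a'" "j1 = k' \<cdot> b'"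
    using cyl' unfolding cylinder_def by blast
  note ab' = coproductD(1,2)[OF S']
  have cyl: "cylinder K A Cyl i0 i1 s"
    using good by (simp add: good_cylinder_def)
  note s = cylinder_hom[OF cyl]
  obtain S a b k where S: "coproduct K A A S a b" and k: "k \<in> hom K S Cyl" "k \<in> Cof K"
    and i: "i0 = k \<cdot> a" "i1 = k \<cdot> b"
    using cyl unfolding cylinder_def by blast
  note ab = coproductD(1,2)[OF S]
  obtain Z l p where l: "l \<in> hom K Cyl' Z" "l \<in> Cof K" "l \<in> Weq K" and p: "p \<in> hom K Z A" "p \<in> Fib K"
    and tpl: "t = p \<cdot> l"
    by (rule factor_TCof_Fib[OF t(3)])
  have pW: "p \<in> Weq K" using Weq_2_of_3(2)[OF l(1) p(1) l(3)] t(4) tpl by simp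
  obtain T q where T: "terminal K T" and q: "q \<in> hom K Q T" "q \<in> Fib K"
    using Q unfolding fibrant_def by blast
  obtain e where e: "e \<in> hom K Z T"
    using T homD[OF p(1)] unfolding terminal_def by blast
  have "q \<cdot> h = e \<cdot> l"
    using terminal_unique[OF T comp_hom[OF h(1) q(1)] comp_hom[OF l(1) e]] .
  then obtain h' where h': "h' \<in> hom K Z Q" "h' \<cdot> l = h"
    using lift[OF has_lift[OF l(2) q(2)] l(1) q(1) h(1) e] l(3) by blast
  have A: "A \<in> Obj K" using homD[OF f] by simp
  have S'O: "S' \<in> Obj K" using homD[OF ab'(1)] by simp
  \<comment> \<open>The two cylinders may be built on different coproducts of \<open>A\<close> with
    itself; \<open>r\<close> compares them.\<close>
  obtain r where r: "r \<in> hom K S S'" "r \<cdot> a = a'" "r \<cdot> b = b'"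
    using coproductD(3)[OF S S'O ab'] by blast
  define w where "w = l \<cdot> (k' \<cdot> r)"
  have k'r: "k' \<cdot> r \<in> hom K S Cyl'" using comp_hom r(1) k' by blast
  have w: "w \<in> hom K S Z" unfolding w_def using comp_hom[OF k'r l(1)] .
  have k'ra: "k' \<cdot> r \<cdot> a = j0" "k' \<cdot> r \<cdot> b = j1"
    using assoc[OF ab(1) r(1) k'] assoc[OF ab(2) r(1) k'] r j by simp_all
  have wa: "w \<cdot> a = l \<cdot> j0" "w \<cdot> b = l \<cdot> j1"
    unfolding w_def using assoc[OF ab(1) k'r l(1)] assoc[OF ab(2) k'r l(1)] k'ra by simp_all
  have plj: "p \<cdot> (l \<cdot> j0) = Ide K A" "p \<cdot> (l \<cdot> j1) = Ide K A"
    using assoc[OF t(1) l(1) p(1)] assoc[OF t(2) l(1) p(1)] t(5,6) tpl by simp_all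
  have pw: "p \<cdot> w \<in> hom K S A" using comp_hom[OF w p(1)] .
  have sk: "s \<cdot> k \<in> hom K S A" using comp_hom[OF k(1) s(3)] .
  have pwa: "p \<cdot> w \<cdot> a = Ide K A" "p \<cdot> w \<cdot> b = Ide K A"
    using assoc[OF ab(1) w p(1)] assoc[OF ab(2) w p(1)] wa plj by simp_all
  have ska: "s \<cdot> k \<cdot> a = Ide K A" "s \<cdot> k \<cdot> b = Ide K A"
    using assoc[OF ab(1) k(1) s(3)] assoc[OF ab(2) k(1) s(3)] s(5,6) i by simp_all
  have "p \<cdot> w = s \<cdot> k"
    by (rule coproductD(4)[OF S A pw sk]) (use pwa ska A in auto)
  then obtain d where d: "d \<in> hom K Cyl Z" "d \<cdot> k = w"
    using lift[OF has_lift[OF k(2) p(2)] k(1) p(1) w s(3)] pW by blast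
  have "d \<cdot> i0 = l \<cdot> j0" "d \<cdot> i1 = l \<cdot> j1"
    using assoc[OF ab(1) k(1) d(1)] assoc[OF ab(2) k(1) d(1)] i d wa by simp_all
  then have "h' \<cdot> d \<cdot> i0 = h' \<cdot> (l \<cdot> j0)" "h' \<cdot> d \<cdot> i1 = h' \<cdot> (l \<cdot> j1)"
    using assoc[OF s(1) d(1) h'(1)] assoc[OF s(2) d(1) h'(1)] by simp_all
  moreover have "h' \<cdot> (l \<cdot> j0) = f" "h' \<cdot> (l \<cdot> j1) = g"
    using assoc[OF t(1) l(1) h'(1)] assoc[OF t(2) l(1) h'(1)] h' h by simp_all
  ultimately show ?thesis using comp_hom[OF d(1) h'(1)] by (intro bexI[of _ "h' \<cdot> d"]) auto
qed

text \<open>The end inclusion \<open>i0\<close> has the left lifting property against trivial fibrations, hence is a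
  trivial cofibration.\<close>

lemma cylinder_Cof:
  assumes A: "cofibrant K A" and cyl: "cylinder K A Cyl i0 i1 s"
  shows "i0 \<in> Cof K" "i0 \<in> Weq K"
proof -
  note s = cylinder_hom[OF cyl]
  have AO: "A \<in> Obj K" using A by (simp add: cofibrant_def)
  show "i0 \<in> Weq K"
    using Weq_2_of_3(3)[OF s(1,3,4)] s(5) Weq_Ide[OF AO] by simp
  obtain S a b k where S: "coproduct K A A S a b" and k: "k \<in> hom K S Cyl" "k \<in> Cof K"
    and i: "i0 = k \<cdot> a" "i1 = k \<cdot> b"
    using cyl unfolding cylinder_def by blast
  note ab = coproductD(1,2)[OF S]
  obtain I z where I: "initial K I" and z: "z \<in> hom K I A" "z \<in> Cof K"
    using A unfolding cofibrant_def by blast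
  show "i0 \<in> Cof K"
  proof (rule Cof_of_has_lift[OF s(1)])
    fix p assume p: "p \<in> Fib K" "p \<in> Weq K"
    define E B where "E = Dom K p" and "B = Cod K p"
    have ph: "p \<in> hom K E B" unfolding E_def B_def using p(1) Fib_Arr hom_arr by blast
    have B: "B \<in> Obj K" and E: "E \<in> Obj K" using homD[OF ph] by auto
    show "has_lift K i0 p"
      unfolding has_lift_def
    proof (intro ballI impI)
      fix u v assume "u \<in> hom K (Dom K i0) (Dom K p)" "v \<in> hom K (Cod K i0) (Cod K p)"
        and eq: "p \<cdot> u = v \<cdot> i0"
      then have u: "u \<in> hom K A E" and v: "v \<in> hom K Cyl B"
        using homD[OF s(1)] homD[OF ph] by simp_all
      \<comment> \<open>The square prescribes a lift only at the end \<open>i0\<close>. Cofibrancy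
        of \<open>A\<close> supplies some lift \<open>u'\<close> at the end \<open>i1\<close>, so
        that a map on the whole coproduct is available and the cofibration \<open>k\<close> can be
        used.\<close>
      obtain e where e: "e \<in> hom K I E" using I E unfolding initial_def by blast
      have vi1: "v \<cdot> i1 \<in> hom K A B" using comp_hom[OF s(2) v] .
      have "\<exists>!x. x \<in> hom K I B" using I B unfolding initial_def by blast
      then have "p \<cdot> e = v \<cdot> i1 \<cdot> z"
        using comp_hom[OF e ph] comp_hom[OF z(1) vi1] by blast
      then obtain u' where u': "u' \<in> hom K A E" "p \<cdot> u' = v \<cdot> i1"
        using lift[OF has_lift[OF z(2) p(1)] z(1) ph e vi1] p(2) by blast
      obtain w where w: "w \<in> hom K S E" "w \<cdot> a = u" "w \<cdot> b = u'"
        using coproductD(3)[OF S E u u'(1)] by blast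
      have "p \<cdot> w = v \<cdot> k"
      proof (rule coproductD(4)[OF S B])
        show "p \<cdot> w \<in> hom K S B" "v \<cdot> k \<in> hom K S B"
          using comp_hom[OF w(1) ph] comp_hom[OF k(1) v] .
        show "p \<cdot> w \<cdot> a \<in> hom K A B" "p \<cdot> w \<cdot> b \<in> hom K A B"
          using comp_hom[OF ab(1) comp_hom[OF w(1) ph]] comp_hom[OF ab(2) comp_hom[OF w(1) ph]] .
        show "p \<cdot> w \<cdot> a = v \<cdot> k \<cdot> a"
          using assoc[OF ab(1) w(1) ph] assoc[OF ab(1) k(1) v] w eq i by simp
        show "p \<cdot> w \<cdot> b = v \<cdot> k \<cdot> b"
          using assoc[OF ab(2) w(1) ph] assoc[OF ab(2) k(1) v] w u' i by simp
      qed
      then obtain h where h: "h \<in> hom K Cyl E" "h \<cdot> k = w" "p \<cdot> h = v"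
        using lift[OF has_lift[OF k(2) p(1)] k(1) ph w(1) v] p(2) by blast
      have "h \<cdot> i0 = u" using assoc[OF ab(1) k(1) h(1)] h i w by simp
      then show "\<exists>h\<in>hom K (Cod K i0) (Dom K p). h \<cdot> i0 = u \<and> p \<cdot> h = v"
        using h homD[OF s(1)] homD[OF ph] by auto
    qed
  qed
qed

text \<open>The constant homotopy \<open>f \<cdot> s\<close> and the given homotopy \<open>h\<close>
  form a map \<open>v\<close> from the cylinder to the product \<open>S\<close> of two copies of
  \<open>Q\<close>. As \<open>i0\<close> is a trivial cofibration, \<open>v\<close> lifts to the
  path object with the constant path \<open>t \<cdot> f\<close> at \<open>i0\<close>; the lift
  restricted along \<open>i1\<close> is a right homotopy from \<open>f\<close> to
  \<open>g\<close>.\<close>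

lemma right_homotopic_of_left:
  assumes A: "cofibrant K A" and f: "f \<in> hom K A Q" and "left_homotopic K f g"
  shows "right_homotopic K f g"
proof -
  obtain Cyl i0 i1 s h where cyl: "cylinder K A Cyl i0 i1 s"
    and h: "h \<in> hom K Cyl Q" "h \<cdot> i0 = f" "h \<cdot> i1 = g"
    using assms(3) homD[OF f] unfolding left_homotopic_def by blast
  note s = cylinder_hom[OF cyl]
  have Q: "Q \<in> Obj K" and CylO: "Cyl \<in> Obj K" using homD[OF h(1)] by auto
  obtain Path p0 p1 t where path: "cylinder (op_model K) Q Path p0 p1 t"
    using model_in_universe.ex_good_cylinder[OF model_in_universe_op, of Q] Q
    by (auto simp: good_cylinder_def)
  note t = model_in_universe.cylinder_hom[OF model_in_universe_op path, simplified]
  obtain S a b k where S: "coproduct (op_model K) Q Q S a b"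
    and "k \<in> hom (op_model K) S Path" "k \<in> Cof (op_model K)"
      "p0 = Cmp (op_model K) k a" "p1 = Cmp (op_model K) k b"
    using path unfolding cylinder_def by blast
  then have k: "k \<in> hom K Path S" "k \<in> Fib K" and p: "p0 = a \<cdot> k" "p1 = b \<cdot> k" by simp_all
  note ab = coproductD(1,2)[OF S, simplified]
  have fs: "f \<cdot> s \<in> hom K Cyl Q" using comp_hom[OF s(3) f] .
  obtain v where v: "v \<in> hom K Cyl S" "a \<cdot> v = f \<cdot> s" "b \<cdot> v = h"
    using coproductD(3)[OF S, of Cyl "f \<cdot> s" h] CylO fs h(1) by auto
  have tf: "t \<cdot> f \<in> hom K A Path" using comp_hom[OF f t(3)] .
  have fsi: "f \<cdot> s \<cdot> i0 = f" "f \<cdot> s \<cdot> i1 = f"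
    using assoc[OF s(1,3) f] assoc[OF s(2,3) f] s(5,6) comp_Ide[OF f] by simp_all
  have pt: "p0 \<cdot> (t \<cdot> f) = f" "p1 \<cdot> (t \<cdot> f) = f"
    using assoc[OF f t(3,1)] assoc[OF f t(3,2)] t(5,6) Ide_comp[OF f] by simp_all
  have ktf: "k \<cdot> (t \<cdot> f) \<in> hom K A S" using comp_hom[OF tf k(1)] .
  have vi: "v \<cdot> i0 \<in> hom K A S" using comp_hom[OF s(1) v(1)] .
  have AO: "A \<in> Obj K" using homD[OF f] by simp
  have eqs: "a \<cdot> (k \<cdot> (t \<cdot> f)) = f" "b \<cdot> (k \<cdot> (t \<cdot> f)) = f" "a \<cdot> (v \<cdot> i0) = f" "b \<cdot> (v \<cdot> i0) = f"
    using assoc[OF tf k(1) ab(1)] assoc[OF tf k(1) ab(2)] assoc[OF s(1) v(1) ab(1)]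
      assoc[OF s(1) v(1) ab(2)] pt p v fsi h by simp_all
  have "k \<cdot> (t \<cdot> f) = v \<cdot> i0"
    using coproductD(4)[OF S, of A "k \<cdot> (t \<cdot> f)" "v \<cdot> i0"] AO ktf vi eqs f by simp
  then obtain H where H: "H \<in> hom K Cyl Path" "k \<cdot> H = v"
    using lift[OF has_lift[OF cylinder_Cof(1)[OF A cyl] k(2)] s(1) k(1) tf v(1)] cylinder_Cof(2)[OF A cyl]
    by blast
  have G: "H \<cdot> i1 \<in> hom K A Path" using comp_hom[OF s(2) H(1)] .
  have kG: "k \<cdot> (H \<cdot> i1) = v \<cdot> i1" using assoc[OF s(2) H(1) k(1)] H by simp
  have "p0 \<cdot> (H \<cdot> i1) = f" "p1 \<cdot> (H \<cdot> i1) = g"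
    using assoc[OF G k(1) ab(1)] assoc[OF G k(1) ab(2)] assoc[OF s(2) v(1) ab(1)]
      assoc[OF s(2) v(1) ab(2)] kG p v fsi h by simp_all
  moreover have "g \<in> hom K A Q" using comp_hom[OF s(2) h(1)] h by simp
  ultimately show ?thesis
    unfolding right_homotopic_def left_homotopic_def
    using homD[OF f] path G by (auto intro!: exI[of _ Path] bexI[of _ "H \<cdot> i1"])
qed

text \<open>One cylinder, fixed in advance, decides homotopy for all pairs of maps into all fibrant
  objects. Homotopy becomes an extension problem between the two fixed objects \<open>A\<close> and
  \<open>Cyl\<close>, to which compactness can be applied.\<close>

lemma homotopy_iff:
  assumes "cofibrant K A" "fibrant K Q" and good: "good_cylinder K A Cyl i0 i1 s"
    and f: "f \<in> hom K A Q" and g: "g \<in> hom K A Q"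
  shows "(f, g) \<in> homotopy K \<longleftrightarrow> (\<exists>h\<in>hom K Cyl Q. h \<cdot> i0 = f \<and> h \<cdot> i1 = g)"
proof
  assume "(f, g) \<in> homotopy K"
  then show "\<exists>h\<in>hom K Cyl Q. h \<cdot> i0 = f \<and> h \<cdot> i1 = g"
    using left_homotopic_good_cylinder[OF good assms(2) f] by (simp add: homotopy_def)
next
  assume "\<exists>h\<in>hom K Cyl Q. h \<cdot> i0 = f \<and> h \<cdot> i1 = g"
  then have "left_homotopic K f g"
    using homD[OF f] g good unfolding left_homotopic_def good_cylinder_def by blast
  then show "(f, g) \<in> homotopy K"
    using right_homotopic_of_left[OF assms(1) f] by (simp add: homotopy_def)
qed

section \<open>Hom-sets and terminal objects of the homotopy category\<close>

lemma hom_Ho: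
  assumes "fibrant K A" "cofibrant K A" "fibrant K Q" "cofibrant K Q"
  shows "hom (Ho K) A Q = (\<lambda>f. homotopy K `` {f}) ` hom K A Q"
proof -
  \<comment> \<open>Homotopic maps are parallel, so \<open>the_elem\<close> reads off the common
    domain or codomain of a class.\<close>
  have 1: "the_elem (Dom K ` (homotopy K `` {f})) = Dom K f"
    "the_elem (Cod K ` (homotopy K `` {f})) = Cod K f" if "f \<in> Arr K" for f
  proof -
    have "Dom K g = Dom K f \<and> Cod K g = Cod K f" if "g \<in> homotopy K `` {f}" for g
      using homotopy_hom[of f g] homD[of g] that by blast
    moreover have "f \<in> homotopy K `` {f}" using homotopy_refl[OF that] by simp
    ultimately have "Dom K ` (homotopy K `` {f}) = {Dom K f}" "Cod K ` (homotopy K `` {f}) = {Cod K f}"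
      by (blast intro: image_eqI)+
    then show "the_elem (Dom K ` (homotopy K `` {f})) = Dom K f"
      "the_elem (Cod K ` (homotopy K `` {f})) = Cod K f" by simp_all
  qed
  have "F \<in> hom (Ho K) A Q \<longleftrightarrow> F \<in> (\<lambda>f. homotopy K `` {f}) ` hom K A Q" for F
  proof -
    have "F \<in> hom (Ho K) A Q \<longleftrightarrow> (\<exists>f\<in>Arr (Kcf K). F = homotopy K `` {f} \<and>
        the_elem (Dom K ` F) = A \<and> the_elem (Cod K ` F) = Q)"
      by (auto simp: hom_def Ho_def quotient_cat_def quotient_def Kcf_def full_subcat_def)
    also have "\<dots> \<longleftrightarrow> (\<exists>f\<in>Arr (Kcf K). F = homotopy K `` {f} \<and> Dom K f = A \<and> Cod K f = Q)"
      using 1 by (auto simp: Kcf_def full_subcat_def)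
    also have "\<dots> \<longleftrightarrow> F \<in> (\<lambda>f. homotopy K `` {f}) ` hom K A Q"
      using assms by (auto simp: Kcf_def full_subcat_def hom_def)
    finally show ?thesis .
  qed
  then show ?thesis by blast
qed

text \<open>In one direction the classes of \<open>f\<close> and \<open>g\<close> coincide, and
  \<open>g\<close> lies in its own class. In the other direction the class of any map is the whole
  hom-set, because homotopic maps are parallel.\<close>

lemma ex1_hom_Ho_iff:
  assumes "fibrant K A" "cofibrant K A" "fibrant K Q" "cofibrant K Q"
  shows "(\<exists>!F. F \<in> hom (Ho K) A Q) \<longleftrightarrow>
    hom K A Q \<noteq> {} \<and> (\<forall>f\<in>hom K A Q. \<forall>g\<in>hom K A Q. (f, g) \<in> homotopy K)"
proof
  assume *: "\<exists>!F. F \<in> hom (Ho K) A Q"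
  have "(f, g) \<in> homotopy K" if "f \<in> hom K A Q" "g \<in> hom K A Q" for f g
  proof -
    have "homotopy K `` {f} = homotopy K `` {g}"
      using * that unfolding hom_Ho[OF assms] by blast
    then show ?thesis using homotopy_refl[of g] that homD[OF that(2)] by blast
  qed
  then show "hom K A Q \<noteq> {} \<and> (\<forall>f\<in>hom K A Q. \<forall>g\<in>hom K A Q. (f, g) \<in> homotopy K)"
    using * unfolding hom_Ho[OF assms] by blast
next
  assume *: "hom K A Q \<noteq> {} \<and> (\<forall>f\<in>hom K A Q. \<forall>g\<in>hom K A Q. (f, g) \<in> homotopy K)"
  have "homotopy K `` {f} = hom K A Q" if "f \<in> hom K A Q" for f
    using homotopy_hom[of f] that * homD[OF that] by blast
  then show "\<exists>!F. F \<in> hom (Ho K) A Q"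
    using * unfolding hom_Ho[OF assms] by (intro ex1I[of _ "hom K A Q"]) auto
qed

text \<open>Terminality asks for exactly one class of maps from each generator. Existence comes for
  free from the composite \<open>A \<rightarrow> Z \<rightarrow> Q\<close> through the zero object
  \<open>Z\<close> of \<open>K\<close>, so only the comparison of pairs remains.\<close>

lemma terminal_Ho_iff:
  assumes gen: "weak_generator \<kappa> (Ho K) \<A>" and pt: "pointed K"
    and Q: "fibrant K Q" "cofibrant K Q"
  shows "terminal (Ho K) Q \<longleftrightarrow>
    (\<forall>A\<in>\<A>. \<forall>f\<in>hom K A Q. \<forall>g\<in>hom K A Q. (f, g) \<in> homotopy K)"
proof -
  have Obj_Ho: "Obj (Ho K) = {X. fibrant K X \<and> cofibrant K X}"
    by (simp add: Ho_def quotient_cat_def Kcf_def full_subcat_def)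
  have \<A>: "fibrant K A" "cofibrant K A" if "A \<in> \<A>" for A
    using gen that Obj_Ho unfolding weak_generator_def by auto
  have ne: "hom K A Q \<noteq> {}" if "A \<in> \<A>" for A
  proof -
    obtain Z where Z: "initial K Z" "terminal K Z"
      using pt by (auto simp: pointed_def zero_object_def)
    have "A \<in> Obj K" "Q \<in> Obj K" using \<A>[OF that] Q by (simp_all add: fibrant_def)
    then obtain f g where "f \<in> hom K A Z" "g \<in> hom K Z Q"
      using Z unfolding initial_def terminal_def by blast
    then show ?thesis using comp_hom by blast
  qed
  have QO: "Q \<in> Obj (Ho K)" using Q Obj_Ho by simp
  have "terminal (Ho K) Q \<longleftrightarrow> (\<forall>A\<in>\<A>. \<exists>!F. F \<in> hom (Ho K) A Q)"
  proof
    assume "terminal (Ho K) Q"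
    moreover have "\<A> \<subseteq> Obj (Ho K)" using gen by (simp add: weak_generator_def)
    ultimately show "\<forall>A\<in>\<A>. \<exists>!F. F \<in> hom (Ho K) A Q"
      unfolding terminal_def by (meson subsetD)
  next
    assume "\<forall>A\<in>\<A>. \<exists>!F. F \<in> hom (Ho K) A Q"
    then show "terminal (Ho K) Q"
      using gen QO unfolding weak_generator_def by (elim conjE) (drule bspec, assumption, erule mp)
  qed
  also have "\<dots> \<longleftrightarrow> (\<forall>A\<in>\<A>. \<forall>f\<in>hom K A Q. \<forall>g\<in>hom K A Q. (f, g) \<in> homotopy K)"
    using ex1_hom_Ho_iff[OF \<A> Q] ne by simp
  finally show ?thesis .
qed

end

section \<open>Directed diagrams\<close>

text \<open>The preorder is kept as a thin category so that it can serve directly as the shape of a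
  diagram. The bound for the empty \<open>F\<close> makes it nonempty.\<close>

definition directed :: "'w set \<Rightarrow> ('i, 'j, 'y) cat_scheme \<Rightarrow> bool" where
  "directed W J \<longleftrightarrow> is_category J \<and>
     (\<forall>u\<in>Arr J. \<forall>v\<in>Arr J. Dom J u = Dom J v \<longrightarrow> Cod J u = Cod J v \<longrightarrow> u = v) \<and>
     (\<forall>F\<subseteq>Obj J. |F| \<le>o |W| \<longrightarrow> (\<exists>q\<in>Obj J. \<forall>p\<in>F. hom J p q \<noteq> {}))"

text \<open>The two clauses say that the comparison from the colimit of the sets
  \<open>hom C A (onObj D q)\<close> to \<open>hom C A X\<close> is surjective and injective, in the
  form valid for directed shapes. The notion refers to a single cocone rather than to all filtered
  colimits, so that it can be used for objects whose presentability rank exceeds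
  \<open>lam\<close>.\<close>

definition compact_wrt :: "('i, 'j, 'y) cat_scheme \<Rightarrow> ('o, 'm, 'z) cat_scheme \<Rightarrow>
    ('i, 'j, 'o, 'm) ftor \<Rightarrow> 'o \<Rightarrow> ('i \<Rightarrow> 'm) \<Rightarrow> 'o \<Rightarrow> bool" where
  "compact_wrt J C D X c A \<longleftrightarrow>
     (\<forall>h\<in>hom C A X. \<exists>q\<in>Obj J. \<exists>h'\<in>hom C A (onObj D q). Cmp C (c q) h' = h) \<and>
     (\<forall>q\<in>Obj J. \<forall>u\<in>hom C A (onObj D q). \<forall>v\<in>hom C A (onObj D q). Cmp C (c q) u = Cmp C (c q) v \<longrightarrow>
       (\<exists>w\<in>Arr J. Dom J w = q \<and> Cmp C (onArr D w) u = Cmp C (onArr D w) v))"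

context
  fixes W :: "'w set" and J :: "('i, 'j, 'y) cat_scheme"
  assumes dir: "directed W J"
begin

lemma directed_category: "category J"
  using dir by unfold_locales (simp add: directed_def)

lemma directed_thin: "u \<in> hom J p q \<Longrightarrow> v \<in> hom J p q \<Longrightarrow> u = v"
  using dir unfolding directed_def hom_def by simp

lemma directed_bound:
  assumes "|S| \<le>o |W|" "\<And>s. s \<in> S \<Longrightarrow> p s \<in> Obj J"
  shows "\<exists>q\<in>Obj J. \<forall>s\<in>S. \<exists>w. w \<in> hom J (p s) q"
proof -
  have "p ` S \<subseteq> Obj J" "|p ` S| \<le>o |W|"
    using assms ordLeq_transitive[OF card_of_image] by auto
  then have "\<exists>q\<in>Obj J. \<forall>x\<in>p ` S. hom J x q \<noteq> {}"
    using dir unfolding directed_def by meson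
  then show ?thesis by fastforce
qed

lemma directed_bound_insert:
  assumes W: "infinite W" and "|S| \<le>o |W|" "\<And>s. s \<in> S \<Longrightarrow> p s \<in> Obj J" and q: "q \<in> Obj J"
  shows "\<exists>k\<in>Obj J. (\<exists>w. w \<in> hom J q k) \<and> (\<forall>s\<in>S. \<exists>w. w \<in> hom J (p s) k)"
proof -
  have "|insert q (p ` S)| \<le>o |W|"
    using card_of_Un_ordLeq_infinite_Field[of "|W|" "{q}" "p ` S"] W assms(2)
      ordLeq_transitive[OF card_of_image] card_of_card_order_on[of W]
      card_of_singl_ordLeq[of W q] by (auto simp: Field_card_of)
  then have "\<exists>k\<in>Obj J. \<forall>x\<in>insert q (p ` S). \<exists>w. w \<in> hom J x k"
    using directed_bound[of "insert q (p ` S)" id] assms by auto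
  then show ?thesis by auto
qed

end

text \<open>Identities embed the objects of \<open>I\<close> into its arrows, so there are few
  enough objects for one upper bound; the chosen arrows into it form a cocone by thinness. Functors
  that preserve \<open>lam\<close>-filtered colimits can therefore be applied to all diagrams
  directed for \<open>W\<close>.\<close>

lemma directed_filtered:
  fixes J :: "('u, 'u) cat" and W :: "'u set"
  assumes dir: "directed W J" and lam: "lam \<le>o |W|"
  shows "filtered lam J"
  unfolding filtered_def
proof (intro conjI allI impI)
  show "is_category J" using dir by (simp add: directed_def)
  fix I :: "('u, 'u) cat" and D :: "('u, 'u, 'u, 'u) ftor"
  assume "is_category I \<and> |Arr I| <o lam \<and> is_functor I J D"
  then have I: "is_category I" "|Arr I| <o lam" and D: "is_functor I J D" by auto
  interpret I: category I using I by unfold_locales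
  have "inj_on (Ide I) (Obj I)" by (metis I.Dom_Ide inj_onI)
  then have "|Obj I| \<le>o |Arr I|" using I.Ide_Arr by (intro card_of_ordLeqI) auto
  then have "|Obj I| \<le>o |W|"
    using I(2) lam ordLeq_transitive ordLess_imp_ordLeq by blast
  then obtain k where k: "k \<in> Obj J" "\<forall>i\<in>Obj I. \<exists>w. w \<in> hom J (onObj D i) k"
    using directed_bound[OF dir, of "Obj I" "onObj D"] D unfolding is_functor_def by blast
  then obtain c where c: "\<And>i. i \<in> Obj I \<Longrightarrow> c i \<in> hom J (onObj D i) k" by metis
  have "Cmp J (c (Cod I u)) (onArr D u) = c (Dom I u)" if u: "u \<in> Arr I" for u
  proof (rule directed_thin[OF dir])
    show "c (Dom I u) \<in> hom J (onObj D (Dom I u)) k" using c u by simp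
    show "Cmp J (c (Cod I u)) (onArr D u) \<in> hom J (onObj D (Dom I u)) k"
      using category.comp_hom[OF directed_category[OF dir] is_functor_hom[OF D I.hom_arr[OF u]] c] u by simp
  qed
  then show "\<exists>k c. cocone I J D k c" using k c unfolding cocone_def by blast
qed

section \<open>Compactness relative to a directed diagram\<close>

context category
begin

lemma cocone_comp:
  assumes "cocone J C D X c" "h \<in> hom C X Y" "category J" "is_functor J C D"
  shows "cocone J C D Y (\<lambda>j. h \<cdot> c j)"
  unfolding cocone_def
proof (intro conjI ballI)
  interpret J: category J by fact
  have c: "c j \<in> hom C (onObj D j) X" if "j \<in> Obj J" for j using assms that by (simp add: cocone_def)
  show "Y \<in> Obj C" using homD[OF assms(2)] by simp
  show "h \<cdot> c j \<in> hom C (onObj D j) Y" if "j \<in> Obj J" for j using comp_hom[OF c assms(2)] that .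
  show "h \<cdot> c (Cod J u) \<cdot> onArr D u = h \<cdot> c (Dom J u)" if u: "u \<in> Arr J" for u
    using assoc[OF is_functor_hom[OF assms(4) J.hom_arr[OF u]] c assms(2)] assms(1) u
    by (simp add: cocone_def)
qed

lemma colimit_ex:
  assumes "colimit J C D X c" "cocone J C D Y d"
  obtains h where "h \<in> hom C X Y" "\<And>j. j \<in> Obj J \<Longrightarrow> h \<cdot> c j = d j"
proof -
  have "\<exists>!h. h \<in> hom C X Y \<and> (\<forall>j\<in>Obj J. h \<cdot> c j = d j)" using assms unfolding colimit_def by (elim conjE) (erule allE, erule allE, erule mp)
  then show ?thesis using that by blast
qed

lemma colimit_eqI:
  assumes colim: "colimit J C D X c" and J: "category J" and D: "is_functor J C D"
    and h: "h \<in> hom C X Y" "h' \<in> hom C X Y" and eq: "\<And>j. j \<in> Obj J \<Longrightarrow> h \<cdot> c j = h' \<cdot> c j"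
  shows "h = h'"
proof -
  have "cocone J C D Y (\<lambda>j. h \<cdot> c j)"
    using cocone_comp colim h J D unfolding colimit_def by blast
  then have "\<exists>!g. g \<in> hom C X Y \<and> (\<forall>j\<in>Obj J. g \<cdot> c j = h \<cdot> c j)"
    using colim unfolding colimit_def by (elim conjE) (erule allE, erule allE, erule mp)
  then show ?thesis using h eq by (metis (no_types, lifting))
qed

text \<open>The relative form of the closure of \<mu>-presentable objects under \<mu>-small
  colimits. A map from \<open>A\<close> is a compatible family of maps from the
  \<open>onObj E i\<close>. Each member factors through a stage and each compatibility equation
  holds at a stage; there are at most \<open>|W|\<close> members and equations, so a single stage
  serves for all.\<close>

lemma compact_wrt_colimit:
  fixes I :: "('k, 'l, 'x) cat_scheme"
  assumes dir: "directed W J" and W: "infinite W" and D: "is_functor J C D" and cc: "cocone J C D X c"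
    and I: "category I" and E: "is_functor I C E" and colim: "colimit I C E A e"
    and card: "|Arr I| \<le>o |W|"
    and comp: "\<And>i. i \<in> Obj I \<Longrightarrow> compact_wrt J C D X c (onObj E i)"
  shows "compact_wrt J C D X c A"
proof -
  interpret J: category J using directed_category[OF dir] .
  interpret I: category I by fact
  have "inj_on (Ide I) (Obj I)" by (metis I.Dom_Ide inj_onI)
  then have "|Obj I| \<le>o |Arr I|" using I.Ide_Arr by (intro card_of_ordLeqI) auto
  then have cardO: "|Obj I| \<le>o |W|" using card ordLeq_transitive by blast
  have c: "c j \<in> hom C (onObj D j) X" if "j \<in> Obj J" for j using cc that by (simp add: cocone_def)
  have cD: "c k \<cdot> onArr D w = c j" if "w \<in> hom J j k" for w j k
    using cc J.homD[OF that] by (auto simp: cocone_def)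
  have e: "e i \<in> hom C (onObj E i) A" if "i \<in> Obj I" for i
    using colim that by (simp add: cocone_def colimit_def)
  have eE: "e (Cod I u) \<cdot> onArr E u = e (Dom I u)" if "u \<in> Arr I" for u
    using colim that by (simp add: cocone_def colimit_def)
  have Dw: "onArr D w \<in> hom C (onObj D p) (onObj D q)" if "w \<in> hom J p q" for w p q
    using is_functor_hom[OF D that] .
  \<comment> \<open>Pairs that agree in \<open>X\<close> agree at one common later stage. This is
    used with \<open>S\<close> the objects of \<open>I\<close> for the injectivity clause, and with
    \<open>S\<close> the arrows of \<open>I\<close> for the compatibility of a factored
    family.\<close>
  have common: "\<exists>k b. b \<in> hom J q k \<and> (\<forall>s\<in>S. onArr D b \<cdot> u s = onArr D b \<cdot> v s)"
    if S: "|S| \<le>o |W|" and q: "q \<in> Obj J"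
      and B: "\<And>s. s \<in> S \<Longrightarrow> B s \<in> onObj E ` Obj I"
      and uv: "\<And>s. s \<in> S \<Longrightarrow> u s \<in> hom C (B s) (onObj D q)" "\<And>s. s \<in> S \<Longrightarrow> v s \<in> hom C (B s) (onObj D q)"
      and eq: "\<And>s. s \<in> S \<Longrightarrow> c q \<cdot> u s = c q \<cdot> v s"
    for S :: "'s set" and q B u v
  proof -
    have "\<exists>w\<in>Arr J. Dom J w = q \<and> onArr D w \<cdot> u s = onArr D w \<cdot> v s" if s: "s \<in> S" for s
    proof -
      obtain i where i: "i \<in> Obj I" "B s = onObj E i" using B[OF s] by blast
      have "compact_wrt J C D X c (B s)" using comp i by simp
      then show ?thesis unfolding compact_wrt_def using q uv[OF s] eq[OF s] by blast
    qed
    then obtain w where w: "\<And>s. s \<in> S \<Longrightarrow> w s \<in> hom J q (Cod J (w s))"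
        "\<And>s. s \<in> S \<Longrightarrow> onArr D (w s) \<cdot> u s = onArr D (w s) \<cdot> v s"
      unfolding hom_def by (simp) metis
    have "Cod J (w s) \<in> Obj J" if "s \<in> S" for s using J.homD[OF w(1)[OF that]] by simp
    then obtain k b where k: "k \<in> Obj J" "b \<in> hom J q k" "\<forall>s\<in>S. \<exists>x. x \<in> hom J (Cod J (w s)) k"
      using directed_bound_insert[OF dir W S, of "\<lambda>s. Cod J (w s)" q] q by blast
    have "onArr D b \<cdot> u s = onArr D b \<cdot> v s" if s: "s \<in> S" for s
    proof -
      obtain x where x: "x \<in> hom J (Cod J (w s)) k" using k s by blast
      have "b = Cmp J x (w s)" using directed_thin[OF dir k(2) J.comp_hom[OF w(1)[OF s] x]] .
      then have b: "onArr D b = onArr D x \<cdot> onArr D (w s)" using is_functor_comp[OF D w(1)[OF s] x] by simp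
      show ?thesis
        unfolding b using assoc[OF uv(1)[OF s] Dw[OF w(1)[OF s]] Dw[OF x]]
          assoc[OF uv(2)[OF s] Dw[OF w(1)[OF s]] Dw[OF x]] w(2)[OF s] by simp
    qed
    then show ?thesis using k by blast
  qed
  show ?thesis
    unfolding compact_wrt_def
  proof (intro conjI ballI impI)
    fix q u v assume q: "q \<in> Obj J" and u: "u \<in> hom C A (onObj D q)" and v: "v \<in> hom C A (onObj D q)"
      and eq: "c q \<cdot> u = c q \<cdot> v"
    obtain k b where b: "b \<in> hom J q k" "\<forall>i\<in>Obj I. onArr D b \<cdot> (u \<cdot> e i) = onArr D b \<cdot> (v \<cdot> e i)"
      using common[OF cardO q, of "onObj E" "\<lambda>i. u \<cdot> e i" "\<lambda>i. v \<cdot> e i"] comp_hom[OF e u] comp_hom[OF e v]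
        assoc[OF e u c[OF q]] assoc[OF e v c[OF q]] eq by auto
    have "onArr D b \<cdot> u = onArr D b \<cdot> v"
    proof (rule colimit_eqI[OF colim I E])
      show "onArr D b \<cdot> u \<in> hom C A (onObj D k)" "onArr D b \<cdot> v \<in> hom C A (onObj D k)"
        using comp_hom[OF u Dw[OF b(1)]] comp_hom[OF v Dw[OF b(1)]] .
      show "onArr D b \<cdot> u \<cdot> e i = onArr D b \<cdot> v \<cdot> e i" if "i \<in> Obj I" for i
        using assoc[OF e u Dw[OF b(1)]] assoc[OF e v Dw[OF b(1)]] b that by simp
    qed
    then show "\<exists>w\<in>Arr J. Dom J w = q \<and> onArr D w \<cdot> u = onArr D w \<cdot> v"
      using J.homD[OF b(1)] by blast
  next
    fix h assume h: "h \<in> hom C A X"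
    have "\<exists>q\<in>Obj J. \<exists>h'\<in>hom C (onObj E i) (onObj D q). c q \<cdot> h' = h \<cdot> e i" if i: "i \<in> Obj I" for i
      using comp[OF i] comp_hom[OF e[OF i] h] unfolding compact_wrt_def by blast
    then obtain p g where p: "\<And>i. i \<in> Obj I \<Longrightarrow> p i \<in> Obj J"
      and g: "\<And>i. i \<in> Obj I \<Longrightarrow> g i \<in> hom C (onObj E i) (onObj D (p i))"
        "\<And>i. i \<in> Obj I \<Longrightarrow> c (p i) \<cdot> g i = h \<cdot> e i"
      by metis
    obtain q where q: "q \<in> Obj J" "\<forall>i\<in>Obj I. \<exists>w. w \<in> hom J (p i) q"
      using directed_bound[OF dir cardO, of p] p by blast
    then obtain w where w: "\<And>i. i \<in> Obj I \<Longrightarrow> w i \<in> hom J (p i) q" by metis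
    define f where "f i = onArr D (w i) \<cdot> g i" for i
    have f: "f i \<in> hom C (onObj E i) (onObj D q)" "c q \<cdot> f i = h \<cdot> e i" if i: "i \<in> Obj I" for i
      unfolding f_def using comp_hom[OF g(1)[OF i] Dw[OF w[OF i]]]
        assoc[OF g(1)[OF i] Dw[OF w[OF i]] c[OF q(1)]] cD[OF w[OF i]] g(2)[OF i] by simp_all
    have Eu: "onArr E u \<in> hom C (onObj E (Dom I u)) (onObj E (Cod I u))" if "u \<in> Arr I" for u
      using is_functor_hom[OF E I.hom_arr[OF that]] .
    \<comment> \<open>The maps \<open>f i\<close> are so far compatible only after composition with
      \<open>c q\<close>; passing on to the stage \<open>k\<close> turns them into a cocone within
      the diagram.\<close>
    have "c q \<cdot> (f (Cod I u) \<cdot> onArr E u) = c q \<cdot> f (Dom I u)" if u: "u \<in> Arr I" for u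
      using assoc[OF Eu[OF u] f(1) c[OF q(1)]] assoc[OF Eu[OF u] e h] f(2) eE[OF u] u by simp
    then obtain k b where b: "b \<in> hom J q k"
      "\<forall>u\<in>Arr I. onArr D b \<cdot> (f (Cod I u) \<cdot> onArr E u) = onArr D b \<cdot> f (Dom I u)"
      using common[OF card q(1), of "\<lambda>u. onObj E (Dom I u)" "\<lambda>u. f (Cod I u) \<cdot> onArr E u" "\<lambda>u. f (Dom I u)"]
        comp_hom[OF Eu f(1)] f(1) by auto
    have k: "k \<in> Obj J" using J.homD[OF b(1)] by simp
    have Dk: "onObj D k \<in> Obj C" using D k unfolding is_functor_def by blast
    have bf: "onArr D b \<cdot> f i \<in> hom C (onObj E i) (onObj D k)" if "i \<in> Obj I" for i
      using comp_hom[OF f(1)[OF that] Dw[OF b(1)]] .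
    have "cocone I C E (onObj D k) (\<lambda>i. onArr D b \<cdot> f i)"
      unfolding cocone_def
    proof (intro conjI ballI)
      show "onArr D b \<cdot> f (Cod I u) \<cdot> onArr E u = onArr D b \<cdot> f (Dom I u)" if u: "u \<in> Arr I" for u
        using assoc[OF Eu[OF u] f(1) Dw[OF b(1)]] b(2) u by simp
    qed (use bf Dk in auto)
    then obtain h' where h': "h' \<in> hom C A (onObj D k)" "\<And>i. i \<in> Obj I \<Longrightarrow> h' \<cdot> e i = onArr D b \<cdot> f i"
      using colimit_ex[OF colim] by blast
    have "c k \<cdot> h' = h"
    proof (rule colimit_eqI[OF colim I E comp_hom[OF h'(1) c[OF k]] h])
      fix i assume i: "i \<in> Obj I"
      show "c k \<cdot> h' \<cdot> e i = h \<cdot> e i"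
        using assoc[OF e[OF i] h'(1) c[OF k]] h'(2)[OF i] assoc[OF f(1)[OF i] Dw[OF b(1)] c[OF k]]
          cD[OF b(1)] f(2)[OF i] by simp
    qed
    then show "\<exists>q\<in>Obj J. \<exists>h'\<in>hom C A (onObj D q). c q \<cdot> h' = h" using k h'(1) by blast
  qed
qed

text \<open>The universal property of \<open>hom C A X\<close> as a colimit in
  \<open>set_cat\<close>, freed from the coding of maps as triples: the family \<open>t\<close> is a
  cocone with vertex \<open>Y\<close>. In the applications \<open>Y\<close> consists of two distinct
  arrows and acts as a set of truth values.\<close>

lemma presentable_hom_colimit:
  fixes J :: "('u, 'u) cat" and \<kappa> :: "'u rel" and Y :: "'m set"
  assumes pres: "presentable \<kappa> lam C A" and ls: "locally_small \<kappa> C"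
    and J: "small_category \<kappa> J" "filtered lam J" and D: "is_functor J C D" and colim: "colimit J C D X c"
    and Y: "small \<kappa> Y" and t: "\<And>j x. j \<in> Obj J \<Longrightarrow> x \<in> hom C A (onObj D j) \<Longrightarrow> t j x \<in> Y"
    and compat: "\<And>u x. u \<in> Arr J \<Longrightarrow> x \<in> hom C A (onObj D (Dom J u)) \<Longrightarrow>
      t (Cod J u) (onArr D u \<cdot> x) = t (Dom J u) x"
  shows "\<exists>!\<eta>. \<eta> \<in> hom C A X \<rightarrow>\<^sub>E Y \<and> (\<forall>j\<in>Obj J. \<forall>x\<in>hom C A (onObj D j). \<eta> (c j \<cdot> x) = t j x)"
proof -
  interpret J: category J using J by unfold_locales (simp add: small_category_def)
  define G where "G = comp_ftor (hom_ftor C A) D"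
  define P where "P \<eta> \<longleftrightarrow> \<eta> \<in> hom C A X \<rightarrow>\<^sub>E Y \<and> (\<forall>j\<in>Obj J. \<forall>x\<in>hom C A (onObj D j). \<eta> (c j \<cdot> x) = t j x)" for \<eta>
  have A: "A \<in> Obj C" using pres by (simp add: presentable_def)
  have cc: "cocone J C D X c" using colim by (simp add: colimit_def)
  have c: "c j \<in> hom C (onObj D j) X" if "j \<in> Obj J" for j
    using cc that by (simp add: cocone_def)
  have Du: "onArr D u \<in> hom C (onObj D (Dom J u)) (onObj D (Cod J u))" if "u \<in> Arr J" for u
    using is_functor_hom[OF D J.hom_arr[OF that]] .
  have DO: "onObj D j \<in> Obj C" if "j \<in> Obj J" for j using D that unfolding is_functor_def by blast
  have smh: "small \<kappa> (hom C A (onObj D j))" if "j \<in> Obj J" for j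
    using ls A DO[OF that] unfolding locally_small_def by blast
  have smX: "small \<kappa> (hom C A X)" using ls A cc unfolding locally_small_def cocone_def by blast
  have colimG: "colimit J (set_cat \<kappa>) G (hom C A X) (onArr (hom_ftor C A) \<circ> c)"
    using pres J D colim unfolding presentable_def preserves_filtered_colimits_def G_def
    by (simp add: hom_ftor_def)
  define d where "d j = (hom C A (onObj D j), restrict (t j) (hom C A (onObj D j)), Y)" for j
  have homset: "f \<in> hom (set_cat \<kappa>) U V \<longleftrightarrow> (\<exists>\<phi>. f = (U, \<phi>, V) \<and> small \<kappa> U \<and> small \<kappa> V \<and> \<phi> \<in> U \<rightarrow>\<^sub>E V)"
    for U V f by (auto simp: hom_def set_cat_def)
  have "cocone J (set_cat \<kappa>) G Y d"
    unfolding cocone_def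
  proof (intro conjI ballI)
    show "Y \<in> Obj (set_cat \<kappa>)" using Y by (simp add: set_cat_def)
    show "d j \<in> hom (set_cat \<kappa>) (onObj G j) Y" if "j \<in> Obj J" for j
      using t[OF that] smh[OF that] Y by (auto simp: homset d_def G_def hom_ftor_def)
    fix u assume u: "u \<in> Arr J"
    have "onArr D u \<cdot> x \<in> hom C A (onObj D (Cod J u))" if "x \<in> hom C A (onObj D (Dom J u))" for x
      using comp_hom[OF that Du[OF u]] .
    then show "Cmp (set_cat \<kappa>) (d (Cod J u)) (onArr G u) = d (Dom J u)"
      using homD[OF Du[OF u]] compat[OF u]
      by (auto simp: set_cat_def d_def G_def hom_ftor_def compose_def restrict_def fun_eq_iff)
  qed
  then have ex1: "\<exists>!h. h \<in> hom (set_cat \<kappa>) (hom C A X) Y \<and>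
      (\<forall>j\<in>Obj J. Cmp (set_cat \<kappa>) h ((onArr (hom_ftor C A) \<circ> c) j) = d j)"
    using colimG unfolding colimit_def by (elim conjE) (erule allE, erule allE, erule mp)
  have iff: "(\<forall>j\<in>Obj J. Cmp (set_cat \<kappa>) (hom C A X, \<eta>, Y) ((onArr (hom_ftor C A) \<circ> c) j) = d j) \<longleftrightarrow>
      (\<forall>j\<in>Obj J. \<forall>x\<in>hom C A (onObj D j). \<eta> (c j \<cdot> x) = t j x)" for \<eta>
  proof (rule ball_cong[OF refl])
    fix j assume j: "j \<in> Obj J"
    show "Cmp (set_cat \<kappa>) (hom C A X, \<eta>, Y) ((onArr (hom_ftor C A) \<circ> c) j) = d j \<longleftrightarrow>
        (\<forall>x\<in>hom C A (onObj D j). \<eta> (c j \<cdot> x) = t j x)"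
      using homD[OF c[OF j]]
      by (auto simp: set_cat_def d_def hom_ftor_def compose_def restrict_def fun_eq_iff)
  qed
  have *: "(hom C A X, \<eta>, Y) \<in> hom (set_cat \<kappa>) (hom C A X) Y \<and>
      (\<forall>j\<in>Obj J. Cmp (set_cat \<kappa>) (hom C A X, \<eta>, Y) ((onArr (hom_ftor C A) \<circ> c) j) = d j) \<longleftrightarrow> P \<eta>" for \<eta>
    unfolding iff P_def using smX Y by (simp add: homset)
  obtain h where h: "h \<in> hom (set_cat \<kappa>) (hom C A X) Y \<and>
      (\<forall>j\<in>Obj J. Cmp (set_cat \<kappa>) h ((onArr (hom_ftor C A) \<circ> c) j) = d j)"
    using ex1 by blast
  then obtain \<phi> where "h = (hom C A X, \<phi>, Y)" using homset[of h "hom C A X" Y] by blast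
  then have "P \<phi>" using h * by blast
  moreover have "\<eta> = \<phi>" if "P \<eta>" for \<eta>
    using the1_equality[OF ex1 *[of \<eta>, THEN iffD2, OF that]]
      the1_equality[OF ex1 *[of \<phi>, THEN iffD2, OF \<open>P \<phi>\<close>]] by simp
  ultimately have "\<exists>!\<eta>. P \<eta>" by blast
  then show ?thesis unfolding P_def .
qed

text \<open>Surjectivity and injectivity are tested by functions with two values. If
  \<open>h\<close> came from no stage, its value could be changed freely, against the uniqueness of
  the induced function. If \<open>u\<close> and \<open>v\<close> agree in \<open>X\<close>, a
  function that detects eventual equality with \<open>u\<close> descends to \<open>hom C A X\<close>
  and takes the same value at both.\<close>

lemma presentable_compact_wrt:
  fixes J :: "('u, 'u) cat" and \<kappa> :: "'u rel"
  assumes "universe \<kappa>" and pres: "presentable \<kappa> lam C A" and ls: "locally_small \<kappa> C"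
    and J: "small_category \<kappa> J" "filtered lam J" and dir: "directed W J" and W: "infinite W"
    and D: "is_functor J C D" and colim: "colimit J C D X c"
  shows "compact_wrt J C D X c A"
proof -
  interpret universe \<kappa> by fact
  interpret J: category J using directed_category[OF dir] .
  have A: "A \<in> Obj C" using pres by (simp add: presentable_def)
  have cc: "cocone J C D X c" using colim by (simp add: colimit_def)
  have c: "c j \<in> hom C (onObj D j) X" if "j \<in> Obj J" for j
    using cc that by (simp add: cocone_def)
  have DO: "onObj D j \<in> Obj C" if "j \<in> Obj J" for j using D that unfolding is_functor_def by blast
  have Dw: "onArr D w \<in> hom C (onObj D p) (onObj D q)" if "w \<in> hom J p q" for w p q
    using is_functor_hom[OF D that] .
  note hc = presentable_hom_colimit[OF pres ls J D colim]
  show ?thesis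
    unfolding compact_wrt_def
  proof (intro conjI ballI impI)
    fix h assume h: "h \<in> hom C A X"
    show "\<exists>q\<in>Obj J. \<exists>h'\<in>hom C A (onObj D q). c q \<cdot> h' = h"
    proof (cases "\<exists>s t :: 'm. s \<noteq> t")
      case True
      then obtain s t :: 'm where st: "s \<noteq> t" by blast
      show ?thesis
      proof (rule ccontr)
        assume no: "\<not> ?thesis"
        have ex1: "\<exists>!\<eta>. \<eta> \<in> hom C A X \<rightarrow>\<^sub>E {s, t} \<and> (\<forall>j\<in>Obj J. \<forall>x\<in>hom C A (onObj D j). \<eta> (c j \<cdot> x) = s)"
          by (rule hc) (auto intro: small_finite)
        define \<phi> where "\<phi> r = (\<lambda>x\<in>hom C A X. if x = h then r else s)" for r
        have \<phi>: "\<phi> r \<in> hom C A X \<rightarrow>\<^sub>E {s, t} \<and> (\<forall>j\<in>Obj J. \<forall>x\<in>hom C A (onObj D j). \<phi> r (c j \<cdot> x) = s)"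
          if "r = s \<or> r = t" for r
          using that no comp_hom[OF _ c] by (auto simp: \<phi>_def)
        have "\<phi> s = \<phi> t"
          using the1_equality[where a = "\<phi> s", OF ex1 \<phi>[OF disjI1[OF refl]]]
            the1_equality[where a = "\<phi> t", OF ex1 \<phi>[OF disjI2[OF refl]]] by simp
        then have "\<phi> s h = \<phi> t h" by simp
        then show False using st h by (simp add: \<phi>_def)
      qed
    next
      case False
      \<comment> \<open>With only one arrow in the type all identities coincide, so every stage is
        \<open>A\<close> itself and the identity serves as the factorization.\<close>
      then have all: "x = y" for x y :: 'm by blast
      obtain q where q: "q \<in> Obj J"
        using directed_bound[OF dir, of "{}" id] card_of_empty[of W] by auto
      have "Dom C (Ide C A) = Dom C (Ide C (onObj D q))"
        using all[of "Ide C A" "Ide C (onObj D q)"] by (rule arg_cong)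
      then have "onObj D q = A" using A DO[OF q] by simp
      then have "Ide C A \<in> hom C A (onObj D q)" using A by simp
      then show ?thesis using q all[of "c q \<cdot> Ide C A" h] by (intro bexI)
    qed
  next
    fix q u v assume q: "q \<in> Obj J" and u: "u \<in> hom C A (onObj D q)" and v: "v \<in> hom C A (onObj D q)"
      and eq: "c q \<cdot> u = c q \<cdot> v"
    show "\<exists>w\<in>Arr J. Dom J w = q \<and> onArr D w \<cdot> u = onArr D w \<cdot> v"
    proof (cases "u = v")
      case True
      then show ?thesis using J.Ide_Arr[OF q] J.Dom_Ide[OF q] by blast
    next
      case False
      \<comment> \<open>\<open>R j x\<close> says that \<open>x\<close> becomes equal to
        \<open>u\<close> at some later stage. It is invariant under the transition maps, so
        \<open>t\<close> is a compatible family; the arrows \<open>u\<close> and \<open>v\<close>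
        themselves play the two truth values.\<close>
      define R where "R j x \<longleftrightarrow> (\<exists>k a b. a \<in> hom J j k \<and> b \<in> hom J q k \<and> onArr D a \<cdot> x = onArr D b \<cdot> u)" for j x
      define t where "t j x = (if R j x then u else v)" for j x
      have compat: "R (Cod J e) (onArr D e \<cdot> x) \<longleftrightarrow> R (Dom J e) x"
        if e: "e \<in> Arr J" and x: "x \<in> hom C A (onObj D (Dom J e))" for e x
      proof
        have eh: "e \<in> hom J (Dom J e) (Cod J e)" using e by (rule J.hom_arr)
        {
          assume "R (Cod J e) (onArr D e \<cdot> x)"
          then obtain k a b where a: "a \<in> hom J (Cod J e) k" and b: "b \<in> hom J q k"
            and eq': "onArr D a \<cdot> (onArr D e \<cdot> x) = onArr D b \<cdot> u"
            unfolding R_def by blast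
          have "onArr D (Cmp J a e) \<cdot> x = onArr D b \<cdot> u"
            using is_functor_comp[OF D eh a] assoc[OF x Dw[OF eh] Dw[OF a]] eq' by simp
          then show "R (Dom J e) x" unfolding R_def using J.comp_hom[OF eh a] b by blast
        next
          assume "R (Dom J e) x"
          then obtain k a b where a: "a \<in> hom J (Dom J e) k" and b: "b \<in> hom J q k"
            and eq': "onArr D a \<cdot> x = onArr D b \<cdot> u"
            unfolding R_def by blast
          have "|{Cod J e}| \<le>o |W|" using W by (intro card_of_singl_ordLeq) auto
          then obtain k' a1 a2 where a1: "a1 \<in> hom J k k'" and a2: "a2 \<in> hom J (Cod J e) k'"
            using directed_bound_insert[OF dir W, of "{Cod J e}" id k] J.homD[OF a] J.homD[OF eh] by auto
          have "Cmp J a2 e = Cmp J a1 a"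
            using directed_thin[OF dir J.comp_hom[OF eh a2] J.comp_hom[OF a a1]] .
          then have "onArr D a2 \<cdot> onArr D e = onArr D a1 \<cdot> onArr D a"
            using is_functor_comp[OF D eh a2] is_functor_comp[OF D a a1] by simp
          then have "onArr D a2 \<cdot> (onArr D e \<cdot> x) = onArr D a1 \<cdot> (onArr D a \<cdot> x)"
            using assoc[OF x Dw[OF eh] Dw[OF a2]] assoc[OF x Dw[OF a] Dw[OF a1]] by simp
          also have "\<dots> = onArr D (Cmp J a1 b) \<cdot> u"
            using assoc[OF u Dw[OF b] Dw[OF a1]] is_functor_comp[OF D b a1] eq' by simp
          finally show "R (Cod J e) (onArr D e \<cdot> x)"
            unfolding R_def using a2 J.comp_hom[OF b a1] by blast
        }
      qed
      have "\<exists>!\<eta>. \<eta> \<in> hom C A X \<rightarrow>\<^sub>E {u, v} \<and> (\<forall>j\<in>Obj J. \<forall>x\<in>hom C A (onObj D j). \<eta> (c j \<cdot> x) = t j x)"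
        by (rule hc) (use compat in \<open>auto simp: t_def intro: small_finite\<close>)
      then obtain \<eta> where "\<forall>j\<in>Obj J. \<forall>x\<in>hom C A (onObj D j). \<eta> (c j \<cdot> x) = t j x" by blast
      then have "t q u = t q v" using q u v eq by metis
      moreover have "R q u" unfolding R_def using J.Ide_hom[OF q] by blast
      ultimately have "R q v" using False by (auto simp: t_def split: if_splits)
      then obtain k a b where a: "a \<in> hom J q k" and b: "b \<in> hom J q k"
        and eq': "onArr D a \<cdot> v = onArr D b \<cdot> u"
        unfolding R_def by blast
      then have "onArr D a \<cdot> u = onArr D a \<cdot> v" using directed_thin[OF dir a b] by simp
      then show ?thesis using J.homD[OF a] by blast
    qed
  qed
qed

end

section \<open>Colimits over subgraphs of a diagram\<close>

text \<open>A diagram on a graph is coded by its labelled vertices and labelled edges.  The colimit is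
  chosen as a function of the code, so that there are few of these colimits although the diagrams that
  present the objects form a proper class.\<close>

definition graph_cocone ::
  "('o, 'm, 'z) cat_scheme \<Rightarrow> ('i \<times> 'o) set \<times> ('i \<times> 'i \<times> 'm) set \<Rightarrow> 'o \<Rightarrow> ('i \<Rightarrow> 'm) \<Rightarrow> bool" where
  "graph_cocone C G X c \<longleftrightarrow> X \<in> Obj C \<and> (\<forall>(j, Y)\<in>fst G. c j \<in> hom C Y X) \<and>
     (\<forall>(i, j, f)\<in>snd G. Cmp C (c j) f = c i)"

definition graph_colimit ::
  "('o, 'm, 'z) cat_scheme \<Rightarrow> ('i \<times> 'o) set \<times> ('i \<times> 'i \<times> 'm) set \<Rightarrow> 'o \<Rightarrow> ('i \<Rightarrow> 'm) \<Rightarrow> bool" where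
  "graph_colimit C G X c \<longleftrightarrow> graph_cocone C G X c \<and>
     (\<forall>Y d. graph_cocone C G Y d \<longrightarrow>
       (\<exists>!h. h \<in> hom C X Y \<and> (\<forall>j\<in>fst ` fst G. Cmp C h (c j) = d j)))"

definition graph_colimit_obj ::
  "('o, 'm, 'z) cat_scheme \<Rightarrow> ('i \<times> 'o) set \<times> ('i \<times> 'i \<times> 'm) set \<Rightarrow> 'o" where
  "graph_colimit_obj C G = (SOME X. \<exists>c. graph_colimit C G X c)"

text \<open>A subgraph is given by its arrows alone; an isolated object enters through its identity
  arrow.\<close>

definition vertices :: "('i, 'j, 'y) cat_scheme \<Rightarrow> 'j set \<Rightarrow> 'i set" where
  "vertices J T = Dom J ` T \<union> Cod J ` T"

definition graph ::
  "('i, 'j, 'y) cat_scheme \<Rightarrow> ('i, 'j, 'o, 'm) ftor \<Rightarrow> ('i \<Rightarrow> 'k) \<Rightarrow> 'j set \<Rightarrow>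
   ('k \<times> 'o) set \<times> ('k \<times> 'k \<times> 'm) set" where
  "graph J D e T = ((\<lambda>j. (e j, onObj D j)) ` vertices J T,
     (\<lambda>u. (e (Dom J u), e (Cod J u), onArr D u)) ` T)"

definition part_cocone ::
  "('i, 'j, 'y) cat_scheme \<Rightarrow> ('o, 'm, 'z) cat_scheme \<Rightarrow> ('i, 'j, 'o, 'm) ftor \<Rightarrow> 'j set \<Rightarrow>
   'o \<Rightarrow> ('i \<Rightarrow> 'm) \<Rightarrow> bool" where
  "part_cocone J C D T X c \<longleftrightarrow> X \<in> Obj C \<and> (\<forall>j\<in>vertices J T. c j \<in> hom C (onObj D j) X) \<and>
     (\<forall>u\<in>T. Cmp C (c (Cod J u)) (onArr D u) = c (Dom J u))"

definition part_colimit ::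
  "('i, 'j, 'y) cat_scheme \<Rightarrow> ('o, 'm, 'z) cat_scheme \<Rightarrow> ('i, 'j, 'o, 'm) ftor \<Rightarrow> 'j set \<Rightarrow>
   'o \<Rightarrow> ('i \<Rightarrow> 'm) \<Rightarrow> bool" where
  "part_colimit J C D T X c \<longleftrightarrow> part_cocone J C D T X c \<and>
     (\<forall>Y d. part_cocone J C D T Y d \<longrightarrow>
       (\<exists>!h. h \<in> hom C X Y \<and> (\<forall>j\<in>vertices J T. Cmp C h (c j) = d j)))"

lemma graph_cocone_graph:
  "graph_cocone C (graph J D e T) X c \<longleftrightarrow> part_cocone J C D T X (c \<circ> e)"
  by (auto simp: graph_cocone_def graph_def part_cocone_def)

lemma part_cocone_cong:
  "(\<And>j. j \<in> vertices J T \<Longrightarrow> c j = c' j) \<Longrightarrow> part_cocone J C D T X c = part_cocone J C D T X c'"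
  by (simp add: part_cocone_def vertices_def)

lemma part_colimit_cong:
  assumes "\<And>j. j \<in> vertices J T \<Longrightarrow> c j = c' j"
  shows "part_colimit J C D T X c = part_colimit J C D T X c'"
proof -
  have "(\<forall>j\<in>vertices J T. Cmp C h (c j) = d j) = (\<forall>j\<in>vertices J T. Cmp C h (c' j) = d j)" for h d
    using assms by simp
  then show ?thesis
    using part_cocone_cong[of J T c c' C D X] assms by (simp add: part_colimit_def)
qed

lemma graph_colimit_graph:
  assumes e: "inj_on e (vertices J T)"
  shows "graph_colimit C (graph J D e T) X c \<longleftrightarrow> part_colimit J C D T X (c \<circ> e)"
proof -
  let ?U = "\<lambda>Y d. \<exists>!h. h \<in> hom C X Y \<and> (\<forall>j\<in>vertices J T. Cmp C h (c (e j)) = d j)"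
  have "(\<forall>Y d. part_cocone J C D T Y (d \<circ> e) \<longrightarrow> ?U Y (d \<circ> e)) \<longleftrightarrow>
      (\<forall>Y d. part_cocone J C D T Y d \<longrightarrow> ?U Y d)" (is "?L \<longleftrightarrow> ?R")
  proof
    assume L: ?L
    show ?R
    proof (intro allI impI)
      fix Y d assume d: "part_cocone J C D T Y d"
      define d' where "d' = d \<circ> inv_into (vertices J T) e"
      have d': "(d' \<circ> e) j = d j" if "j \<in> vertices J T" for j
        using e that by (simp add: d'_def)
      have "part_cocone J C D T Y (d' \<circ> e)"
        using d part_cocone_cong[of J T "d' \<circ> e" d C D Y] d' by blast
      then have "?U Y (d' \<circ> e)" using L by blast
      then show "?U Y d" using d' by (simp cong: ball_cong)
    qed
  qed blast
  moreover have "fst ` fst (graph J D e T) = e ` vertices J T"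
    by (simp add: graph_def image_image)
  ultimately show ?thesis
    by (simp add: graph_colimit_def part_colimit_def graph_cocone_graph)
qed

text \<open>Paths grow at the target end by one arrow of \<open>T\<close> at a time, the direction
  in which the equations of a cocone propagate by induction.\<close>

inductive_set generated :: "('i, 'j, 'y) cat_scheme \<Rightarrow> 'j set \<Rightarrow> 'j set" for J T where
  Ide: "j \<in> vertices J T \<Longrightarrow> Ide J j \<in> generated J T"
| Cmp: "f \<in> generated J T \<Longrightarrow> u \<in> T \<Longrightarrow> Cod J f = Dom J u \<Longrightarrow> Cmp J u f \<in> generated J T"

section \<open>Colimits over the subcategory generated by a subgraph\<close>

context category
begin

lemma generated_hom:
  assumes "f \<in> generated C T" "T \<subseteq> Arr C"
  shows "f \<in> Arr C \<and> Dom C f \<in> vertices C T \<and> Cod C f \<in> vertices C T"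
  using assms
proof induction
  case (Ide j)
  then have "j \<in> Obj C" by (auto simp: vertices_def)
  then show ?case using Ide by simp
next
  case (Cmp f u)
  then have "u \<cdot> f \<in> hom C (Dom C f) (Cod C u)" using comp_hom'[of f u] by auto
  then show ?case using Cmp homD by (auto simp: vertices_def)
qed

lemma generated_comp:
  assumes T: "T \<subseteq> Arr C" and g: "g \<in> generated C T"
    and f: "f \<in> generated C T" "Cod C f = Dom C g"
  shows "g \<cdot> f \<in> generated C T"
  using g f(2)
proof induction
  case (Ide j)
  then have "j \<in> Obj C" using T by (auto simp: vertices_def)
  moreover have "f \<in> Arr C" using generated_hom[OF f(1) T] by simp
  ultimately have "Ide C j \<cdot> f = f" using Ide Ide_comp'[of f] by simp
  then show ?case using f by simp
next
  case (Cmp g u)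
  have g: "g \<in> Arr C" and f': "f \<in> Arr C" and u: "u \<in> Arr C"
    using generated_hom[OF _ T] Cmp f T by auto
  have "Dom C (u \<cdot> g) = Dom C g" using homD[OF comp_hom'[OF g u]] Cmp by simp
  then have fg: "Cod C f = Dom C g" using Cmp by simp
  then have "u \<cdot> (g \<cdot> f) = u \<cdot> g \<cdot> f" using assoc'[OF f' g u] Cmp by simp
  moreover have "Cod C (g \<cdot> f) = Dom C u" using homD[OF comp_hom'[OF f' g fg]] Cmp by simp
  ultimately show ?case using generated.Cmp[of "g \<cdot> f" C T u] Cmp fg by simp
qed

text \<open>Cocompleteness speaks of categories, not of graphs. Since the equations of a cocone over
  \<open>T\<close> extend to all composites, the cocones over \<open>T\<close> are exactly those
  over the generated subcategory \<open>I\<close>, which is small.\<close>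

lemma ex_part_colimit:
  fixes J :: "('u, 'u) cat" and \<kappa> :: "'u rel"
  assumes "universe \<kappa>" and J: "small_category \<kappa> J" and D: "is_functor J C D" and T: "T \<subseteq> Arr J"
    and coc: "cocomplete \<kappa> C"
  shows "\<exists>X c. part_colimit J C D T X c"
proof -
  interpret universe \<kappa> by fact
  interpret J: category J using J by unfold_locales (simp add: small_category_def)
  define I where "I = J\<lparr>Obj := vertices J T, Arr := generated J T\<rparr>"
  have I [simp]: "Obj I = vertices J T" "Arr I = generated J T" "Dom I = Dom J" "Cod I = Cod J"
    "Ide I = Ide J" "Cmp I = Cmp J"
    by (simp_all add: I_def)
  note gen = J.generated_hom[OF _ T]
  have V: "vertices J T \<subseteq> Obj J" using T by (auto simp: vertices_def)
  have T_gen: "T \<subseteq> generated J T"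
  proof
    fix u assume u: "u \<in> T"
    then have "Dom J u \<in> vertices J T" "Dom J u \<in> Obj J" "u \<in> Arr J"
      using T by (auto simp: vertices_def)
    then show "u \<in> generated J T"
      using generated.Cmp[OF generated.Ide, of "Dom J u" J T u] u J.comp_Ide'[of u] by simp
  qed
  have "is_category I"
    unfolding is_category_def
  proof (intro conjI ballI impI)
    fix f g h assume fgh: "f \<in> Arr I" "g \<in> Arr I" "h \<in> Arr I" "Cod I f = Dom I g" "Cod I g = Dom I h"
    then show "Cmp I h (Cmp I g f) = Cmp I (Cmp I h g) f"
      using gen J.assoc'[of f g h] by simp
  next
    fix f g assume fg: "f \<in> Arr I" "g \<in> Arr I" "Cod I f = Dom I g"
    then have "Cmp J g f \<in> hom J (Dom J f) (Cod J g)" using gen J.comp_hom'[of f g] by simp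
    then show "Cmp I g f \<in> hom I (Dom I f) (Cod I g)"
      using fg J.generated_comp[OF T] by (simp add: hom_def)
  next
    fix X assume X: "X \<in> Obj I"
    then have "X \<in> Obj J" using V by auto
    then show "Ide I X \<in> hom I X X" using X generated.Ide[of X J T] by (simp add: hom_def)
  qed (use gen J.comp_Ide' J.Ide_comp' in auto)
  moreover have "small \<kappa> (Obj I)" "small \<kappa> (Arr I)"
    using J small_subset[OF _ V] small_subset[of "Arr J" "generated J T"] gen
    by (auto simp: small_category_def)
  ultimately have small: "small_category \<kappa> I" by (simp add: small_category_def)
  have DI: "is_functor I C D"
    unfolding is_functor_def
  proof (intro conjI ballI impI)
    fix f g assume fg: "f \<in> Arr I" "g \<in> Arr I" "Cod I f = Dom I g"
    then show "onArr D (Cmp I g f) = onArr D g \<cdot> onArr D f"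
      using gen is_functor_comp[OF D J.hom_arr, of f g] by (simp add: hom_def)
  next
    fix X assume "X \<in> Obj I"
    then show "onObj D X \<in> Obj C" "onArr D (Ide I X) = Ide C (onObj D X)"
      using D V unfolding is_functor_def by auto
  next
    fix f assume "f \<in> Arr I"
    then show "onArr D f \<in> hom C (onObj D (Dom I f)) (onObj D (Cod I f))"
      using gen is_functor_hom[OF D J.hom_arr, of f] by simp
  qed
  have cocone: "cocone I C D X c \<longleftrightarrow> part_cocone J C D T X c" for X c
  proof
    assume "cocone I C D X c"
    then show "part_cocone J C D T X c" using T_gen unfolding cocone_def part_cocone_def by auto
  next
    assume pc: "part_cocone J C D T X c"
    have "c (Cod J u) \<cdot> onArr D u = c (Dom J u)" if "u \<in> generated J T" for u
      using that
    proof induction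
      case (Ide j)
      then have "c j \<in> hom C (onObj D j) X" using pc by (simp add: part_cocone_def)
      moreover have "j \<in> Obj J" using Ide V by auto
      moreover from this have "onArr D (Ide J j) = Ide C (onObj D j)"
        using D by (simp add: is_functor_def)
      ultimately show ?case using comp_Ide by simp
    next
      case (Cmp f u)
      then have f: "f \<in> hom J (Dom J f) (Dom J u)" and u: "u \<in> hom J (Dom J u) (Cod J u)"
        using gen[OF Cmp(1)] T by (auto simp: hom_def)
      have c: "c (Cod J u) \<in> hom C (onObj D (Cod J u)) X"
        using pc Cmp by (auto simp: part_cocone_def vertices_def)
      have "c (Cod J u) \<cdot> onArr D (Cmp J u f) = c (Cod J u) \<cdot> onArr D u \<cdot> onArr D f"
        using is_functor_comp[OF D f u] assoc[OF is_functor_hom[OF D f] is_functor_hom[OF D u] c] by simp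
      also have "\<dots> = c (Dom J f)" using pc Cmp by (simp add: part_cocone_def)
      finally show ?case using J.homD[OF J.comp_hom[OF f u]] by simp
    qed
    then show "cocone I C D X c" using pc by (simp add: cocone_def part_cocone_def)
  qed
  obtain X c where "colimit I C D X c"
    using coc small DI unfolding cocomplete_def by blast
  then show ?thesis unfolding colimit_def part_colimit_def cocone by auto
qed

lemma part_cocone_comp:
  assumes "part_cocone J C D T X c" "h \<in> hom C X Y" "category J" "is_functor J C D" "T \<subseteq> Arr J"
  shows "part_cocone J C D T Y (\<lambda>j. h \<cdot> c j)"
  unfolding part_cocone_def
proof (intro conjI ballI)
  interpret J: category J by fact
  have c: "c j \<in> hom C (onObj D j) X" if "j \<in> vertices J T" for j
    using assms that by (simp add: part_cocone_def)
  show "Y \<in> Obj C" using homD[OF assms(2)] by simp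
  show "h \<cdot> c j \<in> hom C (onObj D j) Y" if "j \<in> vertices J T" for j using comp_hom[OF c assms(2)] that .
  show "h \<cdot> c (Cod J u) \<cdot> onArr D u = h \<cdot> c (Dom J u)" if u: "u \<in> T" for u
    using assoc[OF is_functor_hom[OF assms(4) J.hom_arr] c assms(2)] assms(1,5) u
    by (auto simp: part_cocone_def vertices_def)
qed

lemma part_colimit_ex:
  assumes "part_colimit J C D T X c" "part_cocone J C D T Y d"
  shows "\<exists>h. h \<in> hom C X Y \<and> (\<forall>j\<in>vertices J T. h \<cdot> c j = d j)"
proof -
  have "\<exists>!h. h \<in> hom C X Y \<and> (\<forall>j\<in>vertices J T. h \<cdot> c j = d j)"
    using assms unfolding part_colimit_def by (elim conjE) (erule allE, erule allE, erule mp)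
  then show ?thesis by blast
qed

lemma part_colimit_eqI:
  assumes colim: "part_colimit J C D T X c" and J: "category J" and D: "is_functor J C D"
    and T: "T \<subseteq> Arr J" and h: "h \<in> hom C X Y" "h' \<in> hom C X Y"
    and eq: "\<And>j. j \<in> vertices J T \<Longrightarrow> h \<cdot> c j = h' \<cdot> c j"
  shows "h = h'"
proof -
  have "part_cocone J C D T X c" using colim by (simp add: part_colimit_def)
  then have "part_cocone J C D T Y (\<lambda>j. h \<cdot> c j)"
    using part_cocone_comp h J D T by blast
  then have "\<exists>!g. g \<in> hom C X Y \<and> (\<forall>j\<in>vertices J T. g \<cdot> c j = h \<cdot> c j)"
    using colim unfolding part_colimit_def by (elim conjE) (erule allE, erule allE, erule mp)
  then show ?thesis using h eq by (metis (no_types, lifting))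
qed

end

text \<open>Shapes of diagrams must live on \<open>'u\<close>, so the points and the comparable
  pairs of the poset are coded there by two embeddings.\<close>

lemma (in universe) ex_poset_category:
  assumes P: "small \<kappa> P" and refl: "\<And>x. x \<in> P \<Longrightarrow> le x x"
    and trans: "\<And>x y z. le x y \<Longrightarrow> le y z \<Longrightarrow> le x z"
  obtains Q :: "('u, 'u) cat" and dec :: "'u \<Rightarrow> 'p"
  where "small_category \<kappa> Q" "bij_betw dec (Obj Q) P"
    "\<And>u v. u \<in> Arr Q \<Longrightarrow> v \<in> Arr Q \<Longrightarrow> Dom Q u = Dom Q v \<Longrightarrow> Cod Q u = Cod Q v \<Longrightarrow> u = v"
    "\<And>p q. p \<in> Obj Q \<Longrightarrow> q \<in> Obj Q \<Longrightarrow> hom Q p q \<noteq> {} \<longleftrightarrow> le (dec p) (dec q)"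
proof -
  obtain e :: "'p \<Rightarrow> 'u" where e: "inj_on e P" using small_embedding[OF P] .
  have "small \<kappa> (P \<times> P)" using P by (intro small_Sigma)
  then obtain e2 :: "'p \<times> 'p \<Rightarrow> 'u" where e2: "inj_on e2 (P \<times> P)" using small_embedding by blast
  define dec where "dec = inv_into P e"
  define dec2 where "dec2 = inv_into (P \<times> P) e2"
  have dec: "dec (e x) = x" if "x \<in> P" for x using e that by (simp add: dec_def)
  have dec2: "dec2 (e2 (x, y)) = (x, y)" if "x \<in> P" "y \<in> P" for x y using e2 that by (simp add: dec2_def)
  define A where "A = {(x, y). x \<in> P \<and> y \<in> P \<and> le x y}"
  define Q :: "('u, 'u) cat" where "Q = \<lparr>Obj = e ` P, Arr = e2 ` A,
    Dom = (\<lambda>u. e (fst (dec2 u))), Cod = (\<lambda>u. e (snd (dec2 u))),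
    Ide = (\<lambda>p. e2 (dec p, dec p)), Cmp = (\<lambda>v u. e2 (fst (dec2 u), snd (dec2 v)))\<rparr>"
  have inj: "e x = e y \<longleftrightarrow> x = y" if "x \<in> P" "y \<in> P" for x y using e that by (auto simp: inj_on_def)
  have "is_category Q"
    unfolding is_category_def
    by (auto simp: Q_def A_def hom_def dec dec2 inj refl intro: trans)
  moreover have "small \<kappa> (Obj Q)" "small \<kappa> (Arr Q)"
    using P small_subset[OF \<open>small \<kappa> (P \<times> P)\<close>, of A] by (auto simp: Q_def A_def intro!: small_image)
  ultimately have "small_category \<kappa> Q" by (simp add: small_category_def)
  moreover have "bij_betw dec (Obj Q) P"
    unfolding dec_def Q_def using e by (simp add: bij_betw_inv_into inj_on_imp_bij_betw)
  moreover have "u = v" if "u \<in> Arr Q" "v \<in> Arr Q" "Dom Q u = Dom Q v" "Cod Q u = Cod Q v" for u v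
    using that by (auto simp: Q_def A_def dec2 inj)
  moreover have "hom Q p q \<noteq> {} \<longleftrightarrow> le (dec p) (dec q)" if pq: "p \<in> Obj Q" "q \<in> Obj Q" for p q
  proof -
    obtain x y where xy: "x \<in> P" "y \<in> P" "p = e x" "q = e y" using pq by (auto simp: Q_def)
    have "e2 (x, y) \<in> hom Q p q" if "le x y"
      using that xy by (auto simp: Q_def A_def hom_def dec2)
    moreover have "le x y" if "u \<in> hom Q p q" for u
      using that xy by (auto simp: Q_def A_def hom_def dec2 inj)
    ultimately show ?thesis using xy dec by auto
  qed
  ultimately show ?thesis by (rule that)
qed

text \<open>The set of codes depends on \<open>W\<close> and \<open>S\<close> only, not on the
  diagram being decomposed. Codes without a colimit contribute an arbitrary value of the choice
  operator, which can only enlarge the set.\<close>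

definition subcolimits :: "('o, 'm, 'z) cat_scheme \<Rightarrow> 'u set \<Rightarrow> 'o set \<Rightarrow> 'o set" where
  "subcolimits C W S = graph_colimit_obj C `
     (Pow (W \<times> S) \<times> Pow (W \<times> W \<times> {f \<in> Arr C. Dom C f \<in> S \<and> Cod C f \<in> S}))"

section \<open>Directed presentations with stages in a fixed small set\<close>

context category
begin

lemma small_arrows_between:
  fixes \<kappa> :: "'u rel"
  assumes "universe \<kappa>" "locally_small \<kappa> C" and S: "small \<kappa> S"
  shows "small \<kappa> {f \<in> Arr C. Dom C f \<in> S \<and> Cod C f \<in> S}"
proof -
  interpret universe \<kappa> by fact
  \<comment> \<open>\<open>S\<close> may contain values that are not objects, for which local
    smallness says nothing; the ends of an arrow are objects.\<close>
  have "{f \<in> Arr C. Dom C f \<in> S \<and> Cod C f \<in> S} \<subseteq> (\<Union>X\<in>S \<inter> Obj C. \<Union>Y\<in>S \<inter> Obj C. hom C X Y)"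
    by (auto simp: hom_def)
  moreover have "small \<kappa> (S \<inter> Obj C)" using S small_subset by blast
  ultimately show ?thesis
    using assms(2) unfolding locally_small_def
    by (elim small_subset[rotated]) (intro small_UN, auto)
qed

lemma small_subcolimits:
  fixes \<kappa> :: "'u rel"
  assumes "universe \<kappa>" "locally_small \<kappa> C" "small \<kappa> S" "small \<kappa> W"
  shows "small \<kappa> (subcolimits C W S)"
proof -
  interpret universe \<kappa> by fact
  show ?thesis
    unfolding subcolimits_def
    by (intro small_image small_Sigma small_Pow assms small_arrows_between[OF assms(1-3)])
qed

text \<open>At most \<open>|W|\<close> arrows touch at most \<open>|W|\<close> vertices, which can
  then be named injectively by elements of \<open>W\<close>. Some colimit of the subgraph exists, so
  the choice attached to its code returns a genuine one.\<close>

lemma ex_subcolimit: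
  fixes J :: "('u, 'u) cat" and \<kappa> :: "'u rel" and W :: "'u set"
  assumes "universe \<kappa>" and J: "small_category \<kappa> J" and D: "is_functor J C D" and T: "T \<subseteq> Arr J"
    and coc: "cocomplete \<kappa> C" and W: "infinite W" "|T| \<le>o |W|" and S: "onObj D ` Obj J \<subseteq> S"
  shows "\<exists>X\<in>subcolimits C W S. \<exists>c. part_colimit J C D T X c"
proof -
  interpret J: category J using J by unfold_locales (simp add: small_category_def)
  have "|Dom J ` T| \<le>o |W|" "|Cod J ` T| \<le>o |W|"
    using W(2) ordLeq_transitive[OF card_of_image] by blast+
  then have "|vertices J T| \<le>o |W|"
    unfolding vertices_def using card_of_Un_ordLeq_infinite_Field[of "|W|"] W(1)
    by (simp add: Field_card_of card_of_card_order_on)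
  then obtain e where e: "inj_on e (vertices J T)" "e ` vertices J T \<subseteq> W"
    using card_of_ordLeq[of "vertices J T" W] by blast
  let ?G = "graph J D e T"
  have gc: "graph_colimit C ?G Y a \<longleftrightarrow> part_colimit J C D T Y (a \<circ> e)" for Y a
    by (rule graph_colimit_graph[OF e(1)])
  obtain X c where X: "part_colimit J C D T X c"
    using ex_part_colimit[OF assms(1) J D T coc] by blast
  have "part_colimit J C D T X (c \<circ> inv_into (vertices J T) e \<circ> e)"
    using X e(1) part_colimit_cong[of J T "c \<circ> inv_into (vertices J T) e \<circ> e" c C D X] by simp
  then have "\<exists>c. graph_colimit C ?G X c" unfolding gc by blast
  then have "\<exists>c. graph_colimit C ?G (graph_colimit_obj C ?G) c"
    unfolding graph_colimit_obj_def by (rule someI)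
  then have "\<exists>c. part_colimit J C D T (graph_colimit_obj C ?G) c"
    unfolding gc by blast
  moreover have "?G \<in> Pow (W \<times> S) \<times> Pow (W \<times> W \<times> {f \<in> Arr C. Dom C f \<in> S \<and> Cod C f \<in> S})"
  proof -
    have "vertices J T \<subseteq> Obj J" using T by (auto simp: vertices_def)
    then have "fst ?G \<subseteq> W \<times> S" using e S by (auto simp: graph_def)
    moreover have "snd ?G \<subseteq> W \<times> W \<times> {f \<in> Arr C. Dom C f \<in> S \<and> Cod C f \<in> S}"
    proof
      fix r assume "r \<in> snd ?G"
      then obtain u where u: "u \<in> T" and r: "r = (e (Dom J u), e (Cod J u), onArr D u)"
        by (auto simp: graph_def)
      have uJ: "u \<in> Arr J" using u T by blast
      have "onObj D (Dom J u) \<in> S" "onObj D (Cod J u) \<in> S" using S uJ by auto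
      moreover have "e (Dom J u) \<in> W" "e (Cod J u) \<in> W" using e(2) u by (auto simp: vertices_def)
      ultimately show "r \<in> W \<times> W \<times> {f \<in> Arr C. Dom C f \<in> S \<and> Cod C f \<in> S}"
        using homD[OF is_functor_hom[OF D J.hom_arr[OF uJ]]] r by simp
    qed
    ultimately show ?thesis by (simp add: mem_Times_iff)
  qed
  ultimately show ?thesis
    unfolding subcolimits_def by (intro bexI[of _ "graph_colimit_obj C ?G"] imageI)
qed

text \<open>This raises the degree of directedness of a presentation. A union of at most
  \<open>|W|\<close> subgraphs with at most \<open>|W|\<close> arrows each is again such a subgraph,
  and every object and arrow of \<open>J\<close> already lies in one of them; hence the colimits of
  the subgraphs form a directed diagram with the same colimit \<open>X\<close>.\<close>

lemma directed_subcolimits: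
  fixes J :: "('u, 'u) cat" and \<kappa> :: "'u rel" and W :: "'u set"
  assumes "universe \<kappa>" and J: "small_category \<kappa> J" and D: "is_functor J C D"
    and colim: "colimit J C D X c"
    and coc: "cocomplete \<kappa> C" and W: "infinite W" and S: "onObj D ` Obj J \<subseteq> S"
  shows "\<exists>(Q :: ('u, 'u) cat) F d. small_category \<kappa> Q \<and> directed W Q \<and> is_functor Q C F \<and>
    (\<forall>q\<in>Obj Q. onObj F q \<in> subcolimits C W S) \<and> colimit Q C F X d"
proof -
  interpret universe \<kappa> by fact
  have J': "category J" using J by unfold_locales (simp add: small_category_def)
  interpret J: category J by fact
  define P where "P = {T. T \<subseteq> Arr J \<and> |T| \<le>o |W|}"
  have PT: "T \<subseteq> Arr J" if "T \<in> P" for T using that by (simp add: P_def)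
  have "P \<subseteq> Pow (Arr J)" by (auto simp: P_def)
  then have smP: "small \<kappa> P"
    using J small_subset small_Pow unfolding small_category_def by blast
  have "\<exists>X c. X \<in> subcolimits C W S \<and> part_colimit J C D T X c" if "T \<in> P" for T
    using ex_subcolimit[OF assms(1) J D _ coc W _ S] that unfolding P_def by blast
  then obtain XT cT where XT: "\<And>T. T \<in> P \<Longrightarrow> XT T \<in> subcolimits C W S"
    and cT: "\<And>T. T \<in> P \<Longrightarrow> part_colimit J C D T (XT T) (cT T)"
    by metis
  have cT_hom: "cT T j \<in> hom C (onObj D j) (XT T)" if "T \<in> P" "j \<in> vertices J T" for T j
    using cT[OF that(1)] that(2) by (simp add: part_colimit_def part_cocone_def)
  have cT_comp: "cT T (Cod J u) \<cdot> onArr D u = cT T (Dom J u)" if "T \<in> P" "u \<in> T" for T u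
    using cT[OF that(1)] that(2) by (simp add: part_colimit_def part_cocone_def)
  have XT_Obj: "XT T \<in> Obj C" if "T \<in> P" for T
    using cT[OF that] by (simp add: part_colimit_def part_cocone_def)
  have V: "vertices J T \<subseteq> Obj J" if "T \<in> P" for T using PT[OF that] by (auto simp: vertices_def)
  have eqI: "h = h'" if "T \<in> P" "h \<in> hom C (XT T) Y" "h' \<in> hom C (XT T) Y"
    "\<And>j. j \<in> vertices J T \<Longrightarrow> h \<cdot> cT T j = h' \<cdot> cT T j" for T h h' Y
    using part_colimit_eqI[OF cT[OF that(1)] J' D PT[OF that(1)] that(2,3)] that(4) by blast
  \<comment> \<open>The colimit cocone of a larger subgraph restricts to the smaller one and so
    induces the transition map \<open>tr T T'\<close>.\<close>
  have "\<exists>h. h \<in> hom C (XT T) (XT T') \<and> (\<forall>j\<in>vertices J T. h \<cdot> cT T j = cT T' j)"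
    if "T \<in> P" "T' \<in> P" "T \<subseteq> T'" for T T'
  proof (rule part_colimit_ex[OF cT[OF that(1)]])
    show "part_cocone J C D T (XT T') (cT T')"
      using cT[OF that(2)] that(3) by (auto simp: part_colimit_def part_cocone_def vertices_def)
  qed
  then obtain tr where tr: "\<And>T T'. T \<in> P \<Longrightarrow> T' \<in> P \<Longrightarrow> T \<subseteq> T' \<Longrightarrow> tr T T' \<in> hom C (XT T) (XT T')"
    and tr_comp: "\<And>T T' j. T \<in> P \<Longrightarrow> T' \<in> P \<Longrightarrow> T \<subseteq> T' \<Longrightarrow> j \<in> vertices J T \<Longrightarrow>
      tr T T' \<cdot> cT T j = cT T' j"
    by metis
  have cc: "cocone J C D X c" using colim by (simp add: colimit_def)
  have c: "c j \<in> hom C (onObj D j) X" if "j \<in> Obj J" for j using cc that by (simp add: cocone_def)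
  have "\<exists>h. h \<in> hom C (XT T) X \<and> (\<forall>j\<in>vertices J T. h \<cdot> cT T j = c j)" if "T \<in> P" for T
  proof (rule part_colimit_ex[OF cT[OF that(1)]])
    show "part_cocone J C D T X c"
      using cc PT[OF that] by (auto simp: part_cocone_def cocone_def vertices_def)
  qed
  then obtain k where k: "\<And>T. T \<in> P \<Longrightarrow> k T \<in> hom C (XT T) X"
    and k_comp: "\<And>T j. T \<in> P \<Longrightarrow> j \<in> vertices J T \<Longrightarrow> k T \<cdot> cT T j = c j"
    by metis
  obtain Q :: "('u, 'u) cat" and dec :: "'u \<Rightarrow> 'u set"
    where Q: "small_category \<kappa> Q" "bij_betw dec (Obj Q) P"
      and thin: "\<And>u v. u \<in> Arr Q \<Longrightarrow> v \<in> Arr Q \<Longrightarrow> Dom Q u = Dom Q v \<Longrightarrow> Cod Q u = Cod Q v \<Longrightarrow> u = v"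
      and le: "\<And>p q. p \<in> Obj Q \<Longrightarrow> q \<in> Obj Q \<Longrightarrow> hom Q p q \<noteq> {} \<longleftrightarrow> dec p \<subseteq> dec q"
    by (rule ex_poset_category[OF smP, of "(\<subseteq>)"])
      (rule subset_refl, erule (1) subset_trans, rule that, assumption+)
  interpret Q: category Q using Q by unfold_locales (simp add: small_category_def)
  have dec: "dec q \<in> P" if "q \<in> Obj Q" for q using Q(2) that by (auto simp: bij_betw_def)
  have dec_surj: "\<exists>q\<in>Obj Q. dec q = T" if "T \<in> P" for T using Q(2) that by (auto simp: bij_betw_def)
  have le_arr: "dec (Dom Q w) \<subseteq> dec (Cod Q w)" if "w \<in> Arr Q" for w
    using le[of "Dom Q w" "Cod Q w"] Q.hom_arr[OF that] that by auto
  define F where "F = \<lparr>onObj = XT \<circ> dec, onArr = (\<lambda>w. tr (dec (Dom Q w)) (dec (Cod Q w)))\<rparr>"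
  have F [simp]: "onObj F q = XT (dec q)" "onArr F w = tr (dec (Dom Q w)) (dec (Cod Q w))" for q w
    by (simp_all add: F_def)
  have dir: "directed W Q"
    unfolding directed_def
  proof (intro conjI ballI impI allI)
    show "is_category Q" by (rule Q.is_category)
    show "u = v" if "u \<in> Arr Q" "v \<in> Arr Q" "Dom Q u = Dom Q v" "Cod Q u = Cod Q v" for u v
      using thin that .
    fix G assume G: "G \<subseteq> Obj Q" "|G| \<le>o |W|"
    have "\<Union>(dec ` G) \<in> P"
    proof -
      have "|\<Union>(dec ` G)| \<le>o |W|"
        using card_of_UNION_ordLeq_infinite[OF W G(2), of dec] dec G(1) by (auto simp: P_def)
      then show ?thesis using PT dec G(1) by (auto simp: P_def)
    qed
    then obtain q where q: "q \<in> Obj Q" "dec q = \<Union>(dec ` G)" using dec_surj by blast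
    have "hom Q p q \<noteq> {}" if "p \<in> G" for p
    proof -
      have "p \<in> Obj Q" using G(1) that by blast
      then show ?thesis using le[of p q] q that by auto
    qed
    then show "\<exists>q\<in>Obj Q. \<forall>p\<in>G. hom Q p q \<noteq> {}" using q(1) by blast
  qed
  have FF: "is_functor Q C F"
    unfolding is_functor_def
  proof (intro conjI ballI impI)
    fix q assume q: "q \<in> Obj Q"
    show "onObj F q \<in> Obj C" using XT_Obj dec q by simp
    show "onArr F (Ide Q q) = Ide C (onObj F q)"
      using eqI[OF dec[OF q] tr Ide_hom[OF XT_Obj[OF dec[OF q]]]] dec[OF q] tr_comp[of "dec q" "dec q"]
        Ide_comp[OF cT_hom[OF dec[OF q]]] q by simp
  next
    fix w assume w: "w \<in> Arr Q"
    then show "onArr F w \<in> hom C (onObj F (Dom Q w)) (onObj F (Cod Q w))"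
      using tr dec le_arr by simp
  next
    fix w v assume w: "w \<in> Arr Q" and v: "v \<in> Arr Q" and wv: "Cod Q w = Dom Q v"
    define T1 T2 T3 where "T1 = dec (Dom Q w)" and "T2 = dec (Cod Q w)" and "T3 = dec (Cod Q v)"
    have T: "T1 \<in> P" "T2 \<in> P" "T3 \<in> P" "T1 \<subseteq> T2" "T2 \<subseteq> T3"
      using w v wv dec le_arr[OF w] le_arr[OF v] by (auto simp: T1_def T2_def T3_def)
    have "tr T1 T3 = tr T2 T3 \<cdot> tr T1 T2"
    proof (rule eqI[OF T(1)])
      show "tr T1 T3 \<in> hom C (XT T1) (XT T3)" using tr[OF T(1,3)] T(4,5) by simp
      show "tr T2 T3 \<cdot> tr T1 T2 \<in> hom C (XT T1) (XT T3)"
        by (rule comp_hom[OF tr[OF T(1,2,4)] tr[OF T(2,3,5)]])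
      fix j assume j: "j \<in> vertices J T1"
      then have j2: "j \<in> vertices J T2" using T by (auto simp: vertices_def)
      have "tr T2 T3 \<cdot> tr T1 T2 \<cdot> cT T1 j = tr T2 T3 \<cdot> (tr T1 T2 \<cdot> cT T1 j)"
        by (rule assoc[OF cT_hom[OF T(1) j] tr[OF T(1,2,4)] tr[OF T(2,3,5)]])
      moreover have "T1 \<subseteq> T3" using T by blast
      ultimately show "tr T1 T3 \<cdot> cT T1 j = tr T2 T3 \<cdot> tr T1 T2 \<cdot> cT T1 j"
        using tr_comp T j j2 by simp
    qed
    then show "onArr F (Cmp Q v w) = onArr F v \<cdot> onArr F w"
      using Q.homD[OF Q.comp_hom'[OF w v wv]] wv by (simp add: T1_def T2_def T3_def)
  qed
  have "colimit Q C F X (k \<circ> dec)"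
    unfolding colimit_def
  proof (intro conjI allI impI)
    show "cocone Q C F X (k \<circ> dec)"
      unfolding cocone_def
    proof (intro conjI ballI)
      show "X \<in> Obj C" using cc by (simp add: cocone_def)
      show "(k \<circ> dec) q \<in> hom C (onObj F q) X" if "q \<in> Obj Q" for q using k dec that by simp
      fix w assume w: "w \<in> Arr Q"
      define T1 T2 where "T1 = dec (Dom Q w)" and "T2 = dec (Cod Q w)"
      have T: "T1 \<in> P" "T2 \<in> P" "T1 \<subseteq> T2"
        using w dec le_arr[OF w] by (auto simp: T1_def T2_def)
      have "k T2 \<cdot> tr T1 T2 = k T1"
      proof (rule eqI[OF T(1) comp_hom[OF tr[OF T] k[OF T(2)]] k[OF T(1)]])
        fix j assume j: "j \<in> vertices J T1"
        then have j2: "j \<in> vertices J T2" using T by (auto simp: vertices_def)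
        show "k T2 \<cdot> tr T1 T2 \<cdot> cT T1 j = k T1 \<cdot> cT T1 j"
          using assoc[OF cT_hom[OF T(1) j] tr[OF T] k[OF T(2)]] tr_comp[OF T j] k_comp T j j2 by simp
      qed
      then show "(k \<circ> dec) (Cod Q w) \<cdot> onArr F w = (k \<circ> dec) (Dom Q w)" by (simp add: T1_def T2_def)
    qed
    fix Y d assume d: "cocone Q C F Y d"
    \<comment> \<open>The legs of \<open>d\<close> are indexed by codes in \<open>Q\<close>; as
      \<open>dec\<close> is a bijection, they can be read as indexed by subgraphs.\<close>
    define dT where "dT T = d (inv_into (Obj Q) dec T)" for T
    have dT_dec: "dT (dec q) = d q" if "q \<in> Obj Q" for q
      using bij_betw_inv_into_left[OF Q(2) that] by (simp add: dT_def)
    have dT: "dT T \<in> hom C (XT T) Y" if "T \<in> P" for T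
    proof -
      obtain q where q: "q \<in> Obj Q" "dec q = T" using dec_surj[OF \<open>T \<in> P\<close>] by blast
      have "d q \<in> hom C (onObj F q) Y" using d q(1) unfolding cocone_def by blast
      then show ?thesis using dT_dec[OF q(1)] q(2) by simp
    qed
    have dT_tr: "dT T' \<cdot> tr T T' = dT T" if T: "T \<in> P" "T' \<in> P" "T \<subseteq> T'" for T T'
    proof -
      obtain q q' where q: "q \<in> Obj Q" "dec q = T" "q' \<in> Obj Q" "dec q' = T'"
        using dec_surj[OF T(1)] dec_surj[OF T(2)] by blast
      then obtain w where w: "w \<in> hom Q q q'" using le[of q q'] T by blast
      have "d (Cod Q w) \<cdot> onArr F w = d (Dom Q w)"
        using d Q.homD[OF w] unfolding cocone_def by blast
      then show ?thesis using Q.homD[OF w] q dT_dec[OF q(1)] dT_dec[OF q(3)] by simp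
    qed
    have single: "{u} \<in> P" if "u \<in> Arr J" for u
      using that W by (auto simp: P_def intro: card_of_singl_ordLeq)
    \<comment> \<open>The one-arrow subgraph on the identity of \<open>j\<close> supplies a leg for
      every object \<open>j\<close>. Any other \<open>T\<close> through \<open>j\<close> gives the
      same leg, as both can be compared with \<open>T \<union> {Ide J j}\<close>.\<close>
    define a where "a j = dT {Ide J j} \<cdot> cT {Ide J j} j" for j
    have move: "dT T \<cdot> cT T j = dT T' \<cdot> cT T' j" if T: "T \<in> P" "T' \<in> P" "T \<subseteq> T'" and j: "j \<in> vertices J T" for T T' j
      using assoc[OF cT_hom[OF T(1) j] tr[OF T] dT[OF T(2)]] tr_comp[OF T j] dT_tr[OF T] by simp
    have a: "dT T \<cdot> cT T j = a j" if T: "T \<in> P" and j: "j \<in> vertices J T" for T j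
    proof -
      have jO: "j \<in> Obj J" using V[OF T] j by blast
      then have 1: "{Ide J j} \<in> P" using single by simp
      have "|T \<union> {Ide J j}| \<le>o |W|"
        using card_of_Un_ordLeq_infinite_Field[of "|W|" T "{Ide J j}"] W T 1
        by (simp add: P_def Field_card_of card_of_card_order_on)
      then have 2: "T \<union> {Ide J j} \<in> P" using T jO by (simp add: P_def)
      have "j \<in> vertices J {Ide J j}" using jO by (simp add: vertices_def)
      then show ?thesis
        unfolding a_def using move[OF T 2 Un_upper1 j] move[OF 1 2 Un_upper2] by simp
    qed
    have "cocone J C D Y a"
      unfolding cocone_def
    proof (intro conjI ballI)
      show "Y \<in> Obj C" using d by (simp add: cocone_def)
      show "a j \<in> hom C (onObj D j) Y" if "j \<in> Obj J" for j
        unfolding a_def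
        by (rule comp_hom[OF cT_hom dT]) (use that single in \<open>auto simp: vertices_def\<close>)
      fix u assume u: "u \<in> Arr J"
      have v: "Dom J u \<in> vertices J {u}" "Cod J u \<in> vertices J {u}" by (auto simp: vertices_def)
      have "a (Cod J u) \<cdot> onArr D u = dT {u} \<cdot> cT {u} (Cod J u) \<cdot> onArr D u"
        using a[OF single[OF u] v(2)] by simp
      also have "\<dots> = dT {u} \<cdot> (cT {u} (Cod J u) \<cdot> onArr D u)"
        by (rule assoc[OF is_functor_hom[OF D J.hom_arr[OF u]] cT_hom[OF single[OF u] v(2)] dT[OF single[OF u]]])
      also have "\<dots> = a (Dom J u)"
        using cT_comp[OF single[OF u], of u] a[OF single[OF u] v(1)] by simp
      finally show "a (Cod J u) \<cdot> onArr D u = a (Dom J u)" .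
    qed
    then obtain h where h: "h \<in> hom C X Y" "\<And>j. j \<in> Obj J \<Longrightarrow> h \<cdot> c j = a j"
      using colimit_ex[OF colim] by blast
    have hk: "h \<cdot> k T = dT T" if T: "T \<in> P" for T
    proof (rule eqI[OF T comp_hom[OF k[OF T] h(1)] dT[OF T]])
      fix j assume j: "j \<in> vertices J T"
      then show "h \<cdot> k T \<cdot> cT T j = dT T \<cdot> cT T j"
        using assoc[OF cT_hom[OF T j] k[OF T] h(1)] k_comp[OF T j] h(2) a[OF T j] V[OF T] by auto
    qed
    show "\<exists>!h. h \<in> hom C X Y \<and> (\<forall>q\<in>Obj Q. h \<cdot> (k \<circ> dec) q = d q)"
    proof (rule ex1I[of _ h])
      show "h \<in> hom C X Y \<and> (\<forall>q\<in>Obj Q. h \<cdot> (k \<circ> dec) q = d q)"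
        using h(1) hk dec dT_dec by simp
      fix h' assume h': "h' \<in> hom C X Y \<and> (\<forall>q\<in>Obj Q. h' \<cdot> (k \<circ> dec) q = d q)"
      have h'k: "h' \<cdot> k T = dT T" if T: "T \<in> P" for T
      proof -
        obtain q where q: "q \<in> Obj Q" "dec q = T" using dec_surj[OF T] by blast
        then show ?thesis using h' dT_dec[OF q(1)] by auto
      qed
      show "h' = h"
      proof (rule colimit_eqI[OF colim J' D])
        show "h' \<in> hom C X Y" "h \<in> hom C X Y" using h' h by auto
        fix j assume j: "j \<in> Obj J"
        then have T: "{Ide J j} \<in> P" and jv: "j \<in> vertices J {Ide J j}"
          using single by (auto simp: vertices_def)
        have "h' \<cdot> c j = h' \<cdot> k {Ide J j} \<cdot> cT {Ide J j} j"
          using assoc[OF cT_hom[OF T jv] k[OF T], of h' Y] h' k_comp[OF T jv] by simp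
        also have "\<dots> = h \<cdot> k {Ide J j} \<cdot> cT {Ide J j} j" using h'k[OF T] hk[OF T] by simp
        also have "\<dots> = h \<cdot> c j"
          using assoc[OF cT_hom[OF T jv] k[OF T] h(1)] k_comp[OF T jv] by simp
        finally show "h' \<cdot> c j = h \<cdot> c j" .
      qed
    qed
  qed
  then show ?thesis using Q(1) dir FF XT dec by (intro exI[of _ Q] exI[of _ F]) auto
qed

end

section \<open>Kernels\<close>

text \<open>A homotopy \<open>h\<close> into \<open>Y\<close> descends to a stage because
  \<open>B\<close> is compact, and its ends agree with the given maps at a later stage because
  \<open>A\<close> is. Conversely, a pair of maps into \<open>Y\<close> comes from one stage by
  compactness of \<open>A\<close>, and a homotopy found at a later stage is composed with the leg
  into \<open>Y\<close>.\<close>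

lemma (in category) all_extend_iff:
  fixes W :: "'w set"
  assumes dir: "directed W Q" and W: "infinite W" and G: "is_functor Q C G" and cc: "cocone Q C G Y y"
    and A: "compact_wrt Q C G Y y A" and B: "compact_wrt Q C G Y y B"
    and i: "i0 \<in> hom C A B" "i1 \<in> hom C A B"
  shows "(\<forall>f\<in>hom C A Y. \<forall>g\<in>hom C A Y. \<exists>h\<in>hom C B Y. h \<cdot> i0 = f \<and> h \<cdot> i1 = g) \<longleftrightarrow>
    (\<forall>q\<in>Obj Q. \<forall>x\<in>hom C A (onObj G q). \<forall>x'\<in>hom C A (onObj G q). \<exists>w\<in>Arr Q. Dom Q w = q \<and>
      (\<exists>h\<in>hom C B (onObj G (Cod Q w)). h \<cdot> i0 = onArr G w \<cdot> x \<and> h \<cdot> i1 = onArr G w \<cdot> x'))"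
    (is "?L \<longleftrightarrow> ?R")
proof
  interpret Q: category Q using directed_category[OF dir] .
  have y: "y q \<in> hom C (onObj G q) Y" if "q \<in> Obj Q" for q using cc that by (simp add: cocone_def)
  have Gw: "onArr G w \<in> hom C (onObj G p) (onObj G q)" if "w \<in> hom Q p q" for w p q
    using is_functor_hom[OF G that] .
  have yG: "y q \<cdot> (onArr G w \<cdot> x) = y p \<cdot> x" if w: "w \<in> hom Q p q" and x: "x \<in> hom C V (onObj G p)" for w p q x V
  proof -
    have "y q \<cdot> onArr G w = y p" using cc Q.homD[OF w] unfolding cocone_def by blast
    then show ?thesis using assoc[OF x Gw[OF w] y] Q.homD[OF w] by simp
  qed
  have bound: "\<exists>r\<in>Obj Q. (\<exists>a. a \<in> hom Q p r) \<and> (\<exists>b. b \<in> hom Q q r)" if "p \<in> Obj Q" "q \<in> Obj Q" for p q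
  proof -
    have "|{p}| \<le>o |W|" using W by (intro card_of_singl_ordLeq) auto
    then show ?thesis using directed_bound_insert[OF dir W, of "{p}" id q] that by auto
  qed
  {
    assume L: ?L
    show ?R
    proof (intro ballI)
      fix q x x' assume q: "q \<in> Obj Q" and x: "x \<in> hom C A (onObj G q)" and x': "x' \<in> hom C A (onObj G q)"
      obtain h where h: "h \<in> hom C B Y" "h \<cdot> i0 = y q \<cdot> x" "h \<cdot> i1 = y q \<cdot> x'"
        using L comp_hom[OF x y[OF q]] comp_hom[OF x' y[OF q]] by blast
      obtain p h' where p: "p \<in> Obj Q" and h': "h' \<in> hom C B (onObj G p)" "y p \<cdot> h' = h"
        using B h(1) unfolding compact_wrt_def by blast
      obtain r a b where r: "r \<in> Obj Q" and a: "a \<in> hom Q p r" and b: "b \<in> hom Q q r"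
        using bound[OF p q] by blast
      \<comment> \<open>Each end of the homotopy equals its prescribed map in \<open>Y\<close>,
        hence at some later stage. The two ends may need different stages \<open>r0\<close> and
        \<open>r1\<close>, which \<open>t\<close> dominates; thinness makes the two arrows from
        \<open>r\<close> to \<open>t\<close> equal.\<close>
      have ex: "\<exists>w s. w \<in> hom Q r s \<and> onArr G w \<cdot> (onArr G a \<cdot> (h' \<cdot> j)) = onArr G w \<cdot> (onArr G b \<cdot> z)"
        if j: "j \<in> hom C A B" and z: "z \<in> hom C A (onObj G q)" and eq: "h \<cdot> j = y q \<cdot> z" for j z
      proof -
        have "y r \<cdot> (onArr G a \<cdot> (h' \<cdot> j)) = y r \<cdot> (onArr G b \<cdot> z)"
          using yG[OF a comp_hom[OF j h'(1)]] yG[OF b z] assoc[OF j h'(1) y[OF p]] h'(2) eq by simp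
        moreover have "onArr G a \<cdot> (h' \<cdot> j) \<in> hom C A (onObj G r)" "onArr G b \<cdot> z \<in> hom C A (onObj G r)"
          using comp_hom[OF comp_hom[OF j h'(1)] Gw[OF a]] comp_hom[OF z Gw[OF b]] .
        ultimately obtain w where "w \<in> Arr Q" "Dom Q w = r"
          "onArr G w \<cdot> (onArr G a \<cdot> (h' \<cdot> j)) = onArr G w \<cdot> (onArr G b \<cdot> z)"
          using A r unfolding compact_wrt_def by blast
        then show ?thesis using Q.hom_arr[of w] by auto
      qed
      obtain w0 r0 where w0: "w0 \<in> hom Q r r0"
        "onArr G w0 \<cdot> (onArr G a \<cdot> (h' \<cdot> i0)) = onArr G w0 \<cdot> (onArr G b \<cdot> x)"
        using ex[OF i(1) x h(2)] by blast
      obtain w1 r1 where w1: "w1 \<in> hom Q r r1"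
        "onArr G w1 \<cdot> (onArr G a \<cdot> (h' \<cdot> i1)) = onArr G w1 \<cdot> (onArr G b \<cdot> x')"
        using ex[OF i(2) x' h(3)] by blast
      obtain t t0 t1 where t: "t \<in> Obj Q" and t0: "t0 \<in> hom Q r0 t" and t1: "t1 \<in> hom Q r1 t"
        using bound[of r0 r1] Q.homD[OF w0(1)] Q.homD[OF w1(1)] by blast
      define z where "z = Cmp Q t0 w0"
      have z: "z \<in> hom Q r t" unfolding z_def using Q.comp_hom[OF w0(1) t0] .
      have z': "z = Cmp Q t1 w1" using directed_thin[OF dir z Q.comp_hom[OF w1(1) t1]] .
      have Gz: "onArr G z = onArr G t0 \<cdot> onArr G w0" "onArr G z = onArr G t1 \<cdot> onArr G w1"
        using is_functor_comp[OF G w0(1) t0] is_functor_comp[OF G w1(1) t1] z' by (simp_all add: z_def)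
      note ah = comp_hom[OF comp_hom[OF i(1) h'(1)] Gw[OF a]] comp_hom[OF comp_hom[OF i(2) h'(1)] Gw[OF a]]
      note bx = comp_hom[OF x Gw[OF b]] comp_hom[OF x' Gw[OF b]]
      have "onArr G z \<cdot> (onArr G a \<cdot> (h' \<cdot> i0)) = onArr G z \<cdot> (onArr G b \<cdot> x)"
        unfolding Gz(1) using assoc[OF ah(1) Gw[OF w0(1)] Gw[OF t0]] assoc[OF bx(1) Gw[OF w0(1)] Gw[OF t0]]
          w0(2) by simp
      moreover have "onArr G z \<cdot> (onArr G a \<cdot> (h' \<cdot> i1)) = onArr G z \<cdot> (onArr G b \<cdot> x')"
        unfolding Gz(2) using assoc[OF ah(2) Gw[OF w1(1)] Gw[OF t1]] assoc[OF bx(2) Gw[OF w1(1)] Gw[OF t1]]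
          w1(2) by simp
      moreover define h'' where "h'' = onArr G z \<cdot> (onArr G a \<cdot> h')"
      have ah': "onArr G a \<cdot> h' \<in> hom C B (onObj G r)" using comp_hom[OF h'(1) Gw[OF a]] .
      then have h'': "h'' \<in> hom C B (onObj G t)" unfolding h''_def using comp_hom[OF _ Gw[OF z]] by blast
      moreover have "h'' \<cdot> j = onArr G z \<cdot> (onArr G a \<cdot> (h' \<cdot> j))" if "j \<in> hom C A B" for j
        unfolding h''_def using assoc[OF that ah' Gw[OF z]] assoc[OF that h'(1) Gw[OF a]] by simp
      moreover have "onArr G (Cmp Q z b) \<cdot> v = onArr G z \<cdot> (onArr G b \<cdot> v)" if "v \<in> hom C A (onObj G q)" for v
        using assoc[OF that Gw[OF b] Gw[OF z]] is_functor_comp[OF G b z] by simp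
      ultimately have "h'' \<cdot> i0 = onArr G (Cmp Q z b) \<cdot> x" "h'' \<cdot> i1 = onArr G (Cmp Q z b) \<cdot> x'"
        using i x x' by simp_all
      then show "\<exists>w\<in>Arr Q. Dom Q w = q \<and>
          (\<exists>h\<in>hom C B (onObj G (Cod Q w)). h \<cdot> i0 = onArr G w \<cdot> x \<and> h \<cdot> i1 = onArr G w \<cdot> x')"
        using h'' Q.homD[OF Q.comp_hom[OF b z]] by auto
    qed
  next
    assume R: ?R
    show ?L
    proof (intro ballI)
      fix f g assume "f \<in> hom C A Y" "g \<in> hom C A Y"
      then obtain p x p' x' where p: "p \<in> Obj Q" and x: "x \<in> hom C A (onObj G p)" "y p \<cdot> x = f"
        and p': "p' \<in> Obj Q" and x': "x' \<in> hom C A (onObj G p')" "y p' \<cdot> x' = g"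
        using A unfolding compact_wrt_def by metis
      obtain q a b where q: "q \<in> Obj Q" and a: "a \<in> hom Q p q" and b: "b \<in> hom Q p' q"
        using bound[OF p p'] by blast
      note xx = comp_hom[OF x(1) Gw[OF a]] comp_hom[OF x'(1) Gw[OF b]]
      obtain w h where w: "w \<in> Arr Q" "Dom Q w = q" and h: "h \<in> hom C B (onObj G (Cod Q w))"
        "h \<cdot> i0 = onArr G w \<cdot> (onArr G a \<cdot> x)" "h \<cdot> i1 = onArr G w \<cdot> (onArr G b \<cdot> x')"
        using R q xx by blast
      have w': "w \<in> hom Q q (Cod Q w)" using w Q.hom_arr by blast
      have yw: "y (Cod Q w) \<in> hom C (onObj G (Cod Q w)) Y" using y w by simp
      have "y (Cod Q w) \<cdot> h \<cdot> i0 = f" "y (Cod Q w) \<cdot> h \<cdot> i1 = g"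
        using assoc[OF i(1) h(1) yw] assoc[OF i(2) h(1) yw] h(2,3) yG[OF w' xx(1)] yG[OF w' xx(2)]
          yG[OF a x(1)] yG[OF b x'(1)] x(2) x'(2) by simp_all
      then show "\<exists>h\<in>hom C B Y. h \<cdot> i0 = f \<and> h \<cdot> i1 = g" using comp_hom[OF h(1) yw] by blast
    qed
  }
qed

theorem theorem4p1:
  fixes \<kappa> lam :: "'u rel"
    and K :: "('o, 'm) model_cat"
    and Rf Rc :: "('o, 'm, 'o, 'm) ftor"
  assumes "inaccessible \<kappa>"
    and "regular_cardinal lam" and "lam <o \<kappa>"
    and "strongly_combinatorial \<kappa> lam K"
    and "pointed K"
    and "strong_replacements \<kappa> lam K Rf Rc"
  shows "small \<kappa> {kernel K Rf Rc H | H.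
           is_functor K K H \<and> preserves_filtered_colimits \<kappa> lam K K H \<and> preserves_zero K K H}"
proof -
  have univ: "universe \<kappa>" using assms(1) by unfold_locales
  have mod: "model_category \<kappa> K" and lp: "locally_presentable_at \<kappa> lam K"
    using assms(4) by (simp_all add: strongly_combinatorial_def combinatorial_def)
  then have "is_category K" and ls: "locally_small \<kappa> K" and coc: "cocomplete \<kappa> K"
    unfolding locally_presentable_at_def by simp_all
  interpret model_in_universe \<kappa> K
    by (intro model_in_universe.intro univ model.intro category.intro model_axioms.intro) fact+
  obtain \<A> where gen: "weak_generator \<kappa> (Ho K) \<A>"
    using assms(4) by (auto simp: strongly_combinatorial_def)
  then have sm\<A>: "small \<kappa> \<A>"
    by (simp add: weak_generator_def small_category_def full_subcat_def)
  have "\<A> \<subseteq> Obj (Ho K)" using gen by (simp add: weak_generator_def)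
  then have \<A>: "cofibrant K A" "A \<in> Obj K" if "A \<in> \<A>" for A
    using that by (auto simp: Ho_def quotient_cat_def Kcf_def full_subcat_def cofibrant_def)
  have "\<forall>A\<in>\<A>. \<exists>B i0 i1 s. good_cylinder K A B i0 i1 s"
    using ex_good_cylinder \<A> by blast
  then obtain B i0 i1 s where good: "\<And>A. A \<in> \<A> \<Longrightarrow> good_cylinder K A (B A) (i0 A) (i1 A) (s A)"
    by metis
  have i: "i0 A \<in> hom K A (B A)" "i1 A \<in> hom K A (B A)" if "A \<in> \<A>" for A
    using cylinder_hom[of A "B A" "i0 A" "i1 A" "s A"] good[OF that] by (simp_all add: good_cylinder_def)
  have B: "B A \<in> Obj K" if "A \<in> \<A>" for A using homD[OF i(1)[OF that]] by simp
  obtain S where smS: "small \<kappa> S" and S: "\<And>A. A \<in> S \<Longrightarrow> presentable \<kappa> lam K A"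
    and "\<forall>X\<in>Obj K. \<exists>(J :: ('u, 'u) cat) D c. small_category \<kappa> J \<and> filtered lam J \<and> is_functor J K D \<and>
           (\<forall>j\<in>Obj J. onObj D j \<in> S) \<and> colimit J K D X c"
    using lp unfolding locally_presentable_at_def by blast
  then obtain I :: "'o \<Rightarrow> ('u, 'u) cat" and E e
    where I: "\<And>X. X \<in> Obj K \<Longrightarrow> small_category \<kappa> (I X) \<and> is_functor (I X) K (E X) \<and>
           (\<forall>j\<in>Obj (I X). onObj (E X) j \<in> S) \<and> colimit (I X) K (E X) X (e X)"
    by metis
  \<comment> \<open>\<open>Field lam\<close> makes \<open>W\<close> infinite and turns directedness
    for \<open>W\<close> into \<open>lam\<close>-filteredness. The other terms bound the
    presentations of all generators and of all their cylinders at once.\<close>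
  define W where "W = Field lam \<union> (\<Union>A\<in>\<A>. Arr (I A) \<union> Arr (I (B A)))"
  have "|Field lam| =o lam" and "infinite (Field lam)"
    using assms(2) card_of_Field_ordIso by (auto simp: regular_cardinal_def cinfinite_def)
  then have W: "infinite W" and lamW: "lam \<le>o |W|" and "small \<kappa> (Field lam)"
    using ordIso_ordLeq_trans[OF ordIso_symmetric[of "|Field lam|" lam] card_of_mono1[of "Field lam" W]]
      ordIso_ordLess_trans[OF _ assms(3)] by (auto simp: W_def small_def)
  then have smW: "small \<kappa> W"
    unfolding W_def using I \<A> B sm\<A>
    by (intro small_Un small_UN) (auto simp: small_category_def)
  define S' where "S' = subcolimits K W S"
  have smS': "small \<kappa> S'" unfolding S'_def by (rule small_subcolimits[OF univ ls smS smW])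
  define M where "M = {f \<in> Arr K. Dom K f \<in> S' \<and> Cod K f \<in> S'}"
  have smM: "small \<kappa> M" unfolding M_def by (rule small_arrows_between[OF univ ls smS'])
  have "\<forall>X\<in>Obj K. \<exists>(Q :: ('u, 'u) cat) F d. small_category \<kappa> Q \<and> directed W Q \<and> is_functor Q K F \<and>
      (\<forall>q\<in>Obj Q. onObj F q \<in> S') \<and> colimit Q K F X d"
    unfolding S'_def using directed_subcolimits[OF univ _ _ _ coc W] I by (metis image_subsetI)
  then obtain Q :: "'o \<Rightarrow> ('u, 'u) cat" and F d
    where Q: "\<And>X. X \<in> Obj K \<Longrightarrow> small_category \<kappa> (Q X)" "\<And>X. X \<in> Obj K \<Longrightarrow> directed W (Q X)"
      and F: "\<And>X. X \<in> Obj K \<Longrightarrow> is_functor (Q X) K (F X)"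
        "\<And>X q. X \<in> Obj K \<Longrightarrow> q \<in> Obj (Q X) \<Longrightarrow> onObj (F X) q \<in> S'"
      and d: "\<And>X. X \<in> Obj K \<Longrightarrow> colimit (Q X) K (F X) X (d X)"
    by metis
  \<comment> \<open>The chosen presentation of \<open>X\<close> consists of
    \<open>lam\<close>-presentable objects, each compact relative to the given diagram, and has few
    enough arrows for its colimit to inherit this.\<close>
  have compact: "compact_wrt J K G Y y X"
    if J: "small_category \<kappa> J" "directed W J" and G: "is_functor J K G" "colimit J K G Y y"
      and X: "X \<in> Obj K" "|Arr (I X)| \<le>o |W|" for X Y y G and J :: "('u, 'u) cat"
  proof (rule compact_wrt_colimit[OF J(2) W G(1), where I = "I X" and E = "E X" and e = "e X"])
    show "cocone J K G Y y" using G(2) by (simp add: colimit_def)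
    show "category (I X)" using I[OF X(1)] by (simp add: small_category_def category_def)
    show "compact_wrt J K G Y y (onObj (E X) i)" if "i \<in> Obj (I X)" for i
      using presentable_compact_wrt[OF univ S ls J(1) directed_filtered[OF J(2) lamW] J(2) W G]
        I[OF X(1)] that by blast
  qed (use I[OF X(1)] X(2) in auto)
  have cardA: "|Arr (I A)| \<le>o |W|" "|Arr (I (B A))| \<le>o |W|" if "A \<in> \<A>" for A
    using that by (auto simp: W_def intro!: card_of_mono1)
  define extends where "extends A Y f g \<longleftrightarrow> (\<exists>h\<in>hom K (B A) Y. h \<cdot> i0 A = f \<and> h \<cdot> i1 A = g)" for A Y f g
  define ann where "ann Z A Y x x' =
    {u \<in> M. Dom K u = Y \<and> extends A (onObj Z (Cod K u)) (onArr Z u \<cdot> x) (onArr Z u \<cdot> x')}"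
    for Z :: "('o, 'm, 'o, 'm) ftor" and A Y x x'
  \<comment> \<open>The pair \<open>x\<close>, \<open>x'\<close> itself is forgotten: it lives in
    hom-sets that depend on \<open>Z\<close>, while the annihilators are subsets of the fixed set
    \<open>M\<close>.\<close>
  define anns where "anns Z = {(A, Y, ann Z A Y x x') | A Y x x'.
      A \<in> \<A> \<and> Y \<in> S' \<and> x \<in> hom K A (onObj Z Y) \<and> x' \<in> hom K A (onObj Z Y)}"
    for Z :: "('o, 'm, 'o, 'm) ftor"
  \<comment> \<open>A functor enters \<open>ker\<close> only through \<open>N\<close>; the diagrams
    \<open>Q X\<close> and \<open>F X\<close> are the same for all functors.\<close>
  define ker where "ker N = {X \<in> Obj K. \<forall>A\<in>\<A>. \<forall>q\<in>Obj (Q X). \<forall>\<alpha>. (A, onObj (F X) q, \<alpha>) \<in> N \<longrightarrow>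
      (\<exists>w\<in>Arr (Q X). Dom (Q X) w = q \<and> onArr (F X) w \<in> \<alpha>)}"
    for N :: "('o \<times> 'o \<times> 'm set) set"
  have R: "is_functor K K Rf" "is_functor K K Rc"
      "preserves_filtered_colimits \<kappa> lam K K Rf" "preserves_filtered_colimits \<kappa> lam K K Rc"
      "\<And>X. X \<in> Obj K \<Longrightarrow> fibrant K (onObj Rf X)" "\<And>X. X \<in> Obj K \<Longrightarrow> cofibrant K (onObj Rc X)"
    using assms(6) unfolding strong_replacements_def fibrant_replacement_def cofibrant_replacement_def
    by blast+
  \<comment> \<open>The map \<open>Rc X \<rightarrow> X\<close> is a fibration, so composing it with
    \<open>X \<rightarrow> T\<close> shows that \<open>Rc\<close> keeps objects fibrant. The values
    of \<open>Z\<close> are thus objects of \<open>Ho K\<close>.\<close>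
  have RcRf: "fibrant K (onObj Rc X)" if X: "fibrant K X" for X
  proof -
    obtain T p where T: "terminal K T" and p: "p \<in> hom K X T" "p \<in> Fib K"
      using X unfolding fibrant_def by blast
    obtain r where r: "r \<in> hom K (onObj Rc X) X" "r \<in> Fib K"
      using assms(6) X unfolding strong_replacements_def cofibrant_replacement_def nat_trans_def fibrant_def
      by (auto simp: id_ftor_def)
    show ?thesis
      unfolding fibrant_def using T comp_hom[OF r(1) p(1)] Fib_comp[OF r p] homD[OF r(1)] by blast
  qed
  have "kernel K Rf Rc H = ker (anns (comp_ftor Rc (comp_ftor Rf H)))"
    if H: "is_functor K K H" "preserves_filtered_colimits \<kappa> lam K K H" for H
  proof -
    define Z where "Z = comp_ftor Rc (comp_ftor Rf H)"
    have Z: "is_functor K K Z" "preserves_filtered_colimits \<kappa> lam K K Z"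
      unfolding Z_def
      by (intro is_functor_comp_ftor[OF is_functor_comp_ftor[OF H(1) R(1)] R(2)]
          preserves_filtered_colimits_comp_ftor[OF preserves_filtered_colimits_comp_ftor[OF H(2,1) R(3)]
            is_functor_comp_ftor[OF H(1) R(1)] R(4)])+
    have "terminal (Ho K) (onObj Z X) \<longleftrightarrow> (\<forall>A\<in>\<A>. \<forall>q\<in>Obj (Q X). \<forall>\<alpha>. (A, onObj (F X) q, \<alpha>) \<in> anns Z \<longrightarrow>
      (\<exists>w\<in>Arr (Q X). Dom (Q X) w = q \<and> onArr (F X) w \<in> \<alpha>))" if X: "X \<in> Obj K" for X
    proof -
      have "onObj H X \<in> Obj K" using H(1) X by (simp add: is_functor_def)
      then have fib: "fibrant K (onObj Rf (onObj H X))" by (rule R(5))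
      then have ZX: "fibrant K (onObj Z X)" "cofibrant K (onObj Z X)"
        unfolding Z_def using RcRf R(6) by (simp_all add: fibrant_def)
      let ?G = "comp_ftor Z (F X)" and ?y = "onArr Z \<circ> d X"
      have G: "is_functor (Q X) K ?G" using is_functor_comp_ftor[OF F(1)[OF X] Z(1)] .
      have colim: "colimit (Q X) K ?G (onObj Z X) ?y"
        using Z(2) Q[OF X] directed_filtered[OF Q(2)[OF X] lamW] F(1)[OF X] d[OF X]
        unfolding preserves_filtered_colimits_def by blast
      have cc: "cocone (Q X) K ?G (onObj Z X) ?y" using colim by (simp add: colimit_def)
      interpret Q: category "Q X" using directed_category[OF Q(2)[OF X]] .
      have Fw: "onArr (F X) w \<in> M" "Dom K (onArr (F X) w) = onObj (F X) (Dom (Q X) w)"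
        "Cod K (onArr (F X) w) = onObj (F X) (Cod (Q X) w)" if w: "w \<in> Arr (Q X)" for w
        using homD[OF is_functor_hom[OF F(1)[OF X] Q.hom_arr[OF w]]] F(2)[OF X] w by (auto simp: M_def)
      have "terminal (Ho K) (onObj Z X) \<longleftrightarrow>
          (\<forall>A\<in>\<A>. \<forall>f\<in>hom K A (onObj Z X). \<forall>g\<in>hom K A (onObj Z X). extends A (onObj Z X) f g)"
        unfolding terminal_Ho_iff[OF gen assms(5) ZX] extends_def
        using homotopy_iff[OF \<A>(1) ZX(1) good] by (intro ball_cong refl) auto
      also have "\<dots> \<longleftrightarrow> (\<forall>A\<in>\<A>. \<forall>q\<in>Obj (Q X). \<forall>x\<in>hom K A (onObj ?G q). \<forall>x'\<in>hom K A (onObj ?G q).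
          \<exists>w\<in>Arr (Q X). Dom (Q X) w = q \<and> extends A (onObj ?G (Cod (Q X) w)) (onArr ?G w \<cdot> x) (onArr ?G w \<cdot> x'))"
        unfolding extends_def
        by (intro ball_cong refl all_extend_iff[OF Q(2)[OF X] W G cc]
            compact[OF Q(1,2)[OF X] G colim] \<A> B i cardA)
      \<comment> \<open>All stages lie in \<open>S'\<close>, so every transition map of
        \<open>F X\<close> lies in \<open>M\<close>, where annihilators are formed.\<close>
      also have "\<dots> \<longleftrightarrow> (\<forall>A\<in>\<A>. \<forall>q\<in>Obj (Q X). \<forall>x\<in>hom K A (onObj ?G q). \<forall>x'\<in>hom K A (onObj ?G q).
          \<exists>w\<in>Arr (Q X). Dom (Q X) w = q \<and> onArr (F X) w \<in> ann Z A (onObj (F X) q) x x')"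
        using Fw by (intro ball_cong bex_cong refl) (auto simp: ann_def)
      \<comment> \<open>The inner condition depends on \<open>x\<close> and \<open>x'\<close> only
        through their annihilator, so the quantifier over pairs may run over annihilators
        instead.\<close>
      also have "\<dots> \<longleftrightarrow> (\<forall>A\<in>\<A>. \<forall>q\<in>Obj (Q X). \<forall>\<alpha>. (A, onObj (F X) q, \<alpha>) \<in> anns Z \<longrightarrow>
          (\<exists>w\<in>Arr (Q X). Dom (Q X) w = q \<and> onArr (F X) w \<in> \<alpha>))"
        using F(2)[OF X] by (intro ball_cong refl) (simp add: anns_def, blast)
      finally show ?thesis .
    qed
    then show ?thesis
      by (auto simp: kernel_def proj_Ho_def quotient_ftor_def ker_def Z_def)
  qed
  \<comment> \<open>The bound does not mention \<open>Z\<close>: all kernels are values of the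
    single function \<open>ker\<close> on one small set.\<close>
  moreover have "anns Z \<in> Pow (\<A> \<times> S' \<times> Pow M)" for Z
    by (auto simp: anns_def ann_def)
  ultimately have "{kernel K Rf Rc H | H.
      is_functor K K H \<and> preserves_filtered_colimits \<kappa> lam K K H \<and> preserves_zero K K H}
      \<subseteq> ker ` Pow (\<A> \<times> S' \<times> Pow M)"
    by auto
  moreover have "small \<kappa> (ker ` Pow (\<A> \<times> S' \<times> Pow M))"
    by (intro small_image small_Pow small_Sigma sm\<A> smS' smM)
  ultimately show ?thesis by (rule small_subset[rotated])
qed

end
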